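(* Let $n\ge1$, $q\in(0,1)$, $a\in\mathbb{R}^n_{>0}$, and let $w_1,w_2,\dots$ be independent letters of $[n,\bar n]$ with distribution $\rho(l)=a_l/\sum_{i=1}^n(a_i+a_i^{-1})$, $\rho(\bar l)=a_l^{-1}/\sum_{i=1}^n(a_i+a_i^{-1})$. Let $Z(0)=\mathbf 0$ and let $Z(m)$ be obtained from $Z(m-1)$ by $q$-Berele insertion of $w_m$ (independent randomness at each step), and set $f^m=z^{2n}(m)$. Then: (1) $(Z(m))_{m\ge0}$ is a Markov chain on $\mathbb{K}^{2n}$ with transition kernel $M(Z,\tilde Z)=\sum_{l\in[n,\bar n]}\rho(l)I_l(Z,\tilde Z)$; (2) $(f^m)_{m\ge0}$ is a Markov chain on $\Lambda_n$ with transition kernel $\Pi(\mu,\lambda)=\frac{1}{\sum_{i=1}^n(a_i+a_i^{-1})}\frac{P^{(n)}_\lambda(a;q)}{P^{(n)}_\mu(a;q)}L_n(\mu,\lambda)$; (3) for every $m\ge1$, the conditional law of $Z(m)$ given $f^1,\dots,f^m$ with $f^m=\lambda$ is $\mathbb{P}(Z(m)=Z\mid f^1,\dots,f^m;\,f^m=\lambda)=\frac{a^Z\kappa_n(Z)\mathbb{1}_{z^{2n}=\lambda}}{P^{(n)}_\lambda(a;q)}$; (4) $\mathbb{P}(f^m=\lambda)=\frac{1}{(\sum_{i=1}^n(a_i+a_i^{-1}))^m}P^{(n)}_\lambda(a;q)Q^\lambda_m(n;q)$, where $Q^\lambda_m(n;q)=\sum_{f\in\mathcal{O}_m(n):\,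f^m=\lambda}\prod_{i=1}^mL_n(f^{i-1},f^i)$.
   Context: $\Lambda_l$: weakly decreasing $l$-tuples of nonnegative integers; $|x|=\sum x_i$; $e_i$ unit vectors. For tuples $x,y$ (coordinates beyond length $=0$), $x\preceq y$ means $y_i\ge x_i\ge y_{i+1}$ for all $i$. $\mathbb{K}^{2n}$: patterns $Z=(z^1,\dots,z^{2n})$ with $z^{2l-1},z^{2l}\in\Lambda_l$ and $z^1\preceq\dots\preceq z^{2n}$; $\mathbb{K}^{2n}[\lambda]$ those with $z^{2n}=\lambda$; $\mathbf 0$ is the all-zero pattern. Alphabet $[n,\bar n]=\{1<\bar1<\dots<n<\bar n\}$, $\mathrm{order}(l)=2l-1$, $\mathrm{order}(\bar l)=2l$. $\binom{N}{k}_q=\frac{(q;q)_N}{(q;q)_k(q;q)_{N-k}}$, $(q;q)_k=\prod_{j=1}^k(1-q^j)$. $a^Z=\prod_{i=1}^na_i^{2|z^{2i-1}|-|z^{2i}|-|z^{2i-2}|}$ ($|z^0|=0$), $\kappa_n(Z)=\prod_{k=1}^n\Big[\Big(\prod_{i=1}^{k-1}\binom{z^{2k-1}_i-z^{2k-1}_{i+1}}{z^{2k-1}_i-z^{2k-2}_i}_q\binom{z^{2k}_i-z^{2k}_{i+1}}{z^{2k}_i-z^{2k-1}_i}_q\Big)\binom{z^{2k}_k}{z^{2k}_k-z^{2k-1}_k}_q\Big]$, $P^{(n)}_\lambda(a;q)=\sum_{Z\in\mathbb{K}^{2n}[\lambda]}a^Z\kappa_n(Z)$. Oscillating tableaux: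 $f=(f^0,\dots,f^m)$, $f^0=\emptyset$, consecutive partitions differ by adding or removing one box; $\mathcal{O}_m(n)$ those with all $f^i\in\Lambda_n$. $L_n(\lambda,\lambda+e_i)=u^+_{n,i}(\lambda)$, $L_n(\lambda,\lambda-e_i)=u^-_{n,i}(\lambda)$, $0$ otherwise, $u^+_{n,1}=1$, $u^+_{n,i}(\lambda)=1-q^{\lambda_{i-1}-\lambda_i}$ ($1<i\le n$), $u^-_{n,i}(\lambda)=1-q^{\lambda_i-\lambda_{i+1}}$ ($i<n$), $u^-_{n,n}(\lambda)=1-q^{\lambda_n}$. $q$-Berele insertion: for interlacing $x\preceq y$, $r_i(y;x)=q^{y_i-x_i}\frac{1-q^{x_{i-1}-y_i}}{1-q^{x_{i-1}-x_i}}$, $l_i(y;x)=q^{x_i-y_{i+1}}\frac{1-q^{y_{i+1}-x_{i+1}}}{1-q^{x_i-x_{i+1}}}$ with $x_0=+\infty$ and coordinates beyond length $0$. Inserting letter $l$ into $Z$ makes $z^k_1$, $k=\mathrm{order}(l)$, attempt a right jump (increase by 1); moves propagate downward, with probabilities evaluated at the configuration of levels $k,k+1$ before $z^k_i$ moves. If $z^k_i$ attempts a right jump: if $k=2n$ it is performed; if $k$ odd and $i=(k+1)/2$, with probability $r_i(z^{k+1};z^k)$ it is performed and $z^{k+1}_i$ attempts a right jump, otherwise it is suppressed and $z^{k+1}_i$ performs a left jump; otherwise it is performed and with probability $r_i(z^{k+1};z^k)$ $z^{k+1}_i$ attempts a right jump, else $z^{k+1}_{i+1}$ attempts a right jump.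 If $z^k_i$ performs a left jump and $k<2n$, then with probability $l_i(z^{k+1};z^k)$ $z^{k+1}_{i+1}$ performs a left jump, else $z^{k+1}_i$ does. $I_l(Z,\tilde Z)$ is the probability of reaching $\tilde Z$. *)

theory Defs
  imports "HOL-Probability.Probability"
begin

text \<open>
  Tuples are lists and patterns are lists of lists.  The mathematics counts both coordinates and
  levels from 1, and \<open>coord\<close>, \<open>level\<close> and \<open>entry\<close> implement this numbering.  Subtractions of
  coordinates are on type nat; none of them truncates as long as the tuples involved interlace.
\<close>

definition coord :: "nat list \<Rightarrow> nat \<Rightarrow> nat" where
  "coord x i = (if 1 \<le> i \<and> i \<le> length x then x ! (i - 1) else 0)"

definition tuples :: "nat \<Rightarrow> nat list set" where
  "tuples l = {x. length x = l \<and> sorted_wrt (\<ge>) x}"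

definition interlaces :: "nat list \<Rightarrow> nat list \<Rightarrow> bool" where
  "interlaces x y \<longleftrightarrow> (\<forall>i\<ge>1. coord y i \<ge> coord x i \<and> coord x i \<ge> coord y (i + 1))"

type_synonym pattern = "nat list list"

definition level :: "pattern \<Rightarrow> nat \<Rightarrow> nat list" where
  "level Z k = (if k = 0 then [] else Z ! (k - 1))"

definition entry :: "pattern \<Rightarrow> nat \<Rightarrow> nat \<Rightarrow> nat" where
  "entry Z k i = coord (level Z k) i"

definition patterns :: "nat \<Rightarrow> pattern set" where
  "patterns n = {Z. length Z = 2 * n
     \<and> (\<forall>l\<in>{1..n}. level Z (2 * l - 1) \<in> tuples l \<and> level Z (2 * l) \<in> tuples l)
     \<and> (\<forall>k\<in>{1..<2 * n}. interlaces (level Z k) (level Z (k + 1)))}"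

definition patterns_of_shape :: "nat \<Rightarrow> nat list \<Rightarrow> pattern set" where
  "patterns_of_shape n lam = {Z \<in> patterns n. level Z (2 * n) = lam}"

definition zero_pattern :: "nat \<Rightarrow> pattern" where
  "zero_pattern n = map (\<lambda>k. replicate ((k + 1) div 2) 0) [1..<2 * n + 1]"

definition qpoch :: "real \<Rightarrow> nat \<Rightarrow> real" where
  "qpoch q k = (\<Prod>j=1..k. 1 - q ^ j)"

definition qbinom :: "real \<Rightarrow> nat \<Rightarrow> nat \<Rightarrow> real" where
  "qbinom q N k = qpoch q N / (qpoch q k * qpoch q (N - k))"

definition pattern_monomial :: "nat \<Rightarrow> (nat \<Rightarrow> real) \<Rightarrow> pattern \<Rightarrow> real" where
  "pattern_monomial n a Z = (\<Prod>i=1..n. a i powi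
     (2 * int (sum_list (level Z (2 * i - 1))) - int (sum_list (level Z (2 * i)))
        - int (sum_list (level Z (2 * i - 2)))))"

definition kappa :: "nat \<Rightarrow> real \<Rightarrow> pattern \<Rightarrow> real" where
  "kappa n q Z = (\<Prod>k=1..n.
     (\<Prod>i=1..k - 1.
        qbinom q (entry Z (2 * k - 1) i - entry Z (2 * k - 1) (i + 1))
                 (entry Z (2 * k - 1) i - entry Z (2 * k - 2) i)
      * qbinom q (entry Z (2 * k) i - entry Z (2 * k) (i + 1))
                 (entry Z (2 * k) i - entry Z (2 * k - 1) i))
     * qbinom q (entry Z (2 * k) k) (entry Z (2 * k) k - entry Z (2 * k - 1) k))"

definition qP :: "nat \<Rightarrow> real \<Rightarrow> (nat \<Rightarrow> real) \<Rightarrow> nat list \<Rightarrow> real" where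
  "qP n q a lam = (\<Sum>Z\<in>patterns_of_shape n lam. pattern_monomial n a Z * kappa n q Z)"

definition add_box :: "nat list \<Rightarrow> nat \<Rightarrow> nat list" where
  "add_box x i = x[i - 1 := x ! (i - 1) + 1]"

definition remove_box :: "nat list \<Rightarrow> nat \<Rightarrow> nat list" where
  "remove_box x i = x[i - 1 := x ! (i - 1) - 1]"

definition u_plus :: "real \<Rightarrow> nat \<Rightarrow> nat list \<Rightarrow> real" where
  "u_plus q i lam = (if i = 1 then 1 else 1 - q ^ (coord lam (i - 1) - coord lam i))"

definition u_minus :: "nat \<Rightarrow> real \<Rightarrow> nat \<Rightarrow> nat list \<Rightarrow> real" where
  "u_minus n q i lam =
     (if i < n then 1 - q ^ (coord lam i - coord lam (i + 1)) else 1 - q ^ coord lam n)"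

text \<open>
  At most one summand below is nonzero, since \<open>\<mu>\<close> and \<open>\<lambda>\<close> determine the sign and the
  position of the box.  The condition \<open>\<lambda> = \<mu> - e\<^sub>i\<close> is written as \<open>\<mu> = \<lambda> + e\<^sub>i\<close>.
\<close>

definition Lweight :: "nat \<Rightarrow> real \<Rightarrow> nat list \<Rightarrow> nat list \<Rightarrow> real" where
  "Lweight n q mu lam =
     (\<Sum>i=1..n. (if lam = add_box mu i then u_plus q i mu else 0)
              + (if mu = add_box lam i then u_minus n q i mu else 0))"

text \<open>A tableau \<open>(f\<^sup>0, \<dots>, f\<^sup>m)\<close> with all entries in \<open>tuples n\<close> is a list of length \<open>m + 1\<close>.\<close>

definition osc_tableaux :: "nat \<Rightarrow> nat \<Rightarrow> nat list list set" where
  "osc_tableaux n m = {f. length f = m + 1 \<and> set f \<subseteq> tuples n \<and> f ! 0 = replicate n 0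
     \<and> (\<forall>j<m. \<exists>i\<in>{1..n}. f ! (j + 1) = add_box (f ! j) i \<or> f ! j = add_box (f ! (j + 1)) i)}"

definition Qfun :: "nat \<Rightarrow> real \<Rightarrow> nat \<Rightarrow> nat list \<Rightarrow> real" where
  "Qfun n q m lam =
     (\<Sum>f\<in>{f \<in> osc_tableaux n m. f ! m = lam}. \<Prod>i=1..m. Lweight n q (f ! (i - 1)) (f ! i))"

datatype letter = Plain nat | Barred nat

fun letter_order :: "letter \<Rightarrow> nat" where
  "letter_order (Plain l) = 2 * l - 1"
| "letter_order (Barred l) = 2 * l"

definition alphabet :: "nat \<Rightarrow> letter set" where
  "alphabet n = Plain ` {1..n} \<union> Barred ` {1..n}"

definition normalizer :: "nat \<Rightarrow> (nat \<Rightarrow> real) \<Rightarrow> real" where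
  "normalizer n a = (\<Sum>i=1..n. a i + inverse (a i))"

fun letter_prob :: "nat \<Rightarrow> (nat \<Rightarrow> real) \<Rightarrow> letter \<Rightarrow> real" where
  "letter_prob n a (Plain l) = a l / normalizer n a"
| "letter_prob n a (Barred l) = inverse (a l) / normalizer n a"

text \<open>
  The case \<open>i = 1\<close> is the convention \<open>x\<^sub>0 = +\<infinity>\<close>.  For \<open>0 < q < 1\<close> and interlacing \<open>x\<close>, \<open>y\<close> both
  quantities lie in \<open>[0, 1]\<close>, so the truncation built into \<open>bernoulli_pmf\<close> has no effect when
  inserting into a pattern; the degenerate quotients \<open>0 / 0\<close> arise with probability 0 only.
\<close>

definition rprob :: "real \<Rightarrow> nat \<Rightarrow> nat list \<Rightarrow> nat list \<Rightarrow> real" where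
  "rprob q i y x =
     (if i = 1 then q ^ (coord y 1 - coord x 1)
      else q ^ (coord y i - coord x i) * ((1 - q ^ (coord x (i - 1) - coord y i))
             / (1 - q ^ (coord x (i - 1) - coord x i))))"

definition lprob :: "real \<Rightarrow> nat \<Rightarrow> nat list \<Rightarrow> nat list \<Rightarrow> real" where
  "lprob q i y x = q ^ (coord x i - coord y (i + 1)) *
     ((1 - q ^ (coord y (i + 1) - coord x (i + 1))) / (1 - q ^ (coord x i - coord x (i + 1))))"

definition move_right :: "nat \<Rightarrow> nat \<Rightarrow> pattern \<Rightarrow> pattern" where
  "move_right k i Z = Z[k - 1 := add_box (level Z k) i]"

definition move_left :: "nat \<Rightarrow> nat \<Rightarrow> pattern \<Rightarrow> pattern" where
  "move_left k i Z = Z[k - 1 := remove_box (level Z k) i]"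

function left_jump :: "nat \<Rightarrow> real \<Rightarrow> nat \<Rightarrow> nat \<Rightarrow> pattern \<Rightarrow> pattern pmf" where
  "left_jump n q k i Z =
     (if k < 2 * n then
        do {
          b \<leftarrow> bernoulli_pmf (lprob q i (level Z (k + 1)) (level Z k));
          left_jump n q (k + 1) (if b then i + 1 else i) (move_left k i Z)
        }
      else return_pmf (move_left k i Z))"
  by pat_completeness auto
termination
  by (relation "Wellfounded.measure (\<lambda>(n, q, k, i, Z). 2 * n - k)") auto

declare left_jump.simps [simp del]

function right_attempt :: "nat \<Rightarrow> real \<Rightarrow> nat \<Rightarrow> nat \<Rightarrow> pattern \<Rightarrow> pattern pmf" where
  "right_attempt n q k i Z =
     (if k < 2 * n then
        do {
          b \<leftarrow> bernoulli_pmf (rprob q i (level Z (k + 1)) (level Z k));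
          if odd k \<and> i = (k + 1) div 2 then
            (if b then right_attempt n q (k + 1) i (move_right k i Z)
             else left_jump n q (k + 1) i Z)
          else right_attempt n q (k + 1) (if b then i else i + 1) (move_right k i Z)
        }
      else return_pmf (move_right k i Z))"
  by pat_completeness auto
termination
  by (relation "Wellfounded.measure (\<lambda>(n, q, k, i, Z). 2 * n - k)") auto

declare right_attempt.simps [simp del]

definition insertion :: "nat \<Rightarrow> real \<Rightarrow> letter \<Rightarrow> pattern \<Rightarrow> pattern pmf" where
  "insertion n q l Z = right_attempt n q (letter_order l) 1 Z"

definition insertion_kernel :: "nat \<Rightarrow> real \<Rightarrow> letter \<Rightarrow> pattern \<Rightarrow> pattern \<Rightarrow> real" where
  "insertion_kernel n q l Z Z' = pmf (insertion n q l Z) Z'"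

definition pattern_kernel :: "nat \<Rightarrow> real \<Rightarrow> (nat \<Rightarrow> real) \<Rightarrow> pattern \<Rightarrow> pattern \<Rightarrow> real" where
  "pattern_kernel n q a Z Z' =
     (\<Sum>l\<in>alphabet n. letter_prob n a l * insertion_kernel n q l Z Z')"

definition shape_kernel :: "nat \<Rightarrow> real \<Rightarrow> (nat \<Rightarrow> real) \<Rightarrow> nat list \<Rightarrow> nat list \<Rightarrow> real" where
  "shape_kernel n q a mu lam =
     1 / normalizer n a * (qP n q a lam / qP n q a mu) * Lweight n q mu lam"

text \<open>
  The one-step law is prescribed given the entire past.  Conditioning is on events of
  positive probability, because \<open>cond_prob\<close> is 0 otherwise.
\<close>

definition markov_chain_on ::
  "'a measure \<Rightarrow> 's set \<Rightarrow> ('s \<Rightarrow> 's \<Rightarrow> real) \<Rightarrow> (nat \<Rightarrow> 'a \<Rightarrow> 's) \<Rightarrow> bool" where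
  "markov_chain_on M S K X \<longleftrightarrow>
     (\<forall>x\<in>S. (\<forall>y\<in>S. 0 \<le> K x y) \<and> (K x has_sum 1) S)
   \<and> (\<forall>m. X m \<in> M \<rightarrow>\<^sub>M count_space UNIV)
   \<and> (\<forall>m. AE \<omega> in M. X m \<omega> \<in> S)
   \<and> (\<forall>m x. (\<forall>i\<le>m + 1. x i \<in> S) \<longrightarrow> \<P>(\<omega> in M. \<forall>i\<le>m. X i \<omega> = x i) > 0 \<longrightarrow>
        \<P>(\<omega> in M. X (m + 1) \<omega> = x (m + 1) \<bar> \<forall>i\<le>m. X i \<omega> = x i) = K (x m) (x (m + 1)))"

text \<open>
  A process driven by iid letters \<open>w\<^sub>1, w\<^sub>2, \<dots>\<close> and by further independent random
  elements \<open>u\<^sub>1, u\<^sub>2, \<dots>\<close> of an arbitrary space \<open>S\<close>, which supply the randomness of the successive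
  insertions: \<open>ins l Z u\<close> is the outcome of inserting \<open>l\<close> into \<open>Z\<close> when the auxiliary randomness
  takes the value \<open>u\<close>.  The two independence conditions together say that all the \<open>w\<^sub>m\<close> and
  \<open>u\<^sub>m\<close>, for \<open>m \<ge> 1\<close>, are mutually independent.
\<close>

definition q_berele_process ::
  "nat \<Rightarrow> real \<Rightarrow> (nat \<Rightarrow> real) \<Rightarrow> 'a measure \<Rightarrow> (nat \<Rightarrow> 'a \<Rightarrow> letter) \<Rightarrow>
   'b measure \<Rightarrow> (nat \<Rightarrow> 'a \<Rightarrow> 'b) \<Rightarrow> (letter \<Rightarrow> pattern \<Rightarrow> 'b \<Rightarrow> pattern) \<Rightarrow>
   (nat \<Rightarrow> 'a \<Rightarrow> pattern) \<Rightarrow> bool" where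
  "q_berele_process n q a M w S u ins Z \<longleftrightarrow>
     prob_space M
   \<and> prob_space.indep_vars M (\<lambda>_. count_space (alphabet n) \<Otimes>\<^sub>M S) (\<lambda>m \<omega>. (w m \<omega>, u m \<omega>)) {1..}
   \<and> (\<forall>m\<ge>1. \<forall>l\<in>alphabet n. \<forall>B\<in>sets S.
        \<P>(\<omega> in M. w m \<omega> = l \<and> u m \<omega> \<in> B) = \<P>(\<omega> in M. w m \<omega> = l) * \<P>(\<omega> in M. u m \<omega> \<in> B))
   \<and> (\<forall>m\<ge>1. \<forall>l\<in>alphabet n. \<P>(\<omega> in M. w m \<omega> = l) = letter_prob n a l)
   \<and> (\<forall>l\<in>alphabet n. \<forall>z. ins l z \<in> S \<rightarrow>\<^sub>M count_space UNIV)
   \<and> (\<forall>m\<ge>1. \<forall>l\<in>alphabet n. \<forall>z\<in>patterns n. \<forall>z'.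
        \<P>(\<omega> in M. ins l z (u m \<omega>) = z') = insertion_kernel n q l z z')
   \<and> (\<forall>\<omega>\<in>space M. Z 0 \<omega> = zero_pattern n)
   \<and> (\<forall>m\<ge>1. \<forall>\<omega>\<in>space M. Z m \<omega> = ins (w m \<omega>) (Z (m - 1) \<omega>) (u m \<omega>))"

end

theory Submission
  imports Defs
begin

text \<open>
  With \<open>W(Z) = a\<^sup>Z \<kappa>(Z)\<close>, everything follows from the intertwining relation
  \<open>\<Sum>\<^bsub>Z \<in> K[\<mu>]\<^esub> W(Z) M(Z, Z') = W(Z') L(\<mu>, shape Z') / c\<close>, where \<open>c = \<Sum>\<^sub>i (a\<^sub>i + 1/a\<^sub>i)\<close>: by induction on \<open>m\<close>
  it gives the joint law of \<open>(f\<^sup>1, \<dots>, f\<^sup>m, Z(m))\<close> as \<open>c\<^sup>-\<^sup>m \<Prod> L(f\<^sup>i, f\<^sup>i\<^sup>+\<^sup>1) W(Z(m))\<close>, and it also shows that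
  insertion preserves patterns.

  To prove it, start from a pattern of shape \<open>\<mu>\<close> with law proportional to \<open>W\<close> and a random letter, and
  follow the insertion level by level.  The law of the state, consisting of the partly updated pattern
  and the jump pending on level \<open>k\<close>, is again an explicit product of branching weights.  Passing from
  level \<open>k\<close> to level \<open>k + 1\<close> involves at most three predecessors of a given state, and the corresponding
  identities reduce to the Pascal-type recurrences of the \<open>q\<close>-binomial coefficients together with
  \<open>(1 - q\<^sup>r) + q\<^sup>r (1 - q\<^sup>s) = 1 - q\<^sup>r\<^sup>+\<^sup>s\<close>.
\<close>

text \<open>The rates in \<open>Lweight\<close> are the denominators of the jump probabilities: 1 -
  q^(x_(i-1) - x_i) for r_i and 1 - q^(x_i - x_(i+1)) for l_i. A pending jump that carries its rate
  therefore clears the quotient, and the 0 / 0 cases get weight 0. Each transfer identity then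
  splits the predicted weight of a pending jump into the share handed on within its own column and
  the share coming from the neighbouring column (or from a new letter). The shares add up to 1 on
  every level, with one exception: a left jump of the last coordinate of an odd level has no source
  in its own column, because the level before it is shorter. Only the fraction \<open>theta\<close>
  arrives. The deficit is made good one level later by suppressed right jumps, so this single
  identity involves three consecutive levels. It balances because the letters l and barred l have
  reciprocal weights. The second obstacle is that partly updated configurations need not interlace.
  The candidate law must be 0 exactly where the jump probabilities could leave [0, 1], and it is,
  since it contains the branching weight of the two levels about to interact.\<close>

section \<open>Integer-indexed $q$-binomial coefficients and branching products\<close>

text \<open>
  Extending by \<open>0\<close> outside \<open>0 \<le> k \<le> N\<close> makes the recurrences below hold for all integers, so
  that the branching products vanish, and still satisfy them, on configurations that do not interlace.
\<close>

definition qbin :: "real \<Rightarrow> int \<Rightarrow> int \<Rightarrow> real" where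
  "qbin q N k = (if 0 \<le> k \<and> k \<le> N then qbinom q (nat N) (nat k) else 0)"

lemma qpoch_Suc: "qpoch q (Suc k) = qpoch q k * (1 - q ^ Suc k)"
  by (simp add: qpoch_def)

lemma qpoch_pos: "0 < q \<Longrightarrow> q < 1 \<Longrightarrow> 0 < qpoch q k"
  unfolding qpoch_def by (intro prod_pos) (auto simp: power_less_one_iff)

lemma qbinom_pos: "0 < q \<Longrightarrow> q < 1 \<Longrightarrow> 0 < qbinom q N k"
  unfolding qbinom_def by (intro divide_pos_pos mult_pos_pos qpoch_pos)

lemma one_minus_power_pos: "0 < q \<Longrightarrow> q < 1 \<Longrightarrow> 0 < m \<Longrightarrow> 0 < 1 - (q::real) ^ m"
  by (simp add: power_less_one_iff)

lemma one_minus_powi_pos: "0 < q \<Longrightarrow> q < 1 \<Longrightarrow> 0 < m \<Longrightarrow> 0 < 1 - (q::real) powi m"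
  using one_minus_power_pos[of q "nat m"] by (simp add: power_int_def)

lemma qbin_nonneg: "0 < q \<Longrightarrow> q < 1 \<Longrightarrow> 0 \<le> qbin q N k"
  unfolding qbin_def using qbinom_pos[of q] by (auto simp: less_imp_le)

lemma qbin_eq_0_iff: "0 < q \<Longrightarrow> q < 1 \<Longrightarrow> qbin q N k = 0 \<longleftrightarrow> \<not> (0 \<le> k \<and> k \<le> N)"
  unfolding qbin_def using qbinom_pos[of q "nat N" "nat k"] by auto

text \<open>Inside the range this is the factorial formula. The delicate boundary case is k = N + 1,
  where the left coefficient does not vanish but its factor 1 - q^0 does.\<close>

lemma qbin_upper:
  assumes q: "0 < q" "q < 1"
  shows "qbin q (N + 1) k * (1 - q powi (N + 1 - k)) = qbin q N k * (1 - q powi (N + 1))"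
proof (cases "0 \<le> k \<and> k \<le> N")
  case True
  define a b where "a = nat k" and "b = nat (N - k)"
  have "k = int a" "N = int (a + b)" using True by (auto simp: a_def b_def)
  then show ?thesis
    using qpoch_pos[OF q, of a] qpoch_pos[OF q, of b] one_minus_power_pos[OF q, of "Suc b"]
    by (simp add: qbin_def qbinom_def nat_add_distrib Suc_diff_le power_int_def qpoch_Suc
        nat_diff_distrib' flip: of_nat_Suc del: of_nat_add power_Suc)
next
  case False
  then consider "k < 0" | "k = N + 1" "k \<ge> 0" | "k > N + 1" by linarith
  then show ?thesis by cases (auto simp: qbin_def)
qed

text \<open>The reflection of k to N - k turns this into \<open>qbin_upper\<close>.\<close>

lemma qbin_both:
  assumes q: "0 < q" "q < 1"
  shows "qbin q (N + 1) (k + 1) * (1 - q powi (k + 1)) = qbin q N k * (1 - q powi (N + 1))"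
proof -
  have sym: "qbin q N k = qbin q N (N - k)" for N k
    by (auto simp: qbin_def qbinom_def nat_diff_distrib)
  show ?thesis
    using qbin_upper[OF q, of N "N - k"] sym[of N k] sym[of "N + 1" "k + 1"] by (simp add: add.commute)
qed

text \<open>For positive N both sides equal \<open>qbin q (N - 1) k\<close> times 1 - q^N, by the
  two preceding recurrences.\<close>

lemma qbin_lower:
  assumes q: "0 < q" "q < 1"
  shows "qbin q N (k + 1) * (1 - q powi (k + 1)) = qbin q N k * (1 - q powi (N - k))"
proof (cases "N > 0")
  case True
  then show ?thesis
    using qbin_upper[OF q, of "N - 1" k] qbin_both[OF q, of "N - 1" k]
    by simp
next
  case False
  then consider "N < 0 \<or> k < - 1 \<or> k > 0" | "N = 0" "k = - 1" | "N = 0" "k = 0" by linarith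
  then show ?thesis
    by cases (use False in \<open>auto simp: qbin_def\<close>)
qed

lemma power_diff_powi: "m \<le> k \<Longrightarrow> (q::real) ^ (k - m) = q powi (int k - int m)"
  by (simp add: power_int_def nat_diff_distrib)

section \<open>Branching products under the addition of boxes\<close>

definition branch_prod :: "real \<Rightarrow> nat \<Rightarrow> (nat \<Rightarrow> int) \<Rightarrow> (nat \<Rightarrow> int) \<Rightarrow> real" where
  "branch_prod q m X Y = (\<Prod>i=1..m. qbin q (Y i - Y (i + 1)) (Y i - X i))"

text \<open>The factor 1 - q^d with the convention that coordinate 0 is +infinity: for i = 1 the
  exponent would be infinite, and the power of q is 0.\<close>

definition gap :: "real \<Rightarrow> nat \<Rightarrow> int \<Rightarrow> real" where
  "gap q i d = (if i = 1 then 1 else 1 - q powi d)"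

text \<open>Changing Y in column i and X in columns i - 1 and i touches only the factors i - 1 and
  i. The guards drop whichever of them lies outside 1..m, so every box identity reduces to at most
  two q-binomials.\<close>

lemma branch_prod_mult_eqI:
  assumes "i \<ge> 1" and "\<And>t. t \<noteq> i \<Longrightarrow> Y' t = Y t" "\<And>t. t \<noteq> i \<Longrightarrow> t \<noteq> i - 1 \<Longrightarrow> X' t = X t"
    and "(if 2 \<le> i \<and> i \<le> m + 1 then qbin q (Y (i - 1) - Y i) (Y (i - 1) - X (i - 1)) else 1)
       * (if i \<le> m then qbin q (Y i - Y (i + 1)) (Y i - X i) else 1) * c
      = (if 2 \<le> i \<and> i \<le> m + 1 then qbin q (Y' (i - 1) - Y' i) (Y' (i - 1) - X' (i - 1)) else 1)
       * (if i \<le> m then qbin q (Y' i - Y' (i + 1)) (Y' i - X' i) else 1) * d"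
  shows "branch_prod q m X Y * c = branch_prod q m X' Y' * d"
proof -
  have split: "branch_prod q m X Y
      = (if 2 \<le> i \<and> i \<le> m + 1 then qbin q (Y (i - 1) - Y i) (Y (i - 1) - X (i - 1)) else 1)
       * (if i \<le> m then qbin q (Y i - Y (i + 1)) (Y i - X i) else 1)
       * (\<Prod>t\<in>{1..m} - {i - 1, i}. qbin q (Y t - Y (t + 1)) (Y t - X t))" for X Y
  proof -
    have "branch_prod q m X Y = (\<Prod>t\<in>{1..m} \<inter> {i - 1, i}. qbin q (Y t - Y (t + 1)) (Y t - X t))
       * (\<Prod>t\<in>{1..m} - {i - 1, i}. qbin q (Y t - Y (t + 1)) (Y t - X t))"
      unfolding branch_prod_def by (subst prod.Int_Diff[of _ _ "{i - 1, i}"]) auto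
    also have "{1..m} \<inter> {i - 1, i}
        = (if 2 \<le> i \<and> i \<le> m + 1 then {i - 1} else {}) \<union> (if i \<le> m then {i} else {})"
      using assms(1) by auto
    also have "(\<Prod>t\<in>\<dots>. qbin q (Y t - Y (t + 1)) (Y t - X t))
      = (if 2 \<le> i \<and> i \<le> m + 1 then qbin q (Y (i - 1) - Y i) (Y (i - 1) - X (i - 1)) else 1)
       * (if i \<le> m then qbin q (Y i - Y (i + 1)) (Y i - X i) else 1)"
      using assms(1) by auto
    finally show ?thesis .
  qed
  have "(\<Prod>t\<in>{1..m} - {i - 1, i}. qbin q (Y t - Y (t + 1)) (Y t - X t))
      = (\<Prod>t\<in>{1..m} - {i - 1, i}. qbin q (Y' t - Y' (t + 1)) (Y' t - X' t))"
    using assms by (intro prod.cong refl) auto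
  then show ?thesis
    unfolding split using assms(4) by (simp add: mult_ac)
qed

lemma mult_eq_mult4:
  fixes a b c d :: real
  assumes "a * c = a' * c'" "b * d = b' * d'"
  shows "a * b * (c * d) = a' * b' * (c' * d')"
proof -
  have "a * b * (c * d) = (a * c) * (b * d)" by simp
  then show ?thesis using assms by simp
qed

text \<open>A jump handed on within its column: factor i - 1 loses one from its upper argument,
  factor i gains one there, and both lower arguments stay fixed. Hence \<open>qbin_upper\<close>
  applies twice.\<close>

lemma branch_prod_same:
  assumes q: "0 < q" "q < 1" and i: "1 \<le> i" "i \<le> m"
    and Y': "Y' = Y(i := Y i + 1)" and X': "X' = X(i := X i + 1)"
  shows "branch_prod q m X Y * (gap q i (X (i - 1) - Y i) * (1 - q powi (Y' i - Y (i + 1))))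
       = branch_prod q m X' Y' * (gap q i (Y (i - 1) - Y i) * (1 - q powi (X' i - Y (i + 1))))"
proof (rule branch_prod_mult_eqI[of i], goal_cases)
  case 4
  have 1: "qbin q (Y (i - 1) - Y i) (Y (i - 1) - X (i - 1)) * (1 - q powi (X (i - 1) - Y i))
      = qbin q (Y (i - 1) - (Y i + 1)) (Y (i - 1) - X (i - 1)) * (1 - q powi (Y (i - 1) - Y i))"
    using qbin_upper[OF q, of "Y (i - 1) - (Y i + 1)" "Y (i - 1) - X (i - 1)"]
    by (simp add: algebra_simps)
  have 2: "qbin q (Y i + 1 - Y (i + 1)) (Y i - X i) * (1 - q powi (X i + 1 - Y (i + 1)))
      = qbin q (Y i - Y (i + 1)) (Y i - X i) * (1 - q powi (Y i + 1 - Y (i + 1)))"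
    using qbin_upper[OF q, of "Y i - Y (i + 1)" "Y i - X i"]
    by (simp add: algebra_simps)
  have ne: "i \<noteq> i - 1" using i by auto
  have 3: "qbin q (Y i - Y (i + 1)) (Y i - X i) * (1 - q powi (Y i + 1 - Y (i + 1)))
      = qbin q (Y i + 1 - Y (i + 1)) (Y i + 1 - (X i + 1)) * (1 - q powi (X i + 1 - Y (i + 1)))"
    using 2 by simp
  show ?case
  proof (cases "i = 1")
    case True
    then show ?thesis using i ne 3 unfolding Y' X' gap_def by simp
  next
    case False
    then show ?thesis using i ne mult_eq_mult4[OF 1 3] unfolding Y' X' gap_def by simp
  qed
qed (use i in \<open>auto simp: Y' X'\<close>)

text \<open>A jump handed on to the next column: factor i - 1 loses one in both arguments and factor
  i gains one in both, so \<open>qbin_both\<close> applies twice. For i = m + 1, the last coordinate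
  of an odd level, factor i is absent.\<close>

lemma branch_prod_diag:
  assumes q: "0 < q" "q < 1" and i: "2 \<le> i" "i \<le> m + 1"
    and Y': "Y' = Y(i := Y i + 1)" and X': "X' = X(i - 1 := X (i - 1) + 1)"
  shows "branch_prod q m X Y * ((1 - q powi (Y (i - 1) - X (i - 1)))
           * (if i \<le> m then 1 - q powi (Y' i - Y (i + 1)) else 1))
       = branch_prod q m X' Y' * ((1 - q powi (Y (i - 1) - Y i))
           * (if i \<le> m then 1 - q powi (Y' i - X i) else 1))"
proof (rule branch_prod_mult_eqI[of i], goal_cases)
  case 4
  have 1: "qbin q (Y (i - 1) - Y i) (Y (i - 1) - X (i - 1)) * (1 - q powi (Y (i - 1) - X (i - 1)))
      = qbin q (Y (i - 1) - (Y i + 1)) (Y (i - 1) - (X (i - 1) + 1)) * (1 - q powi (Y (i - 1) - Y i))"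
    using qbin_both[OF q, of "Y (i - 1) - (Y i + 1)" "Y (i - 1) - (X (i - 1) + 1)"]
    by (simp add: algebra_simps)
  have 2: "qbin q (Y i + 1 - Y (i + 1)) (Y i + 1 - X i) * (1 - q powi (Y i + 1 - X i))
      = qbin q (Y i - Y (i + 1)) (Y i - X i) * (1 - q powi (Y i + 1 - Y (i + 1)))"
    using qbin_both[OF q, of "Y i - Y (i + 1)" "Y i - X i"]
    by (simp add: algebra_simps)
  have ne: "i \<noteq> i - 1" "i - 1 \<noteq> i" "i \<noteq> 1" using i by auto
  show ?case
  proof (cases "i \<le> m")
    case True
    with True show ?thesis using i ne mult_eq_mult4[OF 1 2[symmetric]] unfolding Y' X' by simp
  qed (use i ne 1 in \<open>simp add: Y' X'\<close>)
qed (use i in \<open>auto simp: Y' X'\<close>)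

text \<open>The case of a letter entering on the level of Y, where nothing has moved below.\<close>

lemma branch_prod_start:
  assumes q: "0 < q" "q < 1" and i: "1 \<le> m"
    and Y': "Y' = Y(1 := Y 1 + 1)"
  shows "branch_prod q m X Y * (1 - q powi (Y' 1 - Y 2))
       = branch_prod q m X Y' * (1 - q powi (Y' 1 - X 1))"
proof (rule branch_prod_mult_eqI[of 1], goal_cases)
  case 4
  show ?case using i qbin_both[OF q, of "Y 1 - Y 2" "Y 1 - X 1"]
    by (simp add: Y' algebra_simps numeral_2_eq_2)
qed (auto simp: Y')

text \<open>For i = m + 1 only factor i - 1 contains Y_i. This takes the virtual box of a suppressed
  right jump off the last coordinate of an odd level.\<close>

lemma branch_prod_shift_upper:
  assumes q: "0 < q" "q < 1" and i: "2 \<le> i" "i = m + 1"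
    and Y': "Y' = Y(i := Y i + 1)"
  shows "branch_prod q m X Y * (1 - q powi (X (i - 1) - Y i))
       = branch_prod q m X Y' * (1 - q powi (Y (i - 1) - Y i))"
proof (rule branch_prod_mult_eqI[of i], goal_cases)
  case 4
  show ?case using i qbin_upper[OF q, of "Y (i - 1) - (Y i + 1)" "Y (i - 1) - X (i - 1)"]
    by (simp add: Y' algebra_simps)
qed (use i in \<open>auto simp: Y'\<close>)

text \<open>Only factor i contains X_i. This compares a left jump of X_i with a suppressed right
  jump, which leaves X in place.\<close>

lemma branch_prod_shift_lower:
  assumes q: "0 < q" "q < 1" and i: "1 \<le> i" "i \<le> m"
    and X': "X' = X(i := X i + 1)"
  shows "branch_prod q m X Y * (1 - q powi (Y i - X i))
       = branch_prod q m X' Y * (1 - q powi (X' i - Y (i + 1)))"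
proof (rule branch_prod_mult_eqI[of i], goal_cases)
  case 4
  have ne: "i \<noteq> i - 1" using i by auto
  have 1: "qbin q (Y i - Y (i + 1)) (Y i - X i) * (1 - q powi (Y i - X i))
      = qbin q (Y i - Y (i + 1)) (Y i - (X i + 1)) * (1 - q powi (X i + 1 - Y (i + 1)))"
    using qbin_lower[OF q, of "Y i - Y (i + 1)" "Y i - (X i + 1)"]
    by (simp add: algebra_simps)
  show ?case
    using i ne 1 unfolding X' by simp
qed (use i in \<open>auto simp: X'\<close>)

section \<open>Branching weights and one-level jump probabilities\<close>

abbreviation icoord :: "nat list \<Rightarrow> nat \<Rightarrow> int" where
  "icoord x \<equiv> \<lambda>i. int (coord x i)"

section \<open>Boxes, sorted tuples and interlacing\<close>

lemma length_add_box [simp]: "length (add_box x i) = length x"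
  and length_remove_box [simp]: "length (remove_box x i) = length x"
  by (simp_all add: add_box_def remove_box_def)

lemma coord_add_box:
  "1 \<le> i \<Longrightarrow> i \<le> length x \<Longrightarrow> coord (add_box x i) j = (if j = i then coord x i + 1 else coord x j)"
  by (auto simp: coord_def add_box_def nth_list_update)

lemma icoord_add_box:
  "1 \<le> i \<Longrightarrow> i \<le> length x \<Longrightarrow> icoord (add_box x i) = (icoord x)(i := icoord x i + 1)"
  by (auto simp: coord_add_box)

lemma add_remove_box: "1 \<le> i \<Longrightarrow> i \<le> length x \<Longrightarrow> 0 < coord x i \<Longrightarrow> add_box (remove_box x i) i = x"
  by (auto simp: add_box_def remove_box_def coord_def)

lemma remove_add_box: "1 \<le> i \<Longrightarrow> i \<le> length x \<Longrightarrow> remove_box (add_box x i) i = x"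
  by (auto simp: add_box_def remove_box_def)

lemma sum_list_add_box: "1 \<le> i \<Longrightarrow> i \<le> length x \<Longrightarrow> sum_list (add_box x i) = sum_list x + 1"
  unfolding add_box_def by (subst sum_list_update) (auto simp: member_le_sum_list)

lemma coord_beyond: "length x < i \<Longrightarrow> coord x i = 0"
  by (simp add: coord_def)

lemma tuples_iff: "x \<in> tuples l \<longleftrightarrow> length x = l \<and> (\<forall>i\<ge>1. coord x (i + 1) \<le> coord x i)"
proof -
  have "(\<forall>i\<ge>1. coord x (i + 1) \<le> coord x i) \<longleftrightarrow> (\<forall>i. Suc i < length x \<longrightarrow> x ! Suc i \<le> x ! i)"
    by (auto simp: coord_def Suc_le_eq gr0_conv_Suc)
  then show ?thesis
    by (simp add: tuples_def sorted_wrt_iff_nth_Suc_transp transp_on_def)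
qed

lemma interlaces_sorted:
  assumes "interlaces x y"
  shows "i \<ge> 1 \<Longrightarrow> coord x (i + 1) \<le> coord x i" "i \<ge> 1 \<Longrightarrow> coord y (i + 1) \<le> coord y i"
  using assms unfolding interlaces_def by (meson le_trans le_add1)+

lemma interlacesD:
  assumes "interlaces x y"
  shows "i \<ge> 1 \<Longrightarrow> coord x i \<le> coord y i" "i \<ge> 1 \<Longrightarrow> coord y (i + 1) \<le> coord x i"
    "i \<ge> 2 \<Longrightarrow> coord y i \<le> coord x (i - 1)"
  using assms unfolding interlaces_def by auto (metis One_nat_def Suc_1 Suc_diff_1 Suc_le_D Suc_le_mono le0 not_less_eq_eq zero_less_Suc)

text \<open>The rate of a left jump on an arbitrary level and the denominator of
  \<open>lprob\<close>. Since coordinates beyond the length are 0, it covers both cases of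
  \<open>u_minus\<close>.\<close>

definition down :: "real \<Rightarrow> nat \<Rightarrow> nat list \<Rightarrow> real" where
  "down q i x = 1 - q ^ (coord x i - coord x (i + 1))"

section \<open>Branching weights of consecutive levels\<close>

locale berele =
  fixes n :: nat and q :: real and a :: "nat \<Rightarrow> real"
  assumes q: "0 < q" "q < 1" and a: "\<And>i. 1 \<le> i \<Longrightarrow> i \<le> n \<Longrightarrow> 0 < a i"
begin

definition wt :: "nat \<Rightarrow> real" where
  "wt k = (if odd k then a ((k + 1) div 2) else inverse (a ((k + 1) div 2)))"

text \<open>The exponent of a_l in the monomial is (|z^(2l-1)| - |z^(2l-2)|) - (|z^(2l)| -
  |z^(2l-1)|), so a^Z factors over the levels, with base a_l on level 2l - 1 and 1/a_l on level 2l.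
  The number of binomials, \<open>k div 2\<close>, is the length of level k - 1.\<close>

definition branch_weight :: "nat \<Rightarrow> nat list \<Rightarrow> nat list \<Rightarrow> real" where
  "branch_weight k x y = wt k powi (int (sum_list y) - int (sum_list x))
     * branch_prod q (k div 2) (icoord x) (icoord y)"

lemma wt_pos: "1 \<le> k \<Longrightarrow> k \<le> 2 * n \<Longrightarrow> 0 < wt k"
proof -
  assume "1 \<le> k" "k \<le> 2 * n"
  then have "0 < a ((k + 1) div 2)" by (intro a) linarith+
  then show ?thesis unfolding wt_def by (metis inverse_positive_iff_positive)
qed

lemma power_lt_1: "0 < m \<Longrightarrow> q ^ m < 1"
  using one_minus_power_pos[OF q, of m] by auto

lemma power_le_1: "q ^ m \<le> 1"
  using q by (simp add: power_le_one)

lemma branch_weight_nonneg: "1 \<le> k \<Longrightarrow> k \<le> 2 * n \<Longrightarrow> 0 \<le> branch_weight k x y"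
  using wt_pos[of k] unfolding branch_weight_def branch_prod_def
  by (intro mult_nonneg_nonneg prod_nonneg ballI qbin_nonneg[OF q]) (auto intro!: zero_le_power_int)

text \<open>Finitely many factors suffice: for i beyond \<open>k div 2\<close> both x_i and y_(i+1)
  lie beyond the lengths and are 0.\<close>

lemma branch_prod_nonzero_iff:
  assumes "length x = k div 2" "length y = (k + 1) div 2"
  shows "branch_prod q (k div 2) (icoord x) (icoord y) \<noteq> 0 \<longleftrightarrow> interlaces x y"
proof -
  have "branch_prod q (k div 2) (icoord x) (icoord y) \<noteq> 0
      \<longleftrightarrow> (\<forall>i\<in>{1..k div 2}. coord x i \<le> coord y i \<and> coord y (i + 1) \<le> coord x i)"
    unfolding branch_prod_def prod_zero_iff[OF finite_atLeastAtMost] bex_simps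
    by (simp add: qbin_eq_0_iff[OF q])
  also have "\<dots> \<longleftrightarrow> interlaces x y"
  proof -
    have "coord x i \<le> coord y i \<and> coord y (i + 1) \<le> coord x i" if "i > k div 2" for i
      using that assms coord_beyond[of x i] coord_beyond[of y "i + 1"] by auto
    then show ?thesis unfolding interlaces_def by (metis atLeastAtMost_iff not_le)
  qed
  finally show ?thesis .
qed

lemma branch_weight_nonzero_iff:
  assumes "1 \<le> k" "k \<le> 2 * n" "length x = k div 2" "length y = (k + 1) div 2"
  shows "branch_weight k x y \<noteq> 0 \<longleftrightarrow> interlaces x y"
  using branch_prod_nonzero_iff[OF assms(3,4)] wt_pos[of k] assms by (auto simp: branch_weight_def)

section \<open>Jump probabilities multiplied by their rates\<close>

context
  fixes x y :: "nat list" and i :: nat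
  assumes xy: "interlaces x y" and i: "i \<ge> 1"
begin

text \<open>The bounds keep \<open>bernoulli_pmf\<close> from truncating its argument. They survive
  a zero denominator, because division by 0 yields 0.\<close>

lemma rprob_bounds: "0 \<le> rprob q i y x" "rprob q i y x \<le> 1"
proof -
  have "0 \<le> (1 - q ^ c) / (1 - q ^ d)" "(1 - q ^ c) / (1 - q ^ d) \<le> 1" if "c \<le> d" for c d
    using that power_le_1[of c] power_le_1[of d] power_decreasing[OF that, of q] q
    by (auto simp: divide_le_eq_1)
  then show "0 \<le> rprob q i y x" "rprob q i y x \<le> 1"
    using power_le_1 q interlacesD(1)[OF xy i] unfolding rprob_def
    by (auto intro!: mult_le_one simp del: times_divide_eq_right)
qed

lemma lprob_bounds: "0 \<le> lprob q i y x" "lprob q i y x \<le> 1"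
proof -
  have "0 \<le> (1 - q ^ c) / (1 - q ^ d)" "(1 - q ^ c) / (1 - q ^ d) \<le> 1" if "c \<le> d" for c d
    using that power_le_1[of c] power_le_1[of d] power_decreasing[OF that, of q] q
    by (auto simp: divide_le_eq_1)
  then show "0 \<le> lprob q i y x" "lprob q i y x \<le> 1"
    using power_le_1 q interlacesD(2)[OF xy i] unfolding lprob_def
    by (auto intro!: mult_le_one simp del: times_divide_eq_right)
qed

lemma u_plus_gap: "u_plus q i x = gap q i (icoord x (i - 1) - icoord x i)"
  using i interlaces_sorted(1)[OF xy, of "i - 1"]
  by (cases "i = 1") (auto simp: u_plus_def gap_def power_diff_powi)

text \<open>For i > 1 the rate is the denominator of \<open>rprob\<close>. If it vanishes, then
  x_(i-1) = x_i, interlacing squeezes y_i onto the same value, and the right-hand side vanishes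
  too.\<close>

lemma u_plus_rprob:
  "u_plus q i x * rprob q i y x = q powi (icoord y i - icoord x i) * gap q i (icoord x (i - 1) - icoord y i)"
proof (cases "i = 1")
  case True
  then show ?thesis
    using interlacesD(1)[OF xy i] by (simp add: u_plus_def rprob_def gap_def power_diff_powi)
next
  case False
  have 1: "coord x i \<le> coord y i" "coord y i \<le> coord x (i - 1)"
    using interlacesD[OF xy, of i] i False by auto
  show ?thesis
  proof (cases "coord x (i - 1) = coord x i")
    case True
    then show ?thesis using 1 False by (simp add: u_plus_def gap_def)
  next
    case ne: False
    then have "1 - q ^ (coord x (i - 1) - coord x i) \<noteq> 0"
      using 1 power_lt_1[of "coord x (i - 1) - coord x i"] by auto
    then show ?thesis using False 1
      by (simp add: u_plus_def rprob_def gap_def power_diff_powi)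
  qed
qed

text \<open>In the difference of rate and product the two powers that involve x_(i-1) cancel, so the
  result has the same form in the first column as in the others.\<close>

lemma u_plus_rprob_compl: "u_plus q i x * (1 - rprob q i y x) = 1 - q powi (icoord y i - icoord x i)"
proof (cases "i = 1")
  case True
  then show ?thesis
    using u_plus_rprob by (simp add: u_plus_def gap_def)
next
  case False
  have 1: "coord x i \<le> coord y i" "coord y i \<le> coord x (i - 1)"
    using interlacesD[OF xy, of i] i False by auto
  have "q powi (icoord y i - icoord x i) * q powi (icoord x (i - 1) - icoord y i)
      = q powi (icoord x (i - 1) - icoord x i)"
    using q by (subst power_int_add[symmetric]) auto
  then show ?thesis
    using u_plus_rprob False by (simp add: u_plus_gap gap_def algebra_simps)
qed

lemma down_powi: "down q i x = 1 - q powi (icoord x i - icoord x (i + 1))"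
  using interlaces_sorted(1)[OF xy i] by (simp add: down_def power_diff_powi)

text \<open>Again the rate is the denominator. If it vanishes, then x_(i+1) = x_i, and y_(i+1) lies
  between them.\<close>

lemma down_lprob:
  "down q i x * lprob q i y x
     = q powi (icoord x i - icoord y (i + 1)) * (1 - q powi (icoord y (i + 1) - icoord x (i + 1)))"
proof -
  have 1: "coord x (i + 1) \<le> coord y (i + 1)" "coord y (i + 1) \<le> coord x i"
    using interlacesD[OF xy, of i] interlacesD[OF xy, of "i + 1"] i by auto
  show ?thesis
  proof (cases "coord x (i + 1) = coord x i")
    case True
    then show ?thesis using 1 by (simp add: down_def)
  next
    case ne: False
    then have "1 - q ^ (coord x i - coord x (i + 1)) \<noteq> 0"
      using 1 power_lt_1[of "coord x i - coord x (i + 1)"] by auto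
    then show ?thesis using 1
      by (simp add: down_def lprob_def power_diff_powi)
  qed
qed

lemma down_lprob_compl: "down q i x * (1 - lprob q i y x) = 1 - q powi (icoord x i - icoord y (i + 1))"
proof -
  have "q powi (icoord x i - icoord y (i + 1)) * q powi (icoord y (i + 1) - icoord x (i + 1))
      = q powi (icoord x i - icoord x (i + 1))"
    using q by (subst power_int_add[symmetric]) auto
  then show ?thesis
    using down_lprob by (simp add: down_powi algebra_simps)
qed

end

section \<open>Branching weights under the addition of boxes\<close>

context
  fixes K :: nat and x x' y y' :: "nat list" and i :: nat
  assumes K: "2 \<le> K" "K \<le> 2 * n"
    and len: "length x = K div 2" "length y = (K + 1) div 2"
    and i: "1 \<le> i" "i \<le> length y"
    and y': "y' = add_box y i"
begin

lemma icoord_y': "icoord y' = (icoord y)(i := icoord y i + 1)"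
  using i by (simp add: y' icoord_add_box)

lemma sum_y': "int (sum_list y') = int (sum_list y) + 1"
  using i by (simp add: y' sum_list_add_box)

text \<open>Both tuples gain one box, so the power of \<open>wt K\<close> does not change.\<close>

lemma branch_weight_same:
  assumes im: "i \<le> K div 2" and x': "x' = add_box x i"
  shows "branch_weight K x y * (gap q i (icoord x (i - 1) - icoord y i) * (1 - q powi (icoord y' i - icoord y (i + 1))))
    = branch_weight K x' y' * (gap q i (icoord y (i - 1) - icoord y i) * (1 - q powi (icoord x' i - icoord y (i + 1))))"
proof -
  have X: "icoord x' = (icoord x)(i := icoord x i + 1)" "int (sum_list x') = int (sum_list x) + 1"
    using i im len by (simp_all add: x' icoord_add_box sum_list_add_box)
  show ?thesis
    using branch_prod_same[OF q i(1) im icoord_y' X(1)]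
    unfolding branch_weight_def sum_y' X(2) by (simp add: mult.assoc)
qed

lemma branch_weight_diag:
  assumes i2: "2 \<le> i" and x': "x' = add_box x (i - 1)"
  shows "branch_weight K x y * ((1 - q powi (icoord y (i - 1) - icoord x (i - 1)))
           * (if i \<le> K div 2 then 1 - q powi (icoord y' i - icoord y (i + 1)) else 1))
       = branch_weight K x' y' * ((1 - q powi (icoord y (i - 1) - icoord y i))
           * (if i \<le> K div 2 then 1 - q powi (icoord y' i - icoord x i) else 1))"
proof -
  have im: "i \<le> K div 2 + 1" using i len by linarith
  then have X: "icoord x' = (icoord x)(i - 1 := icoord x (i - 1) + 1)"
      "int (sum_list x') = int (sum_list x) + 1"
    using i i2 len by (simp_all add: x' icoord_add_box sum_list_add_box)
  show ?thesis
    using branch_prod_diag[OF q i2 im icoord_y' X(1)]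
    unfolding branch_weight_def sum_y' X(2) by (simp add: mult.assoc)
qed

text \<open>Only the upper tuple gains a box. The additional factor \<open>wt K\<close> is the
  unnormalized probability of the letter entering on level K.\<close>

lemma branch_weight_start:
  assumes "i = 1"
  shows "wt K * branch_weight K x y * (1 - q powi (icoord y' 1 - icoord y 2))
       = branch_weight K x y' * (1 - q powi (icoord y' 1 - icoord x 1))"
proof -
  have "1 \<le> K div 2" using K by linarith
  moreover have "wt K * wt K powi (int (sum_list y) - int (sum_list x))
      = wt K powi (int (sum_list y') - int (sum_list x))"
    using wt_pos[of K] K power_int_add[of "wt K" 1 "int (sum_list y) - int (sum_list x)"]
    by (simp add: sum_y' algebra_simps)
  moreover have "c * d = e \<Longrightarrow> f * g = h * k \<Longrightarrow> c * (d * f) * g = e * h * k" for c d e f g h k :: real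
    by (metis mult.assoc)
  ultimately show ?thesis
    using branch_prod_start[OF q, of "K div 2" "icoord y'" "icoord y" "icoord x"] icoord_y' assms
    unfolding branch_weight_def by simp
qed

end

section \<open>Transfer identities between consecutive levels\<close>

lemma u_plus_gap_sorted:
  assumes "1 \<le> i" "\<And>j. j \<ge> 1 \<Longrightarrow> coord y (j + 1) \<le> coord y j"
  shows "u_plus q i y = gap q i (icoord y (i - 1) - icoord y i)"
  using assms(1) assms(2)[of "i - 1"]
  by (cases "i = 1") (auto simp: u_plus_def gap_def power_diff_powi)

text \<open>Here x' is the lower tuple after its jump and y the upper one before. \<open>T1\<close>
  comes from a jump in column i that pushes its own column, \<open>T2\<close> from a jump in column
  i - 1 that does not, \<open>T3\<close> from a new letter. The common weight of the levels below
  has been divided out. For i in the range of x' the share of \<open>T1\<close> is q^p (1 - q^s) /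
  D, and \<open>T2\<close> or \<open>T3\<close> supplies (1 - q^p) / D, with D = 1 - q^(p+s). In the
  last column of an odd level \<open>T2\<close> alone gives everything.\<close>

lemma right_target:
  assumes K: "2 \<le> K" "K \<le> 2 * n"
    and len: "length x' = K div 2" "length y = (K + 1) div 2"
    and y: "\<And>j. j \<ge> 1 \<Longrightarrow> coord y (j + 1) \<le> coord y j"
    and i: "1 \<le> i" "i \<le> length y"
  defines "T1 \<equiv> (if i \<le> length x' \<and> 0 < coord x' i then
      u_plus q i (remove_box x' i) * rprob q i y (remove_box x' i) * branch_weight K (remove_box x' i) y else 0)"
    and "T2 \<equiv> (if 2 \<le> i \<and> 0 < coord x' (i - 1) then
      u_plus q (i - 1) (remove_box x' (i - 1)) * (1 - rprob q (i - 1) y (remove_box x' (i - 1)))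
        * branch_weight K (remove_box x' (i - 1)) y else 0)"
    and "T3 \<equiv> (if i = 1 then wt K * branch_weight K x' y else 0)"
  shows "T1 + T2 + T3 = branch_weight K x' (add_box y i) * u_plus q i y"
proof -
  define y' where "y' = add_box y i"
  define L where "L = branch_weight K x' y' * u_plus q i y"
  define D where "D = 1 - q powi (icoord y' i - icoord y (i + 1))"
  define s where "s = icoord x' i - icoord y (i + 1)"
  define p where "p = icoord y' i - icoord x' i"
  have cy': "coord y' j = (if j = i then coord y i + 1 else coord y j)" for j
    using i by (simp add: y'_def coord_add_box)
  have "D > 0" using y[OF i(1)] unfolding D_def cy' by (intro one_minus_powi_pos[OF q]) auto
  have u: "u_plus q i y = gap q i (icoord y (i - 1) - icoord y i)"
    by (rule u_plus_gap_sorted[OF i(1) y])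
  have L0: "interlaces x' y'" if "L \<noteq> 0"
    using that branch_weight_nonzero_iff[of K x' y'] K len by (auto simp: L_def y'_def)
  have T1: "T1 * D = L * (q powi p * (1 - q powi s))" if "i \<le> K div 2"
  proof (cases "0 < coord x' i")
    case True
    define x where "x = remove_box x' i"
    have x': "x' = add_box x i" "length x = K div 2"
      using True i that len by (simp_all add: x_def add_remove_box)
    have pp: "p = icoord y i - icoord x i"
      using i that x' by (simp add: p_def cy' coord_add_box)
    have eq: "branch_weight K x y * (gap q i (icoord x (i - 1) - icoord y i) * D) = L * (1 - q powi s)"
      using branch_weight_same[OF K x'(2) len(2) i y'_def that x'(1)] by (simp add: D_def s_def L_def u)
    have T: "T1 = u_plus q i x * rprob q i y x * branch_weight K x y"
      using that True len by (simp add: T1_def x_def)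
    show ?thesis
    proof (cases "interlaces x y")
      case True
      have "T1 * D = q powi p * (branch_weight K x y * (gap q i (icoord x (i - 1) - icoord y i) * D))"
        unfolding T u_plus_rprob[OF True i(1)] pp by simp
      then show ?thesis unfolding eq by simp
    next
      case False
      then have "branch_weight K x y = 0" using branch_weight_nonzero_iff[of K x y] K x' len by auto
      then show ?thesis using eq T by auto
    qed
  next
    case False
    \<comment> \<open>There is no predecessor with a smaller x_i. If L is nonzero, interlacing gives
      y_(i+1) <= x'_i = 0, so s = 0 and the predicted share is 0 as well.\<close>
    then have "L * (1 - q powi s) = 0"
      using interlacesD(2)[OF L0, of i] i by (cases "L = 0") (auto simp: s_def cy')
    then show ?thesis using False by (auto simp: T1_def)
  qed
  have T2: "T2 * (if i \<le> K div 2 then D else 1) = L * (if i \<le> K div 2 then 1 - q powi p else 1)"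
    if i2: "2 \<le> i"
  proof (cases "0 < coord x' (i - 1)")
    case True
    define x where "x = remove_box x' (i - 1)"
    have il: "1 \<le> i - 1" "i - 1 \<le> length x'" using i i2 len by linarith+
    have x': "x' = add_box x (i - 1)" "length x = K div 2"
      using True il len by (simp_all add: x_def add_remove_box)
    have pp: "p = icoord y' i - icoord x i"
      using il x' i2 by (simp add: p_def coord_add_box)
    have eq: "branch_weight K x y * ((1 - q powi (icoord y (i - 1) - icoord x (i - 1))) * (if i \<le> K div 2 then D else 1))
        = L * (if i \<le> K div 2 then 1 - q powi p else 1)"
    proof -
      have "L = branch_weight K x' y' * (1 - q powi (icoord y (i - 1) - icoord y i))"
        using i2 by (simp add: L_def u gap_def)
      then show ?thesis
        using branch_weight_diag[OF K x'(2) len(2) i y'_def i2 x'(1)] unfolding D_def pp by (simp only: mult.assoc)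
    qed
    have T: "T2 = u_plus q (i - 1) x * (1 - rprob q (i - 1) y x) * branch_weight K x y"
      using that True len by (simp add: T2_def x_def)
    show ?thesis
    proof (cases "interlaces x y")
      case True
      show ?thesis unfolding T u_plus_rprob_compl[OF True il(1)] eq[symmetric] by (simp add: mult_ac)
    next
      case False
      then have "branch_weight K x y = 0" using branch_weight_nonzero_iff[of K x y] K x' len by auto
      then show ?thesis using eq T by auto
    qed
  next
    case False
    \<comment> \<open>Interlacing would require 1 <= y'_i <= x'_(i-1) = 0.\<close>
    then have "L = 0"
      using interlacesD(3)[OF L0, of i] i i2 by (auto simp: cy')
    then show ?thesis using False by (auto simp: T2_def)
  qed
  have T3: "T3 * D = L * (1 - q powi p)" if "i = 1"
    using branch_weight_start[OF K len i y'_def that] that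
    by (simp add: T3_def D_def L_def p_def u_plus_def numeral_2_eq_2)
  have D: "D = 1 - q powi p * q powi s"
    using q by (subst power_int_add[symmetric]) (auto simp: D_def p_def s_def)
  have "T1 + T2 + T3 = L"
  proof (cases "i \<le> K div 2")
    case True
    \<comment> \<open>\<open>T2\<close> is 0 for i = 1 and \<open>T3\<close> is 0 for i >= 2, so one
      formula covers both.\<close>
    have "T2 + T3 = L * (1 - q powi p) / D"
      using True T2 T3 i \<open>D > 0\<close> by (cases "i = 1") (auto simp: T2_def T3_def field_simps)
    moreover have "T1 = L * (q powi p * (1 - q powi s)) / D"
      using T1[OF True] \<open>D > 0\<close> by (simp add: field_simps)
    ultimately have "T1 + T2 + T3 = L * (q powi p * (1 - q powi s) + (1 - q powi p)) / D"
      by (simp add: add_divide_distrib distrib_left)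
    also have "q powi p * (1 - q powi s) + (1 - q powi p) = D"
      unfolding D by (simp add: algebra_simps)
    finally show ?thesis using \<open>D > 0\<close> by simp
  next
    case False
    then have "2 \<le> i" using K i by linarith
    then show ?thesis using T2 False len by (simp add: T1_def T3_def)
  qed
  then show ?thesis by (simp add: L_def y'_def)
qed

end

text \<open>
  Correction factor for a left jump of the last coordinate of an odd level; \<open>i = 1\<close> is the
  convention \<open>w\<^sub>0 = +\<infinity>\<close>.  Level \<open>k = 2l - 1\<close> alone does not intertwine: the missing
  fraction \<open>1 - theta\<close> is supplied on level \<open>2l\<close> by the suppressed right jumps, which continue there as
  left jumps of the last coordinate.
\<close>

definition theta :: "real \<Rightarrow> nat list \<Rightarrow> nat list \<Rightarrow> nat \<Rightarrow> real" where
  "theta q w x i = (if i = 1 then 0 else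
     q ^ (coord w (i - 1) - coord x i) * ((1 - q ^ (coord x (i - 1) - coord w (i - 1)))
       / (1 - q ^ (coord x (i - 1) - coord x i))))"

context berele
begin

text \<open>The predecessors have one more box in x', either in column i (\<open>T1\<close>, the
  jump stays in its column) or in column i - 1 (\<open>T2\<close>). For i >= 2 in the range of x'
  their shares are (1 - q^r) / G and q^r (1 - q^s) / G, with G = 1 - q^(r+s). In the last column of
  an odd level \<open>T1\<close> is absent, and the remaining share of \<open>T2\<close> is what
  \<open>theta\<close> records.\<close>

lemma left_target:
  assumes K: "2 \<le> K" "K \<le> 2 * n"
    and len: "length x' = K div 2" "length y = (K + 1) div 2"
    and y: "\<And>j. j \<ge> 1 \<Longrightarrow> coord y (j + 1) \<le> coord y j"
    and i: "1 \<le> i" "i \<le> length y"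
  defines "T1 \<equiv> (if i \<le> length x' then down q i (add_box x' i) * (1 - lprob q i y (add_box x' i))
      * branch_weight K (add_box x' i) y else 0)"
    and "T2 \<equiv> (if 2 \<le> i then down q (i - 1) (add_box x' (i - 1)) * lprob q (i - 1) y (add_box x' (i - 1))
      * branch_weight K (add_box x' (i - 1)) y else 0)"
  shows "T1 + T2 = (if coord y i = 0 then 0 else branch_weight K x' (remove_box y i) * down q i y
           * (if odd K \<and> i = (K + 1) div 2 then theta q x' (remove_box y i) i else 1))"
proof -
  have T1: "T1 = branch_weight K (add_box x' i) y * (1 - q powi (icoord x' i + 1 - icoord y (i + 1)))"
    if "i \<le> K div 2"
  proof (cases "interlaces (add_box x' i) y")
    case True
    show ?thesis
      using down_lprob_compl[OF True i(1)] that i len by (simp add: T1_def coord_add_box add.commute)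
  next
    case False
    then have "branch_weight K (add_box x' i) y = 0" using branch_weight_nonzero_iff[of K "add_box x' i" y] K len by auto
    then show ?thesis by (simp add: T1_def)
  qed
  have T2: "T2 = branch_weight K (add_box x' (i - 1)) y
      * (q powi (icoord x' (i - 1) + 1 - icoord y i) * (1 - q powi (icoord y i - icoord x' i)))"
    if "2 \<le> i"
  proof (cases "interlaces (add_box x' (i - 1)) y")
    case True
    have "1 \<le> i - 1" "i - 1 \<le> length x'" "i \<noteq> i - 1" using i that len by linarith+
    then show ?thesis
      using down_lprob[OF True, of "i - 1"] that i by (simp add: T2_def coord_add_box add.commute)
  next
    case False
    then have "branch_weight K (add_box x' (i - 1)) y = 0"
      using branch_weight_nonzero_iff[of K "add_box x' (i - 1)" y] K len by auto
    then show ?thesis by (simp add: T2_def)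
  qed
  show ?thesis
  proof (cases "coord y i = 0")
    case True
    have "T1 = 0"
    proof (cases "i \<le> K div 2")
      case im: True
      have "\<not> interlaces (add_box x' i) y"
        using interlacesD(1)[of "add_box x' i" y i] i im len True by (auto simp: coord_add_box)
      then have "branch_weight K (add_box x' i) y = 0" using branch_weight_nonzero_iff[of K "add_box x' i" y] K len by auto
      then show ?thesis by (simp add: T1_def)
    qed (simp add: T1_def len)
    moreover have "T2 = 0"
    proof (cases "2 \<le> i")
      case i2: True
      have j: "1 \<le> i - 1" "i - 1 \<le> length x'" "i \<noteq> i - 1" using i i2 len by linarith+
      show ?thesis
      proof (cases "interlaces (add_box x' (i - 1)) y")
        case int: True
        then have "coord x' i = 0"
          using interlacesD(1)[OF int i(1)] True j by (simp add: coord_add_box)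
        then show ?thesis using T2[OF i2] True by simp
      next
        case False
        then have "branch_weight K (add_box x' (i - 1)) y = 0"
          using branch_weight_nonzero_iff[of K "add_box x' (i - 1)" y] K len by auto
        then show ?thesis by (simp add: T2_def)
      qed
    qed (simp add: T2_def)
    ultimately show ?thesis using True by simp
  next
    case False
    \<comment> \<open>The box identities are used backwards: x' and y' are the smaller tuples, and
      adding boxes leads to the predecessor.\<close>
    define y' where "y' = remove_box y i"
    have yy': "y = add_box y' i" "length y' = (K + 1) div 2" "i \<le> length y'"
      using i False len by (simp_all add: y'_def add_remove_box)
    have cy: "coord y j = (if j = i then coord y' i + 1 else coord y' j)" for j
      using i len unfolding yy'(1) by (subst coord_add_box) auto
    define r where "r = icoord x' (i - 1) - icoord y' i"
    define s where "s = icoord y (i - 1) - icoord x' (i - 1)"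
    define G where "G = gap q i (icoord y (i - 1) - icoord y' i)"
    define L where "L = branch_weight K x' y'"
    have yi: "coord y i \<le> coord y (i - 1)" if "2 \<le> i"
      using y[of "i - 1"] that by simp
    have G: "G > 0"
      using yi cy i one_minus_powi_pos[OF q, of "icoord y (i - 1) - icoord y' i"]
      by (cases "i = 1") (auto simp: G_def gap_def)
    have d: "down q i y = 1 - q powi (icoord y i - icoord y (i + 1))"
      using y[OF i(1)] by (simp add: down_def power_diff_powi)
    have T1G: "T1 * G = L * (gap q i r * down q i y)" if im: "i \<le> K div 2"
    proof -
      have xi: "icoord (add_box x' i) i = icoord x' i + 1" using i im len by (simp add: coord_add_box)
      have "icoord y' (i - 1) = icoord y (i - 1)" using i by (simp add: cy)
      then show ?thesis
        using branch_weight_same[OF K len(1) yy'(2) i(1) yy'(3,1) im refl]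
        unfolding T1[OF im] L_def G_def d r_def by (simp add: cy xi mult_ac)
    qed
    have T2G: "T2 * G = L * (q powi r * (1 - q powi s) * down q i y)" if i2: "2 \<le> i"
    proof -
      have rr: "icoord x' (i - 1) + 1 - icoord y i = r" by (simp add: r_def cy)
      have y1: "icoord y' (i - 1) = icoord y (i - 1)" "icoord y' (i + 1) = icoord y (i + 1)"
        using i by (simp_all add: cy)
      have GG: "G = 1 - q powi (icoord y (i - 1) - icoord y' i)" using i2 by (simp add: G_def gap_def)
      \<comment> \<open>In the last column of an odd level x'_i and y_(i+1) are both beyond the
        lengths, hence both 0.\<close>
      have "down q i y = 1 - q powi (icoord y i - icoord x' i)" if "\<not> i \<le> K div 2"
        using that i len coord_beyond[of x' i] coord_beyond[of y "i + 1"] by (simp add: d)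
      then have "branch_weight K (add_box x' (i - 1)) y * (G * (1 - q powi (icoord y i - icoord x' i)))
          = L * ((1 - q powi s) * down q i y)"
        using branch_weight_diag[OF K len(1) yy'(2) i(1) yy'(3,1) i2 refl]
        unfolding y1 GG[symmetric] L_def d s_def by (cases "i \<le> K div 2") (simp_all add: mult.assoc[symmetric])
      then show ?thesis unfolding T2[OF i2] rr by (simp add: mult_ac)
    qed
    have rs: "G = 1 - q powi r * q powi s" if "2 \<le> i"
      using q that by (subst power_int_add[symmetric]) (auto simp: G_def gap_def r_def s_def)
    have "T1 + T2 = L * down q i y * (if odd K \<and> i = (K + 1) div 2 then theta q x' y' i else 1)"
    proof (cases "i \<le> K div 2")
      case True
      have "(T1 + T2) * G = L * down q i y * G"
      proof (cases "i = 1")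
        case True
        then show ?thesis using T1G \<open>i \<le> K div 2\<close> by (simp add: T2_def G_def gap_def)
      next
        case False
        then show ?thesis using T1G T2G True i
          by (simp add: distrib_right rs) (simp add: gap_def algebra_simps)
      qed
      then show ?thesis using G True by auto
    next
      case False
      then have special: "odd K \<and> i = (K + 1) div 2" "2 \<le> i"
        using i len K by presburger+
      have "T1 = 0" using False len by (simp add: T1_def)
      moreover have "L * theta q x' y' i * G = L * (q powi r * (1 - q powi s))"
      proof (cases "L = 0")
        case False
        then have int: "interlaces x' y'"
          using branch_weight_nonzero_iff[of K x' y'] K len yy' by (auto simp: L_def)
        have ne: "1 \<le> i - 1" "i \<noteq> i - 1" "i \<noteq> 1" using special by auto
        have "coord y' i \<le> coord x' (i - 1)" "coord x' (i - 1) \<le> coord y' (i - 1)"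
          "coord y' i \<le> coord y' (i - 1)"
          using interlacesD[OF int, of i] interlacesD(1)[OF int, of "i - 1"] special by auto
        then have "theta q x' y' i = q powi r * ((1 - q powi s) / G)"
          using ne by (simp add: theta_def power_diff_powi r_def s_def G_def gap_def cy)
        then show ?thesis using G by simp
      qed simp
      ultimately have "(T1 + T2) * G = L * theta q x' y' i * G * down q i y"
        using T2G[OF special(2)] by (simp only: add_0_left mult.assoc)
      then show ?thesis using G special by (simp add: mult_ac)
    qed
    then show ?thesis using False by (simp add: L_def y'_def)
  qed
qed

text \<open>A suppressed right jump leaves x' in place and continues as a left jump of y_m. Its
  weight, computed as if the jump were performed, is the missing part 1 - \<open>theta\<close> of
  the same-column source \<open>T1\<close>. With c = w_(m-1) - x'_m and d = x'_(m-1) - w_(m-1), this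
  comes down to (1 - q^c) + q^c (1 - q^d) = 1 - q^(c+d).\<close>

lemma suppressed_target:
  assumes k: "odd k" "k + 1 \<le> 2 * n" and m: "m = (k + 1) div 2"
    and len: "length w = k div 2" "length x' = m" "length y = m"
  defines "T1 \<equiv> down q m (add_box x' m) * (1 - lprob q m y (add_box x' m)) * branch_weight (k + 1) (add_box x' m) y"
  shows "branch_weight k w (add_box x' m) * u_plus q m x' * (1 - rprob q m y x') * branch_weight (k + 1) x' y
       + branch_weight k w x' * theta q w x' m * T1 = branch_weight k w x' * T1"
proof -
  define x where "x = add_box x' m"
  have k1: "1 \<le> k" and m1: "1 \<le> m" using k m by presburger+
  have K: "(k + 1) div 2 = m" "(k + 1 + 1) div 2 = m" using k m by presburger+
  have cx: "coord x j = (if j = m then coord x' m + 1 else coord x' j)" for j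
    using m1 len by (simp add: x_def coord_add_box)
  have cx': "icoord x = (icoord x')(m := icoord x' m + 1)" by (auto simp: cx)
  have sx: "int (sum_list x) = int (sum_list x') + 1" using m1 len by (simp add: x_def sum_list_add_box)
  have w: "wt k > 0" "wt (k + 1) > 0" using wt_pos k1 k by simp_all
  \<comment> \<open>A box added to x' multiplies the power of \<open>wt k\<close> by a_l. In the
    weight of level k + 1 it lowers the exponent of 1/a_l by one, which is again a factor a_l. So
    both terms of the identity carry the same \<open>wt k\<close>.\<close>
  have ww: "wt k * wt (k + 1) = 1" using w k K unfolding wt_def by (auto simp: m)
  define g where "g = gap q m (icoord w (m - 1) - icoord x' m)"
  have D: "branch_weight k w x * u_plus q m x' = wt k * branch_weight k w x' * g"
  proof -
    have 1: "wt k powi (int (sum_list x) - int (sum_list w))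
        = wt k * wt k powi (int (sum_list x') - int (sum_list w))"
      using w power_int_add[of "wt k" 1 "int (sum_list x') - int (sum_list w)"]
      by (simp add: sx algebra_simps)
    have "branch_prod q (k div 2) (icoord w) (icoord x) * u_plus q m x'
        = branch_prod q (k div 2) (icoord w) (icoord x') * g"
    proof (cases "m = 1")
      case True
      then have "k div 2 = 0" using m k by presburger
      then show ?thesis using True by (simp add: branch_prod_def u_plus_def g_def gap_def)
    next
      case False
      then have m2: "2 \<le> m" "m = k div 2 + 1" using m m1 k by presburger+
      note R = branch_prod_shift_upper[OF q m2 cx', of "icoord w"]
      show ?thesis
      proof (cases "coord x' m \<le> coord x' (m - 1)")
        case True
        then show ?thesis using R m2 by (simp add: u_plus_def g_def gap_def power_diff_powi)
      next
        case F: False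
        have "\<not> interlaces w x'"
          using interlaces_sorted(2)[of w x' "m - 1"] F m2 by auto
        then have "branch_prod q (k div 2) (icoord w) (icoord x') = 0"
          using branch_prod_nonzero_iff[of w k x'] len m by auto
        then show ?thesis using F m2 by (simp add: u_plus_def)
      qed
    qed
    then show ?thesis unfolding branch_weight_def 1 by (simp add: mult_ac)
  qed
  define p where "p = icoord y m - icoord x' m"
  have T1: "T1 = wt k * branch_weight (k + 1) x' y * (1 - q powi p)"
  proof -
    have "T1 = branch_weight (k + 1) x y * (1 - q powi (icoord x m - icoord y (m + 1)))"
    proof (cases "interlaces x y")
      case True
      show ?thesis
        using down_lprob_compl[OF True m1] by (simp add: T1_def x_def)
    next
      case False
      then have "branch_weight (k + 1) x y = 0"
        using branch_weight_nonzero_iff[of "k + 1" x y] K k len by (auto simp: x_def)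
      then show ?thesis by (simp add: T1_def x_def)
    qed
    moreover have "wt k * wt (k + 1) powi (int (sum_list y) - int (sum_list x'))
        = wt (k + 1) powi (int (sum_list y) - int (sum_list x))"
    proof -
      have "wt (k + 1) powi (int (sum_list y) - int (sum_list x'))
          = wt (k + 1) * wt (k + 1) powi (int (sum_list y) - int (sum_list x))"
        using w power_int_add[of "wt (k + 1)" 1 "int (sum_list y) - int (sum_list x)"]
        by (simp add: sx algebra_simps)
      then show ?thesis using ww by (simp add: mult.assoc[symmetric])
    qed
    moreover have "branch_prod q m (icoord x') (icoord y) * (1 - q powi p)
        = branch_prod q m (icoord x) (icoord y) * (1 - q powi (icoord x m - icoord y (m + 1)))"
      using branch_prod_shift_lower[OF q m1 order.refl cx', of "icoord y"] by (simp add: p_def)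
    ultimately show ?thesis
      unfolding branch_weight_def K by (simp add: mult.assoc[symmetric])
  qed
  show ?thesis
  proof (cases "branch_weight k w x' = 0 \<or> branch_weight (k + 1) x' y = 0")
    case True
    then show ?thesis using D T1 by (auto simp: x_def)
  next
    case False
    then have int: "interlaces w x'" "interlaces x' y"
      using branch_weight_nonzero_iff[of k w x'] branch_weight_nonzero_iff[of "k + 1" x' y] k k1 K len m by auto
    have r: "u_plus q m x' * (1 - rprob q m y x') = 1 - q powi p"
      using u_plus_rprob_compl[OF int(2) m1] by (simp add: p_def)
    have "g * (1 - rprob q m y x') + theta q w x' m * (1 - q powi p) = 1 - q powi p"
    proof (cases "m = 1")
      case True
      then show ?thesis using r by (simp add: g_def gap_def theta_def u_plus_def)
    next
      case ne: False
      have o: "coord x' m \<le> coord w (m - 1)" "coord w (m - 1) \<le> coord x' (m - 1)"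
        "coord x' m \<le> coord y m" "coord y m \<le> coord x' (m - 1)"
        using interlacesD[OF int(1), of m] interlacesD(1)[OF int(1), of "m - 1"]
          interlacesD[OF int(2), of m] ne m1 by auto
      define u where "u = 1 - q ^ (coord x' (m - 1) - coord x' m)"
      have u: "u = u_plus q m x'" using ne by (simp add: u_def u_plus_def)
      show ?thesis
      proof (cases "coord x' (m - 1) = coord x' m")
        \<comment> \<open>The tuples w and y are squeezed here: w_(m-1) = y_m = x'_m, so both
          \<open>g\<close> and 1 - q^p are 0.\<close>
        case True
        then show ?thesis using o ne by (simp add: g_def gap_def theta_def p_def)
      next
        case False
        then have "u > 0" using o one_minus_power_pos[OF q] by (simp add: u_def)
        have "g + theta q w x' m * u = 1 - q ^ (coord w (m - 1) - coord x' m)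
            + q ^ (coord w (m - 1) - coord x' m) * (1 - q ^ (coord x' (m - 1) - coord w (m - 1)))"
          using \<open>u > 0\<close> ne o by (simp add: g_def gap_def theta_def u_def power_diff_powi)
        also have "\<dots> = u"
          using o by (simp add: u_def right_diff_distrib power_add[symmetric])
        finally have "(g + theta q w x' m * u) * (1 - rprob q m y x') = u * (1 - rprob q m y x')" by simp
        then show ?thesis using r by (simp add: u distrib_right mult.assoc)
      qed
    qed
    then have "wt k * branch_weight k w x' * branch_weight (k + 1) x' y
        * (g * (1 - rprob q m y x') + theta q w x' m * (1 - q powi p))
      = wt k * branch_weight k w x' * branch_weight (k + 1) x' y * (1 - q powi p)" by simp
    then show ?thesis
      using D unfolding T1 x_def[symmetric] by (simp add: algebra_simps)
  qed
qed

end

section \<open>Insertion as a walk through the levels\<close>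

lemma level_update:
  "1 \<le> k \<Longrightarrow> k \<le> length Z \<Longrightarrow> level (Z[k - Suc 0 := x]) j = (if j = k then x else level Z j)"
  by (auto simp: level_def nth_list_update)

lemma level_0 [simp]: "level Z 0 = []"
  by (simp add: level_def)

lemma update_level [simp]: "1 \<le> k \<Longrightarrow> k \<le> length Z \<Longrightarrow> Z[k - Suc 0 := level Z k] = Z"
  by (simp add: level_def)

lemma pmf_map_bernoulli:
  assumes "0 \<le> p" "p \<le> 1"
  shows "pmf (map_pmf g (bernoulli_pmf p)) t = p * of_bool (g True = t) + (1 - p) * of_bool (g False = t)"
  unfolding map_pmf_def pmf_bind
  using assms by (simp add: pmf_return indicator_def of_bool_def)

text \<open>\<open>F\<close> only has to contain the possible predecessors. Spurious members are
  allowed, so a uniform list of candidates can be used.\<close>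

lemma pmf_bind_finite:
  assumes "finite F" "\<And>s. pmf p s \<noteq> 0 \<Longrightarrow> pmf (g s) t \<noteq> 0 \<Longrightarrow> s \<in> F"
  shows "pmf (bind_pmf p g) t = (\<Sum>s\<in>F. pmf p s * pmf (g s) t)"
proof -
  have "pmf (bind_pmf p g) t = measure_pmf.expectation p (\<lambda>s. pmf (g s) t)"
    by (rule pmf_bind)
  also have "\<dots> = (\<Sum>s\<in>F. pmf (g s) t * pmf p s)"
    using assms by (intro integral_measure_pmf_real) (auto simp: set_pmf_iff)
  finally show ?thesis by (simp add: mult.commute)
qed

text \<open>
  \<open>Wait l\<close> is a letter whose insertion starts on a higher level; the other constructors carry the
  column of the jump that is attempted or performed next.
\<close>

datatype pending = Wait letter | Rightward nat | Leftward nat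

section \<open>Weights of patterns and of states of the walk\<close>

context berele
begin

text \<open>Only the lengths are prescribed, since a partly updated configuration need not
  interlace. \<open>weight\<close> vanishes where interlacing fails.\<close>

definition shaped :: "pattern \<Rightarrow> bool" where
  "shaped Z \<longleftrightarrow> length Z = 2 * n \<and> (\<forall>k\<in>{1..2 * n}. length (level Z k) = (k + 1) div 2)"

definition weight :: "pattern \<Rightarrow> real" where
  "weight Z = (\<Prod>j=1..2 * n. branch_weight j (level Z (j - 1)) (level Z j))"

lemma shapedD: "shaped Z \<Longrightarrow> k \<le> 2 * n \<Longrightarrow> length (level Z k) = (k + 1) div 2"
  unfolding shaped_def by (cases "k = 0") auto

lemma shaped_update:
  assumes "shaped Z" "1 \<le> k" "k \<le> 2 * n"
  shows "shaped (Z[k - 1 := x]) \<longleftrightarrow> length x = (k + 1) div 2"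
  using assms unfolding shaped_def by (auto simp: level_update dest: bspec[of _ _ k])

text \<open>A level that interlaces with the one before it is sorted. Level 1 has a single
  coordinate and interlaces with the empty level 0.\<close>

lemma patterns_iff_weight: "Z \<in> patterns n \<longleftrightarrow> shaped Z \<and> weight Z \<noteq> 0"
proof -
  have "weight Z \<noteq> 0 \<longleftrightarrow> (\<forall>k\<in>{1..<2 * n}. interlaces (level Z k) (level Z (k + 1)))" if sh: "shaped Z"
  proof -
    have int: "branch_weight k (level Z (k - 1)) (level Z k) \<noteq> 0 \<longleftrightarrow> interlaces (level Z (k - 1)) (level Z k)"
      if "1 \<le> k" "k \<le> 2 * n" for k
      using that sh by (intro branch_weight_nonzero_iff) (auto simp: shapedD)
    have one: "interlaces (level Z 0) (level Z 1)" if "n \<ge> 1"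
      using shapedD[OF sh, of 1] that coord_beyond[of "level Z 1"] by (auto simp: interlaces_def coord_def)
    have "weight Z \<noteq> 0 \<longleftrightarrow> (\<forall>k\<in>{1..2 * n}. interlaces (level Z (k - 1)) (level Z k))"
      using int by (auto simp: weight_def)
    also have "\<dots> \<longleftrightarrow> (\<forall>k\<in>{1..<2 * n}. interlaces (level Z k) (level Z (k + 1)))"
    proof safe
      fix k assume "\<forall>k\<in>{1..2 * n}. interlaces (level Z (k - 1)) (level Z k)" "k \<in> {1..<2 * n}"
      then show "interlaces (level Z k) (level Z (k + 1))" by (auto dest: bspec[of _ _ "k + 1"])
    next
      fix k assume *: "\<forall>k\<in>{1..<2 * n}. interlaces (level Z k) (level Z (k + 1))" "k \<in> {1..2 * n}"
      show "interlaces (level Z (k - 1)) (level Z k)"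
      proof (cases "k = 1")
        case True
        then show ?thesis using one * by simp
      next
        case False
        then have "k - 1 \<in> {1..<2 * n}" "k - 1 + 1 = k" using *(2) by auto
        with *(1) show ?thesis by metis
      qed
    qed
    finally show ?thesis .
  qed
  moreover have "Z \<in> patterns n \<longleftrightarrow> shaped Z \<and> (\<forall>k\<in>{1..<2 * n}. interlaces (level Z k) (level Z (k + 1)))"
  proof -
    have "(\<forall>l\<in>{1..n}. level Z (2 * l - 1) \<in> tuples l \<and> level Z (2 * l) \<in> tuples l)
        \<longleftrightarrow> (\<forall>k\<in>{1..2 * n}. level Z k \<in> tuples ((k + 1) div 2))" (is "?L \<longleftrightarrow> ?R")
    proof
      assume L: ?L
      show ?R
      proof
        fix k assume k: "k \<in> {1..2 * n}"
        then have "(k + 1) div 2 \<in> {1..n}" by auto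
        with L have *: "level Z (2 * ((k + 1) div 2) - 1) \<in> tuples ((k + 1) div 2)"
          "level Z (2 * ((k + 1) div 2)) \<in> tuples ((k + 1) div 2)" by blast+
        have "k = 2 * ((k + 1) div 2) - 1 \<or> k = 2 * ((k + 1) div 2)" using k by auto
        then show "level Z k \<in> tuples ((k + 1) div 2)" using * by metis
      qed
    next
      assume R: ?R
      show ?L
      proof
        fix l assume l: "l \<in> {1..n}"
        have "(2 * l - 1 + 1) div 2 = l" "(2 * l + 1) div 2 = l" "2 * l - 1 \<in> {1..2 * n}" "2 * l \<in> {1..2 * n}"
          using l by auto
        then show "level Z (2 * l - 1) \<in> tuples l \<and> level Z (2 * l) \<in> tuples l"
          using bspec[OF R, of "2 * l - 1"] bspec[OF R, of "2 * l"] by metis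
      qed
    qed
    then have 1: "Z \<in> patterns n \<longleftrightarrow> length Z = 2 * n \<and> (\<forall>k\<in>{1..2 * n}. level Z k \<in> tuples ((k + 1) div 2))
        \<and> (\<forall>k\<in>{1..<2 * n}. interlaces (level Z k) (level Z (k + 1)))"
      by (simp add: patterns_def)
    have 2: "level Z k \<in> tuples ((k + 1) div 2)"
      if sh: "shaped Z" and int: "\<forall>k\<in>{1..<2 * n}. interlaces (level Z k) (level Z (k + 1))"
        and k: "k \<in> {1..2 * n}" for k
    proof (cases "k = 1")
      case True
      then show ?thesis using shapedD[OF sh, of 1] k coord_beyond[of "level Z 1"] by (auto simp: tuples_iff)
    next
      case False
      then have "k - 1 \<in> {1..<2 * n}" "k - 1 + 1 = k" using k by auto
      with int have "interlaces (level Z (k - 1)) (level Z k)" by metis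
      then show ?thesis
        using shapedD[OF sh, of k] k interlaces_sorted(2) by (auto simp: tuples_iff)
    qed
    show ?thesis unfolding 1 using 2 by (auto simp: shaped_def tuples_iff)
  qed
  ultimately show ?thesis by blast
qed

lemma weight_nonneg: "0 \<le> weight Z"
  unfolding weight_def by (intro prod_nonneg branch_weight_nonneg) auto

fun run :: "nat \<Rightarrow> pending \<times> pattern \<Rightarrow> pattern pmf" where
  "run k (Wait l, Z) = right_attempt n q (letter_order l) 1 Z"
| "run k (Rightward i, Z) = right_attempt n q k i Z"
| "run k (Leftward i, Z) = left_jump n q k i Z"

fun step :: "nat \<Rightarrow> pending \<times> pattern \<Rightarrow> (pending \<times> pattern) pmf" where
  "step k (Wait l, Z) = return_pmf (if letter_order l = k + 1 then Rightward 1 else Wait l, Z)"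
| "step k (Rightward i, Z) = map_pmf (\<lambda>b.
      if odd k \<and> i = (k + 1) div 2 \<and> \<not> b then (Leftward i, Z)
      else (Rightward (if b then i else i + 1), move_right k i Z))
    (bernoulli_pmf (rprob q i (level Z (k + 1)) (level Z k)))"
| "step k (Leftward i, Z) = map_pmf (\<lambda>b. (Leftward (if b then i + 1 else i), move_left k i Z))
    (bernoulli_pmf (lprob q i (level Z (k + 1)) (level Z k)))"

text \<open>An insertion is a Markov walk in the level index; a letter of higher order simply waits
  on the lower levels. This permits induction over levels for all letters at once.\<close>

lemma run_step:
  assumes "k < 2 * n"
  shows "run k s = bind_pmf (step k s) (run (k + 1))"
proof (cases s)
  case (Pair A Z)
  show ?thesis
  proof (cases A)
    case (Wait l)
    then show ?thesis by (simp add: Pair bind_return_pmf)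
  next
    case (Rightward i)
    then show ?thesis using assms
      by (simp add: Pair bind_map_pmf right_attempt.simps[of n q k i Z])
         (auto intro!: bind_pmf_cong)
  next
    case (Leftward i)
    then show ?thesis using assms
      by (simp add: Pair bind_map_pmf left_jump.simps[of n q k i Z])
  qed
qed

definition before :: "nat \<Rightarrow> pattern \<Rightarrow> real" where
  "before k Z = (\<Prod>j\<in>{1..<k}. branch_weight j (level Z (j - 1)) (level Z j))"

definition after :: "nat \<Rightarrow> pattern \<Rightarrow> real" where
  "after k Z = (\<Prod>j\<in>{k<..2 * n}. branch_weight j (level Z (j - 1)) (level Z j))"

text \<open>
  The candidate for the law of the walk: a pending jump contributes the branching weight of the level
  as it will be after the jump, times the rate of \<open>Lweight\<close>.  A right jump is weighted as if it were
  performed, even when it may still be suppressed.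
\<close>

fun pending_weight :: "nat \<Rightarrow> pending \<Rightarrow> nat list \<Rightarrow> nat list \<Rightarrow> real" where
  "pending_weight k (Wait l) w x = wt (letter_order l) * branch_weight k w x"
| "pending_weight k (Rightward i) w x = branch_weight k w (add_box x i) * u_plus q i x"
| "pending_weight k (Leftward i) w x = (if coord x i = 0 then 0 else branch_weight k w (remove_box x i) * down q i x
      * (if odd k \<and> i = (k + 1) div 2 then theta q w (remove_box x i) i else 1))"

text \<open>Level k is seen from two sides: \<open>pending_weight\<close> compares level k - 1 with
  level k after its jump, whereas \<open>after\<close> compares level k before its jump with level k
  + 1. The latter is the configuration at which the next probability is evaluated.\<close>

definition state_weight :: "nat \<Rightarrow> pending \<times> pattern \<Rightarrow> real" where
  "state_weight k s = before k (snd s)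
     * pending_weight k (fst s) (level (snd s) (k - 1)) (level (snd s) k) * after k (snd s)"

text \<open>On level 0 the range of i is empty, so that only waiting letters are admissible.\<close>

fun admissible :: "nat \<Rightarrow> pending \<Rightarrow> bool" where
  "admissible k (Wait l) \<longleftrightarrow> l \<in> alphabet n \<and> k < letter_order l"
| "admissible k (Rightward i) \<longleftrightarrow> 1 \<le> i \<and> i \<le> (k + 1) div 2"
| "admissible k (Leftward i) \<longleftrightarrow> 1 \<le> i \<and> i \<le> (k + 1) div 2"

end

section \<open>The walk started from the weighted law on one shape\<close>

locale berele_shape = berele +
  fixes mu :: "nat list" and P :: real and PZ :: "pattern pmf" and PL :: "letter pmf"
  assumes mu: "mu \<in> tuples n"
    and PZ: "\<And>Z. pmf PZ Z = (if Z \<in> patterns_of_shape n mu then weight Z / P else 0)"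
    and PL: "\<And>l. pmf PL l = (if l \<in> alphabet n then wt (letter_order l) / normalizer n a else 0)"
begin

definition compatible :: "nat \<Rightarrow> pending \<times> pattern \<Rightarrow> bool" where
  "compatible k s \<longleftrightarrow> shaped (snd s) \<and> level (snd s) (2 * n) = mu \<and> admissible k (fst s)"

text \<open>The law when level k is about to move; level k and all later levels still have their
  initial values.\<close>

primrec pending_dist :: "nat \<Rightarrow> (pending \<times> pattern) pmf" where
  "pending_dist 0 = map_pmf (\<lambda>(l, Z). (Wait l, Z)) (pair_pmf PL PZ)"
| "pending_dist (Suc k) = bind_pmf (pending_dist k) (step k)"

lemma pending_dist_run: "k \<le> 2 * n \<Longrightarrow> bind_pmf (pending_dist 0) (run 0) = bind_pmf (pending_dist k) (run k)"
proof (induction k)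
  case (Suc k)
  then have "bind_pmf (pending_dist 0) (run 0) = bind_pmf (pending_dist k) (\<lambda>s. bind_pmf (step k s) (run (Suc k)))"
    using run_step[of k] by (simp add: bind_assoc_pmf)
  then show ?case by (simp add: bind_assoc_pmf)
qed simp

lemma pmf_dist_0: "pmf (pending_dist 0) (Wait l, Z) = pmf PL l * pmf PZ Z"
proof -
  have "inj (\<lambda>(l, Z). (Wait l, Z))" by (auto simp: inj_def)
  from pmf_map_inj'[OF this, of "pair_pmf PL PZ" "(l, Z)"] show ?thesis
    by (simp add: pmf_pair)
qed

lemma set_dist_0: "s \<in> set_pmf (pending_dist 0) \<Longrightarrow> \<exists>l\<in>alphabet n. \<exists>Z\<in>patterns_of_shape n mu. s = (Wait l, Z)"
  using PZ PL by (auto simp: set_pmf_iff split: if_splits)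

text \<open>Untouched levels inherit sortedness from the initial pattern, and no jump is ever handed
  to a column outside its row.\<close>

lemma compatible_pending_dist:
  "k \<le> 2 * n \<Longrightarrow> s \<in> set_pmf (pending_dist k) \<Longrightarrow>
     compatible k s \<and> (\<forall>j\<in>{k..2 * n}. level (snd s) j \<in> tuples ((j + 1) div 2))"
proof (induction k arbitrary: s)
  case 0
  then obtain l Z where s: "s = (Wait l, Z)" "l \<in> alphabet n" "Z \<in> patterns n" "level Z (2 * n) = mu"
    using set_dist_0[of s] by (auto simp: patterns_of_shape_def simp del: pending_dist.simps)
  have sh: "shaped Z" using s by (simp add: patterns_iff_weight)
  have "level Z j \<in> tuples ((j + 1) div 2)" if "j \<le> 2 * n" for j
  proof (cases "j = 0")
    case True
    then show ?thesis by (simp add: tuples_def)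
  next
    case False
    then have j: "(j + 1) div 2 \<in> {1..n}" using that by auto
    have "j = 2 * ((j + 1) div 2) - 1 \<or> j = 2 * ((j + 1) div 2)" by auto
    moreover have "level Z (2 * ((j + 1) div 2) - 1) \<in> tuples ((j + 1) div 2)"
      "level Z (2 * ((j + 1) div 2)) \<in> tuples ((j + 1) div 2)"
      using s(3) j unfolding patterns_def by blast+
    ultimately show ?thesis by metis
  qed
  moreover have "0 < letter_order l" using s(2) by (auto simp: alphabet_def)
  ultimately show ?case using s sh by (auto simp: compatible_def)
next
  case (Suc k)
  then obtain A Z where AZ: "(A, Z) \<in> set_pmf (pending_dist k)" "s \<in> set_pmf (step k (A, Z))" by auto
  with Suc have IH: "shaped Z" "level Z (2 * n) = mu" "admissible k A"
    "\<forall>j\<in>{k..2 * n}. level Z j \<in> tuples ((j + 1) div 2)" by (force simp: compatible_def)+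
  have len: "length (level Z k) = (k + 1) div 2" "length (level Z (k + 1)) = (k + 2) div 2"
    using IH(1) Suc.prems(1) shapedD[of Z k] shapedD[of Z "k + 1"] by auto
  have upd: "shaped (Z[k - 1 := x])" "level (Z[k - 1 := x]) (2 * n) = mu"
    "\<forall>j\<in>{Suc k..2 * n}. level (Z[k - 1 := x]) j \<in> tuples ((j + 1) div 2)"
    if "length x = (k + 1) div 2" "1 \<le> k" for x
    using that IH Suc.prems(1) shaped_update[of Z k x] by (auto simp: level_update shaped_def)
  show ?case
  proof (cases A)
    case (Wait l)
    then show ?thesis using AZ IH by (auto simp: compatible_def alphabet_def)
  next
    case (Rightward i)
    have k1: "1 \<le> k" using IH(3) by (cases k) (auto simp: Rightward)
    consider "odd k" "i = (k + 1) div 2" "s = (Leftward i, Z)"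
      | "s = (Rightward i, move_right k i Z)"
      | "\<not> (odd k \<and> i = (k + 1) div 2)" "s = (Rightward (i + 1), move_right k i Z)"
      using AZ(2) by (auto simp: Rightward split: if_splits)
    then show ?thesis
    proof cases
      case 1
      then show ?thesis using IH Rightward by (auto simp: compatible_def)
    next
      case 2
      then show ?thesis
        using IH Rightward upd[of "add_box (level Z k) i"] len k1 by (auto simp: compatible_def move_right_def)
    next
      case 3
      \<comment> \<open>For odd k the next level is not longer, but a right jump of its last column
        is the excluded, suppressible case.\<close>
      moreover have "i + 1 \<le> (Suc k + 1) div 2" using 3(1) IH(3) unfolding Rightward admissible.simps by presburger
      ultimately show ?thesis
        using IH Rightward upd[of "add_box (level Z k) i"] len k1 by (auto simp: compatible_def move_right_def)
    qed
  next
    case (Leftward i)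
    have k1: "1 \<le> k" using IH(3) by (cases k) (auto simp: Leftward)
    consider "s = (Leftward i, move_left k i Z)"
      | "s = (Leftward (i + 1), move_left k i Z)" "i + 1 \<le> (Suc k + 1) div 2"
    proof (cases "i + 1 \<le> (Suc k + 1) div 2")
      case True
      then show ?thesis using that AZ(2) by (auto simp: Leftward split: if_splits)
    next
      case False
      \<comment> \<open>Column i + 1 lies beyond both tuples, so the numerator is 1 - q^0.\<close>
      then have "lprob q i (level Z (k + 1)) (level Z k) = 0"
        using len by (simp add: lprob_def coord_beyond)
      moreover have "True \<notin> set_pmf (bernoulli_pmf 0)" by (simp add: set_pmf_iff)
      ultimately have "s = (Leftward i, move_left k i Z)" using AZ(2) by (auto simp: Leftward)
      then show ?thesis using that by blast
    qed
    then show ?thesis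
    proof cases
      case 1
      then show ?thesis
        using IH Leftward upd[of "remove_box (level Z k) i"] len k1 by (auto simp: compatible_def move_left_def)
    next
      case 2
      then show ?thesis
        using IH Leftward upd[of "remove_box (level Z k) i"] len k1 by (auto simp: compatible_def move_left_def)
    qed
  qed
qed

declare pending_dist.simps [simp del]

end

lemma remove_box_move_right:
  "1 \<le> k \<Longrightarrow> k \<le> length Z \<Longrightarrow> 1 \<le> i \<Longrightarrow> i \<le> length (level Z k) \<Longrightarrow> Z' = move_right k i Z \<Longrightarrow>
    Z = Z'[k - 1 := remove_box (level Z' k) i]"
  by (simp add: move_right_def level_update remove_add_box)

lemma add_box_move_left:
  "1 \<le> k \<Longrightarrow> k \<le> length Z \<Longrightarrow> 1 \<le> i \<Longrightarrow> i \<le> length (level Z k) \<Longrightarrow> 0 < coord (level Z k) i \<Longrightarrow>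
    Z' = move_left k i Z \<Longrightarrow> Z = Z'[k - 1 := add_box (level Z' k) i]"
  by (simp add: move_left_def level_update add_remove_box)

section \<open>One-step probabilities and the factorization around level k\<close>

context berele
begin

text \<open>The masses of \<open>step\<close> with the truncation of \<open>bernoulli_pmf\<close>
  ignored; they are correct where levels k and k + 1 interlace.\<close>

fun step_prob :: "nat \<Rightarrow> pending \<times> pattern \<Rightarrow> pending \<times> pattern \<Rightarrow> real" where
  "step_prob k (Wait l, Z) t = of_bool ((if letter_order l = k + 1 then Rightward 1 else Wait l, Z) = t)"
| "step_prob k (Rightward i, Z) t = rprob q i (level Z (k + 1)) (level Z k) * of_bool ((Rightward i, move_right k i Z) = t)
    + (1 - rprob q i (level Z (k + 1)) (level Z k))
      * of_bool ((if odd k \<and> i = (k + 1) div 2 then (Leftward i, Z) else (Rightward (i + 1), move_right k i Z)) = t)"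
| "step_prob k (Leftward i, Z) t = lprob q i (level Z (k + 1)) (level Z k) * of_bool ((Leftward (i + 1), move_left k i Z) = t)
    + (1 - lprob q i (level Z (k + 1)) (level Z k)) * of_bool ((Leftward i, move_left k i Z) = t)"

lemma pmf_step:
  assumes "interlaces (level Z k) (level Z (k + 1))" "admissible k A"
  shows "pmf (step k (A, Z)) t = step_prob k (A, Z) t"
proof (cases A)
  case (Wait l)
  then show ?thesis by (simp add: pmf_return)
next
  case (Rightward i)
  with assms rprob_bounds[OF assms(1), of i] show ?thesis by (simp add: pmf_map_bernoulli)
next
  case (Leftward i)
  with assms lprob_bounds[OF assms(1), of i] show ?thesis by (simp add: pmf_map_bernoulli)
qed

lemma before_update: "1 \<le> k \<Longrightarrow> k \<le> length Z \<Longrightarrow> before k (Z[k - 1 := x]) = before k Z"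
  unfolding before_def by (intro prod.cong) (auto simp: level_update)

lemma after_update: "1 \<le> k \<Longrightarrow> k \<le> length Z \<Longrightarrow> after (Suc k) (Z[k - 1 := x]) = after (Suc k) Z"
  unfolding after_def by (intro prod.cong) (auto simp: level_update)

lemma before_Suc: "1 \<le> k \<Longrightarrow> before (Suc k) Z = before k Z * branch_weight k (level Z (k - 1)) (level Z k)"
  unfolding before_def by (simp add: prod.atLeastLessThan_Suc)

lemma after_Suc: "k < 2 * n \<Longrightarrow> after k Z = branch_weight (Suc k) (level Z k) (level Z (Suc k)) * after (Suc k) Z"
proof -
  assume "k < 2 * n"
  then have "{k<..2 * n} = insert (Suc k) {Suc k<..2 * n}" by auto
  then show ?thesis unfolding after_def by simp
qed

text \<open>Together with \<open>state_weight_next\<close> this exhibits a common factor of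
  predecessors and target, \<open>before k Z * after (Suc k) Z\<close>. What remains is an identity
  for the levels k - 1, k and k + 1.\<close>

lemma state_weight_update:
  assumes "1 \<le> k" "k < 2 * n" "shaped Z"
  shows "state_weight k (A, Z[k - 1 := x]) = before k Z * after (Suc k) Z
      * (pending_weight k A (level Z (k - 1)) x * branch_weight (k + 1) x (level Z (k + 1)))"
proof -
  have kl: "k \<le> length Z" using assms by (simp add: shaped_def)
  have lev: "level (Z[k - 1 := x]) k = x" "level (Z[k - 1 := x]) (Suc k) = level Z (k + 1)"
    "level (Z[k - 1 := x]) (k - 1) = level Z (k - 1)"
    using assms(1) kl by (auto simp: level_update)
  show ?thesis
    unfolding state_weight_def snd_conv fst_conv before_update[OF assms(1) kl]
      after_Suc[OF assms(2)] after_update[OF assms(1) kl] lev by simp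
qed

lemma state_weight_next:
  assumes "1 \<le> k"
  shows "state_weight (k + 1) (A, Z) = before k Z * after (Suc k) Z
      * (branch_weight k (level Z (k - 1)) (level Z k) * pending_weight (k + 1) A (level Z k) (level Z (k + 1)))"
  using assms by (simp add: state_weight_def before_Suc)

lemma letter_order_eq_iff:
  assumes "l \<in> alphabet n" "1 \<le> k"
  shows "letter_order l = k \<longleftrightarrow> l = (if odd k then Plain ((k + 1) div 2) else Barred (k div 2))"
proof (cases l)
  case (Plain j)
  with assms have "1 \<le> j" by (auto simp: alphabet_def)
  then have "2 * j - 1 = k \<longleftrightarrow> odd k \<and> j = (k + 1) div 2" by presburger
  then show ?thesis by (simp add: Plain)
next
  case (Barred j)
  have "2 * j = k \<longleftrightarrow> even k \<and> j = k div 2" by presburger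
  then show ?thesis by (simp add: Barred)
qed

lemma branch_weight_0: "branch_weight 0 [] [] = 1"
  by (simp add: branch_weight_def branch_prod_def)

lemma branch_weight_1: "length x = 1 \<Longrightarrow> 1 \<le> n \<Longrightarrow> branch_weight 1 [] (add_box x 1) = wt 1 * branch_weight 1 [] x"
  using wt_pos[of 1] power_int_add[of "wt 1" 1 "int (sum_list x)"]
  by (simp add: branch_weight_def branch_prod_def sum_list_add_box)

end

section \<open>Induction step over the levels\<close>

context berele_shape
begin

definition nconst :: real where "nconst = normalizer n a * P"

context
  fixes k :: nat
  assumes k: "k < 2 * n"
    and IH: "\<And>s. compatible k s \<Longrightarrow> pmf (pending_dist k) s = state_weight k s / nconst"
begin

text \<open>Where levels k and k + 1 fail to interlace, \<open>step_prob\<close> may be wrong, but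
  then \<open>state_weight k\<close> contains a vanishing branching weight and both sides are
  0.\<close>

lemma contribution:
  assumes s: "shaped Z" "level Z (2 * n) = mu" "admissible k A"
  shows "pmf (pending_dist k) (A, Z) * pmf (step k (A, Z)) t = state_weight k (A, Z) * step_prob k (A, Z) t / nconst"
proof (cases "interlaces (level Z k) (level Z (k + 1))")
  case True
  then show ?thesis using IH[of "(A, Z)"] s pmf_step by (simp add: compatible_def)
next
  case False
  then have "branch_weight (Suc k) (level Z k) (level Z (Suc k)) = 0"
    using branch_weight_nonzero_iff[of "Suc k" "level Z k" "level Z (Suc k)"] k s(1) by (simp add: shapedD)
  then have "state_weight k (A, Z) = 0"
    using k by (simp add: state_weight_def after_Suc)
  then show ?thesis using IH[of "(A, Z)"] s by (simp add: compatible_def)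
qed

text \<open>Applied with x the value of level k before its move: a predecessor differs from its
  target on level k at most.\<close>

lemma contribution_update:
  assumes s: "shaped Z'" "level Z' (2 * n) = mu" and k1: "1 \<le> k"
    and x: "length x = (k + 1) div 2" and A: "admissible k A"
  shows "pmf (pending_dist k) (A, Z'[k - 1 := x]) * pmf (step k (A, Z'[k - 1 := x])) t
     = before k Z' * after (Suc k) Z' / nconst * (pending_weight k A (level Z' (k - 1)) x
        * branch_weight (k + 1) x (level Z' (k + 1)) * step_prob k (A, Z'[k - 1 := x]) t)"
proof -
  have "shaped (Z'[k - 1 := x])" "level (Z'[k - 1 := x]) (2 * n) = mu"
    using s x k1 k shaped_update[of Z' k x] by (auto simp: shaped_def level_update)
  from contribution[OF this A] show ?thesis
    using state_weight_update[OF k1 k s(1), of A x] by (simp add: mult_ac)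
qed

lemma inadmissible: "\<not> admissible k A \<Longrightarrow> pmf (pending_dist k) (A, Z) = 0"
  using compatible_pending_dist[of k "(A, Z)"] k by (auto simp: compatible_def set_pmf_iff)

text \<open>The transfer identities need a sorted level k + 1; this settles the other states. An
  unsorted untouched level is never reached. It is also not the top level, which is
  \<open>mu\<close>, and cannot interlace with level j + 1, so \<open>after\<close> is 0.\<close>

lemma pmf_dist_Suc_unsorted:
  assumes t: "compatible (k + 1) t" and j: "j \<in> {k + 1..2 * n}" "level (snd t) j \<notin> tuples ((j + 1) div 2)"
  shows "pmf (pending_dist (Suc k)) t = state_weight (k + 1) t / nconst"
proof -
  have "pmf (pending_dist (Suc k)) t = 0"
    using compatible_pending_dist[of "Suc k" t] k j
    by (cases "pmf (pending_dist (Suc k)) t = 0") (auto simp: set_pmf_iff)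
  moreover have "after (k + 1) (snd t) = 0"
  proof -
    have sh: "shaped (snd t)" using t by (simp add: compatible_def)
    have "j \<noteq> 2 * n" using j(2) t mu by (auto simp: compatible_def)
    then have j': "j + 1 \<in> {k + 1<..2 * n}" using j(1) by auto
    have "\<not> interlaces (level (snd t) j) (level (snd t) (j + 1))"
      using j(2) interlaces_sorted(1)[of "level (snd t) j"] shapedD[OF sh, of j] j(1)
      by (auto simp: tuples_iff)
    then have "branch_weight (j + 1) (level (snd t) (j + 1 - 1)) (level (snd t) (j + 1)) = 0"
      using branch_weight_nonzero_iff[of "j + 1" "level (snd t) j" "level (snd t) (j + 1)"] j' sh by (auto simp: shapedD)
    then show ?thesis
      unfolding after_def using j' by (intro prod_zero bexI[of _ "j + 1"]) auto
  qed
  ultimately show ?thesis by (simp add: state_weight_def)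
qed

lemma pmf_dist_Suc_Wait:
  assumes t: "compatible (k + 1) (Wait l, Z')"
  shows "pmf (pending_dist (Suc k)) (Wait l, Z') = state_weight (k + 1) (Wait l, Z') / nconst"
proof -
  have adm: "admissible k (Wait l)" "letter_order l \<noteq> k + 1" and sh: "shaped Z'" "level Z' (2 * n) = mu"
    using t by (auto simp: compatible_def)
  have "pmf (pending_dist (Suc k)) (Wait l, Z') = (\<Sum>s\<in>{(Wait l, Z')}. pmf (pending_dist k) s * pmf (step k s) (Wait l, Z'))"
    unfolding pending_dist.simps
  proof (rule pmf_bind_finite)
    fix s assume "pmf (step k s) (Wait l, Z') \<noteq> 0"
    then have "(Wait l, Z') \<in> set_pmf (step k s)" by (simp add: set_pmf_iff)
    then show "s \<in> {(Wait l, Z')}"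
      by (cases "(k, s)" rule: step.cases) (auto split: if_splits)
  qed simp
  also have "\<dots> = state_weight k (Wait l, Z') / nconst"
    using contribution[OF sh adm(1), of "(Wait l, Z')"] adm(2) by simp
  also have "state_weight k (Wait l, Z') = state_weight (k + 1) (Wait l, Z')"
    using k by (cases "k = 0")
      (simp_all add: state_weight_def after_Suc before_Suc branch_weight_0 before_def)
  finally show ?thesis .
qed

lemma pmf_dist_Suc_Rightward:
  assumes t: "compatible (k + 1) (Rightward i, Z')" and k1: "1 \<le> k"
    and sorted: "\<And>j. j \<ge> 1 \<Longrightarrow> coord (level Z' (k + 1)) (j + 1) \<le> coord (level Z' (k + 1)) j"
  shows "pmf (pending_dist (Suc k)) (Rightward i, Z') = state_weight (k + 1) (Rightward i, Z') / nconst"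
proof -
  define x' y w where "x' = level Z' k" and "y = level Z' (k + 1)" and "w = level Z' (k - 1)"
  define C where "C = before k Z' * after (Suc k) Z' / nconst"
  define l where "l = (if odd (k + 1) then Plain ((k + 1 + 1) div 2) else Barred ((k + 1) div 2))"
  define Zr where "Zr = (\<lambda>j. Z'[k - 1 := remove_box x' j])"
  define t where "t = (Rightward i, Z')"
  have sh: "shaped Z'" "level Z' (2 * n) = mu" and i: "1 \<le> i" "i \<le> (k + 2) div 2"
    using t by (auto simp: compatible_def)
  have len: "length x' = (k + 1) div 2" "length y = (k + 1 + 1) div 2"
    using sh k shapedD[OF sh(1), of k] shapedD[OF sh(1), of "k + 1"] by (auto simp: x'_def y_def)
  have kl: "k \<le> length Z'" using sh k by (simp add: shaped_def)
  \<comment> \<open>The candidates may be spurious. An out-of-range column is inadmissible; and if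
    x'_j = 0, truncated subtraction makes \<open>Zr j\<close> equal to Z', from which a jump of
    column j does not lead to Z'.\<close>
  define F where "F = {(Rightward i, Zr i), (Rightward (i - 1), Zr (i - 1)), (Wait l, Z')}"
  have l: "letter_order l = k + 1" "l \<in> alphabet n"
  proof -
    have "odd (k + 1) \<Longrightarrow> 2 * ((k + 1 + 1) div 2) - 1 = k + 1 \<and> (k + 1 + 1) div 2 \<in> {1..n}"
      "even (k + 1) \<Longrightarrow> 2 * ((k + 1) div 2) = k + 1 \<and> (k + 1) div 2 \<in> {1..n}"
      using k unfolding atLeastAtMost_iff by presburger+
    then show "letter_order l = k + 1" "l \<in> alphabet n"
      unfolding l_def alphabet_def by (simp_all split: if_split)
  qed
  have "pmf (pending_dist (Suc k)) t = (\<Sum>s\<in>F. pmf (pending_dist k) s * pmf (step k s) t)"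
    unfolding pending_dist.simps
  proof (rule pmf_bind_finite)
    fix s assume s: "pmf (pending_dist k) s \<noteq> 0" "pmf (step k s) t \<noteq> 0"
    obtain A Z where AZ: "s = (A, Z)" by (cases s)
    have compatible: "compatible k (A, Z)" using compatible_pending_dist[of k s] s(1) k AZ by (auto simp: set_pmf_iff)
    have t_in: "t \<in> set_pmf (step k (A, Z))" using s(2) AZ by (simp add: set_pmf_iff)
    show "s \<in> F"
    proof (cases A)
      case (Wait l')
      with t_in have "letter_order l' = k + 1" "Z = Z'" by (auto simp: t_def split: if_splits)
      moreover have "l' = l"
        using letter_order_eq_iff[of l' "k + 1"] calculation compatible Wait by (auto simp: compatible_def l_def)
      ultimately show ?thesis by (simp add: F_def AZ Wait)
    next
      case (Rightward j)
      with t_in have j: "i = j \<or> i = j + 1" "Z' = move_right k j Z" by (auto simp: t_def split: if_splits)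
      have "1 \<le> j" "j \<le> length (level Z k)" "k \<le> length Z"
        using compatible k by (auto simp: compatible_def Rightward shapedD) (simp add: shaped_def)
      then have "Z = Zr j" using remove_box_move_right[OF k1 _ _ _ j(2)] by (simp add: Zr_def x'_def)
      then show ?thesis using j(1) by (auto simp: F_def AZ Rightward)
    next
      case (Leftward j)
      with t_in show ?thesis by (auto simp: t_def)
    qed
  qed (simp add: F_def)
  also have "\<dots> = C * (branch_weight k w x' * (branch_weight (k + 1) x' (add_box y i) * u_plus q i y))"
  proof -
    have sum: "(\<Sum>s\<in>F. f s) = f (Rightward i, Zr i) + f (Rightward (i - 1), Zr (i - 1)) + f (Wait l, Z')" for f :: "_ \<Rightarrow> real"
      using i by (simp add: F_def)
    have move: "0 < coord x' j \<Longrightarrow> move_right k j (Zr j) = Z'"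
        "0 < coord x' j \<Longrightarrow> add_box (remove_box x' j) j = x'"
        "coord x' j = 0 \<Longrightarrow> move_right k j (Zr j) \<noteq> Z'"
      if "1 \<le> j" "j \<le> length x'" for j
    proof -
      have lev: "move_right k j (Zr j) = Z'[k - 1 := add_box (remove_box x' j) j]"
        using k1 kl by (simp add: move_right_def Zr_def level_update)
      show 1: "0 < coord x' j \<Longrightarrow> add_box (remove_box x' j) j = x'"
        using that by (simp add: add_remove_box)
      show "0 < coord x' j \<Longrightarrow> move_right k j (Zr j) = Z'"
        using lev 1 k1 kl by (simp add: x'_def)
      show "move_right k j (Zr j) \<noteq> Z'" if "coord x' j = 0"
      proof
        assume "move_right k j (Zr j) = Z'"
        then have "level Z' k = add_box (remove_box x' j) j"
          using lev k1 kl level_update[of k Z' "add_box (remove_box x' j) j" k] by simp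
        then have "coord x' j > 0"
          using coord_add_box[of j "remove_box x' j" j] \<open>1 \<le> j\<close> \<open>j \<le> length x'\<close> by (simp add: x'_def)
        then show False using that by simp
      qed
    qed
    have levels: "level (Zr j) (k + 1) = y" "level (Zr j) k = remove_box x' j" for j
      using k1 kl by (simp_all add: Zr_def level_update y_def)
    have con: "pmf (pending_dist k) (A, Zr j) * pmf (step k (A, Zr j)) t
      = C * (pending_weight k A w (remove_box x' j) * branch_weight (k + 1) (remove_box x' j) y * step_prob k (A, Zr j) t)"
      if "admissible k A" for A j
      using contribution_update[OF sh k1 _ that, of "remove_box x' j" t] len by (simp add: Zr_def w_def y_def C_def)
    have T1: "pmf (pending_dist k) (Rightward i, Zr i) * pmf (step k (Rightward i, Zr i)) t
      = C * (branch_weight k w x' * (if i \<le> length x' \<and> 0 < coord x' i then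
          u_plus q i (remove_box x' i) * rprob q i y (remove_box x' i) * branch_weight (k + 1) (remove_box x' i) y else 0))"
    proof (cases "i \<le> length x'")
      case True
      have "step_prob k (Rightward i, Zr i) t = (if 0 < coord x' i then rprob q i y (remove_box x' i) else 0)"
        using move[OF i(1) True] levels(2)[of i] levels(1)[of i] by (auto simp: t_def)
      then show ?thesis
        using con[of "Rightward i" i] True i len move(2)[OF i(1) True] by (simp add: mult_ac)
    qed (use inadmissible[of "Rightward i" "Zr i"] len in simp)
    have T2: "pmf (pending_dist k) (Rightward (i - 1), Zr (i - 1)) * pmf (step k (Rightward (i - 1), Zr (i - 1))) t
      = C * (branch_weight k w x' * (if 2 \<le> i \<and> 0 < coord x' (i - 1) then u_plus q (i - 1) (remove_box x' (i - 1))
          * (1 - rprob q (i - 1) y (remove_box x' (i - 1))) * branch_weight (k + 1) (remove_box x' (i - 1)) y else 0))"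
    proof (cases "2 \<le> i")
      case True
      \<comment> \<open>Column i - 1 is never the suppressible one: for odd k levels k and k + 1
        have equal length, so i - 1 is not the last column.\<close>
      have j: "1 \<le> i - 1" "i - 1 \<le> length x'" "\<not> (odd k \<and> i - 1 = (k + 1) div 2)" "Suc (i - 1) = i"
        using i True len by presburger+
      have "step_prob k (Rightward (i - 1), Zr (i - 1)) t
          = (if 0 < coord x' (i - 1) then 1 - rprob q (i - 1) y (remove_box x' (i - 1)) else 0)"
        using move[OF j(1,2)] levels(2)[of "i - 1"] levels(1)[of "i - 1"] j(3,4) by (auto simp: t_def)
      then show ?thesis
        using con[of "Rightward (i - 1)" "i - 1"] True j len move(2)[OF j(1,2)] by (simp add: mult_ac)
    qed (use inadmissible[of "Rightward (i - 1)" "Zr (i - 1)"] in simp)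
    have T3: "pmf (pending_dist k) (Wait l, Z') * pmf (step k (Wait l, Z')) t
      = C * (branch_weight k w x' * (if i = 1 then wt (k + 1) * branch_weight (k + 1) x' y else 0))"
      using contribution_update[OF sh k1, of x' "Wait l" t] len l kl k1
      by (auto simp: x'_def y_def w_def C_def t_def)
    have K: "2 \<le> k + 1" "k + 1 \<le> 2 * n" using k1 k by auto
    have "i \<le> length y" using i len by simp
    from right_target[OF K len sorted[folded y_def] i(1) this] show ?thesis
      unfolding sum T1 T2 T3 by (simp add: distrib_left[symmetric])
  qed
  also have "\<dots> = state_weight (k + 1) (Rightward i, Z') / nconst"
    unfolding state_weight_next[OF k1] by (simp add: C_def w_def x'_def y_def)
  finally show ?thesis by (simp add: t_def)
qed

end

end

context berele_shape
begin

context
  fixes k :: nat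
  assumes k: "k < 2 * n"
    and IH: "\<And>s. compatible k s \<Longrightarrow> pmf (pending_dist k) s = state_weight k s / nconst"
begin

text \<open>The third source, a suppressed right jump, starts from Z' itself because nothing has
  moved on level k.\<close>

lemma pmf_dist_Suc_Leftward:
  assumes t: "compatible (k + 1) (Leftward i, Z')" and k1: "1 \<le> k"
    and sorted: "\<And>j. j \<ge> 1 \<Longrightarrow> coord (level Z' (k + 1)) (j + 1) \<le> coord (level Z' (k + 1)) j"
  shows "pmf (pending_dist (Suc k)) (Leftward i, Z') = state_weight (k + 1) (Leftward i, Z') / nconst"
proof -
  define x' y w where "x' = level Z' k" and "y = level Z' (k + 1)" and "w = level Z' (k - 1)"
  define C where "C = before k Z' * after (Suc k) Z' / nconst"
  define Za where "Za = (\<lambda>j. Z'[k - 1 := add_box x' j])"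
  define t where "t = (Leftward i, Z')"
  have sh: "shaped Z'" "level Z' (2 * n) = mu" and i: "1 \<le> i" "i \<le> (k + 2) div 2"
    using t by (auto simp: compatible_def)
  have len: "length x' = (k + 1) div 2" "length y = (k + 1 + 1) div 2" "length w = k div 2"
    using sh k k1 shapedD[OF sh(1), of k] shapedD[OF sh(1), of "k + 1"] shapedD[OF sh(1), of "k - 1"]
    by (auto simp: x'_def y_def w_def)
  have kl: "k \<le> length Z'" using sh k by (simp add: shaped_def)
  define F where "F = {(Leftward i, Za i), (Leftward (i - 1), Za (i - 1)), (Rightward i, Z')}"
  have "pmf (pending_dist (Suc k)) t = (\<Sum>s\<in>F. pmf (pending_dist k) s * pmf (step k s) t)"
    unfolding pending_dist.simps
  proof (rule pmf_bind_finite)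
    fix s assume s: "pmf (pending_dist k) s \<noteq> 0" "pmf (step k s) t \<noteq> 0"
    obtain A Z where AZ: "s = (A, Z)" by (cases s)
    have compatible: "compatible k (A, Z)"
      using compatible_pending_dist[of k s] s(1) k AZ by (auto simp: set_pmf_iff)
    have t_in: "t \<in> set_pmf (step k (A, Z))" using s(2) AZ by (simp add: set_pmf_iff)
    show "s \<in> F"
    proof (cases A)
      case (Wait l')
      with t_in show ?thesis by (auto simp: t_def split: if_splits)
    next
      case (Rightward j)
      with t_in show ?thesis by (auto simp: t_def F_def AZ split: if_splits)
    next
      case (Leftward j)
      with t_in have j: "i = j \<or> i = j + 1" "Z' = move_left k j Z" by (auto simp: t_def split: if_splits)
      have "1 \<le> j" "j \<le> length (level Z k)" "k \<le> length Z"
        using compatible k by (auto simp: compatible_def Leftward shapedD) (simp add: shaped_def)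
      \<comment> \<open>A pending left jump from 0 has weight 0, hence probability 0 by the
        induction hypothesis. So undoing the jump restores the old level.\<close>
      moreover have "0 < coord (level Z k) j"
        using IH[OF compatible] s(1) by (auto simp: AZ Leftward state_weight_def split: if_splits)
      ultimately have "Z = Za j" using add_box_move_left[OF k1 _ _ _ _ j(2)] by (simp add: Za_def x'_def)
      then show ?thesis using j(1) by (auto simp: F_def AZ Leftward)
    qed
  qed (simp add: F_def)
  also have "\<dots> = C * (branch_weight k w x' * pending_weight (k + 1) (Leftward i) x' y)"
  proof -
    have sum: "(\<Sum>s\<in>F. f s) = f (Leftward i, Za i) + f (Leftward (i - 1), Za (i - 1)) + f (Rightward i, Z')"
      for f :: "_ \<Rightarrow> real"
      using i by (simp add: F_def)
    have move: "move_left k j (Za j) = Z'" "remove_box (add_box x' j) j = x'" "coord (add_box x' j) j \<noteq> 0"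
      if "1 \<le> j" "j \<le> length x'" for j
    proof -
      have lev: "move_left k j (Za j) = Z'[k - 1 := remove_box (add_box x' j) j]"
        using k1 kl by (simp add: move_left_def Za_def level_update)
      show 1: "remove_box (add_box x' j) j = x'"
        using that by (simp add: remove_add_box)
      show "move_left k j (Za j) = Z'" using lev 1 k1 kl by (simp add: x'_def)
      show "coord (add_box x' j) j \<noteq> 0" using that by (simp add: coord_add_box)
    qed
    have levels: "level (Za j) (k + 1) = y" "level (Za j) k = add_box x' j" for j
      using k1 kl by (simp_all add: Za_def level_update y_def)
    have con: "pmf (pending_dist k) (A, Za j) * pmf (step k (A, Za j)) t
      = C * (pending_weight k A w (add_box x' j) * branch_weight (k + 1) (add_box x' j) y * step_prob k (A, Za j) t)"
      if "admissible k A" for A j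
      using contribution_update[OF k IH sh k1 _ that, of "add_box x' j" t] len
      by (simp add: Za_def w_def y_def C_def)
    define T1 where "T1 = (if i \<le> length x' then down q i (add_box x' i) * (1 - lprob q i y (add_box x' i))
      * branch_weight (k + 1) (add_box x' i) y else 0)"
    define T2 where "T2 = (if 2 \<le> i then down q (i - 1) (add_box x' (i - 1)) * lprob q (i - 1) y (add_box x' (i - 1))
      * branch_weight (k + 1) (add_box x' (i - 1)) y else 0)"
    define special where "special \<longleftrightarrow> odd k \<and> i = (k + 1) div 2"
    have 1: "pmf (pending_dist k) (Leftward i, Za i) * pmf (step k (Leftward i, Za i)) t
      = C * (branch_weight k w x' * (if special then theta q w x' i else 1) * T1)"
    proof (cases "i \<le> length x'")
      case True
      have "step_prob k (Leftward i, Za i) t = 1 - lprob q i y (add_box x' i)"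
        using move[OF i(1) True] levels(2)[of i] levels(1)[of i] by (simp add: t_def)
      moreover have "pending_weight k (Leftward i) w (add_box x' i)
          = branch_weight k w x' * down q i (add_box x' i) * (if special then theta q w x' i else 1)"
        unfolding pending_weight.simps special_def move(2)[OF i(1) True]
        using move(3)[OF i(1) True] by simp
      ultimately show ?thesis
        using con[of "Leftward i" i] True i len by (simp add: mult_ac T1_def)
    qed (use inadmissible[OF k IH, of "Leftward i" "Za i"] len in \<open>simp add: T1_def\<close>)
    have 2: "pmf (pending_dist k) (Leftward (i - 1), Za (i - 1)) * pmf (step k (Leftward (i - 1), Za (i - 1))) t
      = C * (branch_weight k w x' * T2)"
    proof (cases "2 \<le> i")
      case True
      have j: "1 \<le> i - 1" "i - 1 \<le> length x'" "\<not> (odd k \<and> i - 1 = (k + 1) div 2)" "Suc (i - 1) = i"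
        using i True len by presburger+
      have "step_prob k (Leftward (i - 1), Za (i - 1)) t = lprob q (i - 1) y (add_box x' (i - 1))"
        using move[OF j(1,2)] levels(2)[of "i - 1"] levels(1)[of "i - 1"] j(4) by (auto simp: t_def)
      moreover have "pending_weight k (Leftward (i - 1)) w (add_box x' (i - 1))
          = branch_weight k w x' * down q (i - 1) (add_box x' (i - 1))"
        unfolding pending_weight.simps move(2)[OF j(1,2)] if_not_P[OF j(3)]
        using move(3)[OF j(1,2)] by simp
      ultimately show ?thesis
        using con[of "Leftward (i - 1)" "i - 1"] True j(1,2) len by (simp add: mult_ac T2_def)
    qed (use inadmissible[OF k IH, of "Leftward (i - 1)" "Za (i - 1)"] in \<open>simp add: T2_def\<close>)
    have 3: "pmf (pending_dist k) (Rightward i, Z') * pmf (step k (Rightward i, Z')) t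
      = C * (if special then branch_weight k w (add_box x' i) * u_plus q i x' * (1 - rprob q i y x') * branch_weight (k + 1) x' y else 0)"
    proof (cases special)
      case True
      then have "admissible k (Rightward i)" using i by (simp add: special_def)
      moreover have "step_prob k (Rightward i, Z') t = 1 - rprob q i y x'"
        using True by (simp add: t_def special_def x'_def y_def)
      ultimately show ?thesis
        using contribution_update[OF k IH sh k1, of x' "Rightward i" t] len kl k1 True
        by (simp add: x'_def y_def w_def C_def)
    next
      case False
      then have "t \<notin> set_pmf (step k (Rightward i, Z'))"
        by (auto simp: t_def special_def split: if_splits)
      then have "pmf (step k (Rightward i, Z')) t = 0" unfolding set_pmf_iff by blast
      then show ?thesis using False by (simp del: step.simps)
    qed
    have K: "2 \<le> k + 1" "k + 1 \<le> 2 * n" using k1 k by auto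
    have "i \<le> length y" using i len by simp
    from left_target[OF K len(1,2) sorted[folded y_def] i(1) this]
    have T12: "T1 + T2 = pending_weight (k + 1) (Leftward i) x' y"
      by (simp add: T1_def T2_def)
    \<comment> \<open>In the special column the same-column source arrives with the factor
      \<open>theta\<close>, and suppression restores it to \<open>T1\<close>. Then
      \<open>left_target\<close> applies to \<open>T1 + T2\<close> in every column.\<close>
    have "branch_weight k w x' * (if special then theta q w x' i else 1) * T1
        + (if special then branch_weight k w (add_box x' i) * u_plus q i x' * (1 - rprob q i y x') * branch_weight (k + 1) x' y else 0)
      = branch_weight k w x' * T1"
    proof (cases special)
      case True
      then have s: "odd k" "i = (k + 1) div 2" by (simp_all add: special_def)
      then have "length y = i" using len by simp
      from suppressed_target[OF s(1) K(2) s(2) len(3) _ this, of x'] show ?thesis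
        using True s len by (simp add: T1_def)
    qed simp
    then have "C * (branch_weight k w x' * (if special then theta q w x' i else 1) * T1) + C * (branch_weight k w x' * T2)
        + C * (if special then branch_weight k w (add_box x' i) * u_plus q i x' * (1 - rprob q i y x') * branch_weight (k + 1) x' y else 0)
      = C * (branch_weight k w x' * (T1 + T2))"
    proof -
      assume eq: "branch_weight k w x' * (if special then theta q w x' i else 1) * T1
        + (if special then branch_weight k w (add_box x' i) * u_plus q i x' * (1 - rprob q i y x') * branch_weight (k + 1) x' y else 0)
        = branch_weight k w x' * T1"
      have "p + r = s \<Longrightarrow> C * p + C * b + C * r = C * (s + b)" for p r s b :: real
        by (auto simp: algebra_simps)
      from this[OF eq, of "branch_weight k w x' * T2"] show ?thesis by (simp only: distrib_left)
    qed
    then show ?thesis unfolding sum 1 2 3 T12 .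
  qed
  also have "\<dots> = state_weight (k + 1) (Leftward i, Z') / nconst"
    unfolding state_weight_next[OF k1] by (simp add: C_def w_def x'_def y_def)
  finally show ?thesis by (simp add: t_def)
qed

end

lemma pmf_dist_1:
  assumes n: "1 \<le> n" and s: "compatible 1 s"
    and IH: "\<And>s. compatible 0 s \<Longrightarrow> pmf (pending_dist 0) s = state_weight 0 s / nconst"
  shows "pmf (pending_dist 1) s = state_weight 1 s / nconst"
proof -
  obtain A Z where AZ: "s = (A, Z)" by (cases s)
  have sh: "shaped Z" "level Z (2 * n) = mu" using s by (auto simp: compatible_def AZ)
  have dist0: "\<exists>l\<in>alphabet n. s' = (Wait l, Z')"
    if "pmf (pending_dist 0) s' * pmf (step 0 s') (A', Z') \<noteq> 0" for s' A' Z'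
  proof -
    have "s' \<in> set_pmf (pending_dist 0)" "(A', Z') \<in> set_pmf (step 0 s')" using that by (auto simp: set_pmf_iff)
    then show ?thesis using set_dist_0[of s'] by auto
  qed
  have dist1: "pending_dist 1 = bind_pmf (pending_dist 0) (step 0)" by (simp add: pending_dist.simps(2))
  show ?thesis
  proof (cases A)
    case (Wait l)
    show ?thesis using pmf_dist_Suc_Wait[of 0 l Z] n IH s by (simp add: AZ Wait)
  next
    case (Rightward i)
    then have i: "i = 1" using s by (simp add: compatible_def AZ)
    have "pmf (pending_dist 1) s = (\<Sum>s'\<in>{(Wait (Plain 1), Z)}. pmf (pending_dist 0) s' * pmf (step 0 s') s)"
      unfolding dist1
    proof (rule pmf_bind_finite)
      fix s' assume s': "pmf (pending_dist 0) s' \<noteq> 0" "pmf (step 0 s') s \<noteq> 0"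
      then obtain l where l: "l \<in> alphabet n" "s' = (Wait l, Z)" using dist0[of s' A Z] by (auto simp: AZ)
      then have "letter_order l = 1"
        using s'(2) by (auto simp: AZ Rightward pmf_return split: if_splits)
      then show "s' \<in> {(Wait (Plain 1), Z)}"
        using letter_order_eq_iff[of l 1] l by simp
    qed simp
    also have "\<dots> = state_weight 0 (Wait (Plain 1), Z) / nconst"
      using IH[of "(Wait (Plain 1), Z)"] sh n by (simp add: compatible_def alphabet_def AZ Rightward i pmf_return)
    also have "state_weight 0 (Wait (Plain 1), Z) = state_weight 1 s"
      using branch_weight_1[of "level Z 1"] n shapedD[OF sh(1), of 1]
      by (simp add: state_weight_def AZ Rightward i before_def after_Suc branch_weight_0 u_plus_def)
    finally show ?thesis .
  next
    case (Leftward i)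
    then have i: "i = 1" using s by (simp add: compatible_def AZ)
    have "pmf (pending_dist 1) s = (\<Sum>s'\<in>{}. pmf (pending_dist 0) s' * pmf (step 0 s') s)"
      unfolding dist1
    proof (rule pmf_bind_finite)
      fix s' assume s': "pmf (pending_dist 0) s' \<noteq> 0" "pmf (step 0 s') s \<noteq> 0"
      then obtain l where l: "s' = (Wait l, Z)" using dist0[of s' A Z] by (auto simp: AZ)
      then show "s' \<in> {}"
        using s'(2) by (auto simp: AZ Leftward pmf_return split: if_splits)
    qed simp
    \<comment> \<open>No left jump can be pending on level 1. The candidate agrees because
      \<open>theta\<close> is 0 for i = 1.\<close>
    then show ?thesis by (simp add: AZ Leftward i state_weight_def theta_def)
  qed
qed

theorem pmf_pending_dist:
  "k \<le> 2 * n \<Longrightarrow> compatible k s \<Longrightarrow> pmf (pending_dist k) s = state_weight k s / nconst"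
proof (induction k arbitrary: s)
  case 0
  obtain A Z where AZ: "s = (A, Z)" by (cases s)
  then obtain l where l: "A = Wait l" using 0 by (cases A) (auto simp: compatible_def)
  have sh: "shaped Z" "level Z (2 * n) = mu" "l \<in> alphabet n" using 0 by (auto simp: compatible_def AZ l)
  have w: "weight Z = after 0 Z" unfolding weight_def after_def by (intro prod.cong) auto
  have "pmf PZ Z = weight Z / P"
    using sh PZ[of Z] patterns_iff_weight[of Z] by (auto simp: patterns_of_shape_def)
  then show ?case
    using PL[of l] sh by (simp add: AZ l pmf_dist_0 state_weight_def nconst_def w before_def branch_weight_0)
next
  case (Suc k)
  then have k: "k < 2 * n" and IH: "\<And>s. compatible k s \<Longrightarrow> pmf (pending_dist k) s = state_weight k s / nconst" by auto
  obtain A Z where AZ: "s = (A, Z)" by (cases s)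
  have s: "compatible (k + 1) (A, Z)" using Suc by (simp add: AZ)
  consider "k = 0" | "k \<ge> 1" "\<forall>j\<in>{k + 1..2 * n}. level Z j \<in> tuples ((j + 1) div 2)"
    | j where "j \<in> {k + 1..2 * n}" "level Z j \<notin> tuples ((j + 1) div 2)"
    by fastforce
  then show ?case
  proof cases
    case 1
    then show ?thesis using pmf_dist_1[of s] IH k Suc.prems by simp
  next
    case 2
    then have "level Z (k + 1) \<in> tuples ((k + 1 + 1) div 2)"
      using k by (intro bspec[OF 2(2)]) auto
    then have sorted: "\<And>j. j \<ge> 1 \<Longrightarrow> coord (level Z (k + 1)) (j + 1) \<le> coord (level Z (k + 1)) j"
      by (simp add: tuples_iff)
    show ?thesis
      using pmf_dist_Suc_Wait[OF k IH] pmf_dist_Suc_Rightward[OF k IH _ 2(1) sorted]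
        pmf_dist_Suc_Leftward[OF k IH _ 2(1) sorted] s
      by (cases A) (simp_all add: AZ)
  next
    case 3
    then show ?thesis using pmf_dist_Suc_unsorted[OF k IH, of s j] s by (simp add: AZ)
  qed
qed

end

section \<open>The intertwining relation\<close>

lemma finite_pmf_exists:
  assumes "finite F" "\<And>x. x \<in> F \<Longrightarrow> 0 \<le> g x" "sum g F = (1::real)"
  obtains p where "\<And>x. pmf p x = (if x \<in> F then g x else 0)"
proof
  fix x
  have "(\<integral>\<^sup>+ x. ennreal (if x \<in> F then g x else 0) \<partial>count_space UNIV) = (\<Sum>x\<in>F. ennreal (if x \<in> F then g x else 0))"
    using assms(1) by (intro nn_integral_count_space') auto
  also have "\<dots> = ennreal (\<Sum>x\<in>F. g x)"
    using assms(2) by (subst sum_ennreal) auto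
  finally show "pmf (embed_pmf (\<lambda>x. if x \<in> F then g x else 0)) x = (if x \<in> F then g x else 0)"
    using assms by (intro pmf_embed_pmf) auto
qed

lemma prod_double: "(\<Prod>j=1..2 * m. g j) = (\<Prod>i=1..m. g (2 * i - 1) * g (2 * i :: nat) :: 'a :: comm_monoid_mult)"
  by (induction m) (auto simp: mult_ac)

context berele_shape
begin

lemma run_top:
  assumes "compatible (2 * n) (A, Z)"
  obtains i where "i \<in> {1..n}" "A = Rightward i" "run (2 * n) (A, Z) = return_pmf (move_right (2 * n) i Z)"
  | i where "i \<in> {1..n}" "A = Leftward i" "run (2 * n) (A, Z) = return_pmf (move_left (2 * n) i Z)"
proof (cases A)
  case (Wait l)
  then have "l \<in> alphabet n" "2 * n < letter_order l" using assms by (auto simp: compatible_def)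
  then show ?thesis by (auto simp: alphabet_def)
qed (use assms that in \<open>auto simp: compatible_def right_attempt.simps[of n q "2 * n"] left_jump.simps[of n q "2 * n"]\<close>)

text \<open>All states leading to Z' carry the same pattern \<open>Zm\<close>, which is Z' with its
  top level put back to \<open>mu\<close>. Level 2n is even, so no \<open>theta\<close> is left and
  the pending rates are exactly those of \<open>Lweight\<close>.\<close>

lemma pmf_final:
  assumes n: "1 \<le> n" and Z': "shaped Z'"
  shows "pmf (bind_pmf (pending_dist (2 * n)) (run (2 * n))) Z'
    = weight Z' * Lweight n q mu (level Z' (2 * n)) / nconst"
proof -
  define lam' where "lam' = level Z' (2 * n)"
  define Zm where "Zm = Z'[2 * n - 1 := mu]"
  define F where "F = (\<lambda>i. (Rightward i, Zm)) ` {1..n} \<union> (\<lambda>i. (Leftward i, Zm)) ` {1..n}"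
  have N: "1 \<le> 2 * n" "2 * n \<le> length Z'" using n Z' by (auto simp: shaped_def)
  have len: "length lam' = n" "length mu = n"
    using shapedD[OF Z', of "2 * n"] mu by (auto simp: lam'_def tuples_def)
  have Zm: "shaped Zm" "level Zm (2 * n) = mu"
    using shaped_update[OF Z' N(1), of mu] level_update[OF N, of mu "2 * n"] len by (auto simp: Zm_def)
  have eqI: "Z'[2 * n - 1 := x] = Z' \<longleftrightarrow> x = lam'" for x
    using level_update[OF N, of x "2 * n"] N by (auto simp: lam'_def)
  have move: "move_right (2 * n) i Zm = Z' \<longleftrightarrow> add_box mu i = lam'"
    "move_left (2 * n) i Zm = Z' \<longleftrightarrow> remove_box mu i = lam'" for i
    using Zm(2) eqI by (simp_all add: move_right_def move_left_def Zm_def)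
  have "pmf (bind_pmf (pending_dist (2 * n)) (run (2 * n))) Z'
      = (\<Sum>s\<in>F. pmf (pending_dist (2 * n)) s * pmf (run (2 * n) s) Z')"
  proof (rule pmf_bind_finite)
    fix s assume s: "pmf (pending_dist (2 * n)) s \<noteq> 0" "pmf (run (2 * n) s) Z' \<noteq> 0"
    obtain A Z where AZ: "s = (A, Z)" by (cases s)
    have compatible: "compatible (2 * n) (A, Z)"
      using compatible_pending_dist[of "2 * n" s] s(1) AZ by (auto simp: set_pmf_iff)
    then have Z: "shaped Z" "level Z (2 * n) = mu" by (auto simp: compatible_def)
    then have NZ: "2 * n \<le> length Z" by (simp add: shaped_def)
    have "Z[2 * n - 1 := mu] = Z" using update_level[OF N(1) NZ] Z(2) by simp
    then have Zm_eq: "Z = Zm" if "Z' = Z[2 * n - 1 := x]" for x using that by (simp add: Zm_def)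
    from compatible show "s \<in> F"
    proof (cases rule: run_top)
      case (1 i)
      then have "Z' = Z[2 * n - 1 := add_box mu i]"
        using s(2) Z(2) by (auto simp: AZ pmf_return move_right_def indicator_def split: if_splits)
      then have "Z = Zm" by (rule Zm_eq)
      then show ?thesis using 1 by (simp add: F_def AZ)
    next
      case (2 i)
      then have "Z' = Z[2 * n - 1 := remove_box mu i]"
        using s(2) Z(2) by (auto simp: AZ pmf_return move_left_def indicator_def split: if_splits)
      then have "Z = Zm" by (rule Zm_eq)
      then show ?thesis using 2 by (simp add: F_def AZ)
    qed
  qed (simp add: F_def)
  also have "\<dots> = (\<Sum>i=1..n. pmf (pending_dist (2 * n)) (Rightward i, Zm) * pmf (run (2 * n) (Rightward i, Zm)) Z')
      + (\<Sum>i=1..n. pmf (pending_dist (2 * n)) (Leftward i, Zm) * pmf (run (2 * n) (Leftward i, Zm)) Z')"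
    unfolding F_def by (subst sum.union_disjoint) (auto simp: sum.reindex inj_on_def)
  also have "\<dots> = (\<Sum>i=1..n. weight Z' / nconst * (if lam' = add_box mu i then u_plus q i mu else 0))
      + (\<Sum>i=1..n. weight Z' / nconst * (if mu = add_box lam' i then u_minus n q i mu else 0))"
  proof (intro arg_cong2[of _ _ _ _ "(+)"] sum.cong refl)
    fix i assume i: "i \<in> {1..n}"
    have wt: "weight Z' = before (2 * n) Zm * branch_weight (2 * n) (level Zm (2 * n - 1)) lam'"
    proof -
      have "{1..2 * n} = insert (2 * n) {1..<2 * n}" using N(1) by auto
      then have "weight Z' = before (2 * n) Z' * branch_weight (2 * n) (level Z' (2 * n - 1)) lam'"
        unfolding weight_def before_def by (simp add: lam'_def)
      then show ?thesis
        using before_update[OF N, of mu] level_update[OF N, of mu "2 * n - 1"] N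
        by (cases "2 * n - Suc 0 = 2 * n") (simp_all add: Zm_def)
    qed
    have after: "after (2 * n) Zm = 1" by (simp add: after_def)
    have pending_dist: "pmf (pending_dist (2 * n)) (A, Zm) = before (2 * n) Zm
        * pending_weight (2 * n) A (level Zm (2 * n - 1)) mu / nconst" if "admissible (2 * n) A" for A
      using pmf_pending_dist[of "2 * n" "(A, Zm)"] that Zm by (simp add: compatible_def state_weight_def after)
    show "pmf (pending_dist (2 * n)) (Rightward i, Zm) * pmf (run (2 * n) (Rightward i, Zm)) Z'
        = weight Z' / nconst * (if lam' = add_box mu i then u_plus q i mu else 0)"
      using i pending_dist[of "Rightward i"] move(1)[of i] wt
      by (auto simp: right_attempt.simps[of n q "2 * n"] pmf_return)
    show "pmf (pending_dist (2 * n)) (Leftward i, Zm) * pmf (run (2 * n) (Leftward i, Zm)) Z'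
        = weight Z' / nconst * (if mu = add_box lam' i then u_minus n q i mu else 0)"
    proof (cases "coord mu i = 0")
      case True
      then have "mu \<noteq> add_box lam' i" using coord_add_box[of i lam' i] i len by auto
      then show ?thesis using True i pending_dist[of "Leftward i"] by simp
    next
      case False
      then have "mu = add_box lam' i \<longleftrightarrow> remove_box mu i = lam'"
        using add_remove_box[of i mu] remove_add_box[of i lam'] i len by auto
      moreover have "down q i mu = u_minus n q i mu"
        using i len by (auto simp: down_def u_minus_def coord_beyond)
      ultimately show ?thesis
        using i pending_dist[of "Leftward i"] move(2)[of i] wt False
        by (auto simp: left_jump.simps[of n q "2 * n"] pmf_return)
    qed
  qed
  also have "\<dots> = weight Z' * Lweight n q mu lam' / nconst"
    unfolding Lweight_def sum.distrib sum_distrib_left[symmetric]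
    by (simp add: distrib_left add_divide_distrib)
  finally show ?thesis by (simp add: lam'_def)
qed

lemma pmf_final_unshaped:
  assumes n: "1 \<le> n" and Z': "\<not> shaped Z'"
  shows "pmf (bind_pmf (pending_dist (2 * n)) (run (2 * n))) Z' = 0"
proof -
  have "pmf (bind_pmf (pending_dist (2 * n)) (run (2 * n))) Z'
      = (\<Sum>s\<in>{}. pmf (pending_dist (2 * n)) s * pmf (run (2 * n) s) Z')"
  proof (rule pmf_bind_finite)
    fix s assume s: "pmf (pending_dist (2 * n)) s \<noteq> 0" "pmf (run (2 * n) s) Z' \<noteq> 0"
    obtain A Z where AZ: "s = (A, Z)" by (cases s)
    have compatible: "compatible (2 * n) (A, Z)"
      using compatible_pending_dist[of "2 * n" s] s(1) AZ by (auto simp: set_pmf_iff)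
    then have Z: "shaped Z" "length (level Z (2 * n)) = n" using mu by (auto simp: compatible_def tuples_def)
    have "shaped (move_right (2 * n) i Z)" "shaped (move_left (2 * n) i Z)" for i
      using shaped_update[OF Z(1), of "2 * n"] n Z(2) by (auto simp: move_right_def move_left_def)
    with compatible show "s \<in> {}"
      by (cases rule: run_top) (use Z' s(2) in \<open>auto simp: AZ pmf_return indicator_def split: if_splits\<close>)
  qed simp
  then show ?thesis by simp
qed

end

section \<open>Weights of patterns, normalization and intertwining\<close>

context berele
begin

lemma letter_prob_eq: "l \<in> alphabet n \<Longrightarrow> letter_prob n a l = wt (letter_order l) / normalizer n a"
proof -
  have "(2 * j - 1 + 1) div 2 = j" "(2 * j + 1) div 2 = j" if "1 \<le> j" for j :: nat using that by auto
  moreover assume "l \<in> alphabet n"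
  ultimately show ?thesis unfolding alphabet_def wt_def by fastforce
qed

lemma sum_alphabet: "(\<Sum>l\<in>alphabet n. g l) = (\<Sum>i=1..n. g (Plain i) + g (Barred i) :: real)"
  unfolding alphabet_def
  by (subst sum.union_disjoint) (auto simp: sum.reindex inj_on_def sum.distrib)

lemma finite_alphabet [simp]: "finite (alphabet n)"
  by (simp add: alphabet_def)

lemma normalizer_pos: "1 \<le> n \<Longrightarrow> 0 < normalizer n a"
  unfolding normalizer_def using a by (intro sum_pos add_pos_pos) auto

lemma letter_prob_pos: "1 \<le> n \<Longrightarrow> l \<in> alphabet n \<Longrightarrow> 0 < letter_prob n a l"
  using normalizer_pos a by (auto simp: alphabet_def)

lemma sum_letter_prob: "1 \<le> n \<Longrightarrow> (\<Sum>l\<in>alphabet n. letter_prob n a l) = 1"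
  unfolding sum_alphabet using normalizer_pos
  by (simp add: sum_divide_distrib[symmetric] add_divide_distrib[symmetric] normalizer_def)

lemma pattern_interlaces:
  assumes "Z \<in> patterns n" "1 \<le> k" "k \<le> 2 * n"
  shows "interlaces (level Z (k - 1)) (level Z k)"
proof -
  have "shaped Z" "branch_weight k (level Z (k - 1)) (level Z k) \<noteq> 0"
    using assms unfolding patterns_iff_weight weight_def by auto
  then show ?thesis
    using branch_weight_nonzero_iff[of k "level Z (k - 1)" "level Z k"] assms by (auto simp: shapedD)
qed

text \<open>On a pattern the natural-number subtractions in \<open>kappa\<close> are exact. The last
  binomial of level 2k matches because entry k + 1 of that level is 0.\<close>

lemma weight_eq:
  assumes Z: "Z \<in> patterns n"
  shows "weight Z = pattern_monomial n a Z * kappa n q Z"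
proof -
  have sh: "shaped Z" using Z by (simp add: patterns_iff_weight)
  have qb: "qbin q (int (entry Z k i) - int (entry Z k (i + 1))) (int (entry Z k i) - int (entry Z (k - 1) i))
      = qbinom q (entry Z k i - entry Z k (i + 1)) (entry Z k i - entry Z (k - 1) i)"
    if "1 \<le> k" "k \<le> 2 * n" "1 \<le> i" for k i
  proof -
    have "coord (level Z (k - 1)) i \<le> coord (level Z k) i" "coord (level Z k) (i + 1) \<le> coord (level Z (k - 1)) i"
      using interlacesD(1,2)[OF pattern_interlaces[OF Z that(1,2)] that(3)] by auto
    then show ?thesis by (auto simp: qbin_def entry_def nat_diff_distrib')
  qed
  have branch_weight: "branch_weight k (level Z (k - 1)) (level Z k)
      = wt k powi (int (sum_list (level Z k)) - int (sum_list (level Z (k - 1))))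
        * (\<Prod>i=1..k div 2. qbinom q (entry Z k i - entry Z k (i + 1)) (entry Z k i - entry Z (k - 1) i))"
    if "1 \<le> k" "k \<le> 2 * n" for k
    unfolding branch_weight_def branch_prod_def
    using qb[OF that] by (intro arg_cong2[of _ _ _ _ "(*)"] prod.cong refl) (auto simp: entry_def)
  have "weight Z = (\<Prod>k=1..n. branch_weight (2 * k - 1) (level Z (2 * k - 1 - 1)) (level Z (2 * k - 1))
      * branch_weight (2 * k) (level Z (2 * k - 1)) (level Z (2 * k)))"
    unfolding weight_def by (rule prod_double)
  also have "\<dots> = (\<Prod>k=1..n. a k powi
     (2 * int (sum_list (level Z (2 * k - 1))) - int (sum_list (level Z (2 * k)))
        - int (sum_list (level Z (2 * k - 2))))
    * ((\<Prod>i=1..k - 1.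
        qbinom q (entry Z (2 * k - 1) i - entry Z (2 * k - 1) (i + 1))
                 (entry Z (2 * k - 1) i - entry Z (2 * k - 2) i)
      * qbinom q (entry Z (2 * k) i - entry Z (2 * k) (i + 1))
                 (entry Z (2 * k) i - entry Z (2 * k - 1) i))
     * qbinom q (entry Z (2 * k) k) (entry Z (2 * k) k - entry Z (2 * k - 1) k)))"
  proof (intro prod.cong refl)
    fix k assume k: "k \<in> {1..n}"
    have ak: "a k > 0" using a k by auto
    have wts: "wt (2 * k - 1) = a k" "wt (2 * k) = inverse (a k)"
      using k by (auto simp: wt_def)
    have d: "2 * k - 1 - 1 = 2 * k - 2" "(2 * k - 1) div 2 = k - 1" "2 * k div 2 = k"
      using k by auto
    have k_eq: "{1..k} = insert k {1..k - 1}" using k by auto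
    have last: "entry Z (2 * k) (k + 1) = 0"
      using shapedD[OF sh, of "2 * k"] k by (simp add: entry_def coord_beyond)
    have pw: "a k powi (x - y) * inverse (a k) powi (z - x) = a k powi (2 * x - z - y)" for x y z
    proof -
      have "inverse (a k) powi (z - x) = a k powi (- (z - x))"
        using ak by (simp only: power_int_minus power_int_inverse)
      then have "a k powi (x - y) * inverse (a k) powi (z - x) = a k powi (x - y + - (z - x))"
        using ak power_int_add[of "a k" "x - y" "- (z - x)"] by simp
      also have "x - y + - (z - x) = 2 * x - z - y" by simp
      finally show ?thesis .
    qed
    have K: "1 \<le> 2 * k - 1" "2 * k - 1 \<le> 2 * n" "1 \<le> 2 * k" "2 * k \<le> 2 * n" using k by auto
    have prod_k: "(\<Prod>i=1..k. g i) = (\<Prod>i=1..k - 1. g i) * g k" for g :: "nat \<Rightarrow> real"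
      unfolding k_eq using k by (subst prod.insert) auto
    show "branch_weight (2 * k - 1) (level Z (2 * k - 1 - 1)) (level Z (2 * k - 1))
      * branch_weight (2 * k) (level Z (2 * k - 1)) (level Z (2 * k))
      = a k powi (2 * int (sum_list (level Z (2 * k - 1))) - int (sum_list (level Z (2 * k)))
        - int (sum_list (level Z (2 * k - 2))))
    * ((\<Prod>i=1..k - 1.
        qbinom q (entry Z (2 * k - 1) i - entry Z (2 * k - 1) (i + 1))
                 (entry Z (2 * k - 1) i - entry Z (2 * k - 2) i)
      * qbinom q (entry Z (2 * k) i - entry Z (2 * k) (i + 1))
                 (entry Z (2 * k) i - entry Z (2 * k - 1) i))
     * qbinom q (entry Z (2 * k) k) (entry Z (2 * k) k - entry Z (2 * k - 1) k))"
      unfolding d branch_weight[OF K(1,2), unfolded d] branch_weight[OF K(3,4), unfolded d] wts prod_k prod.distrib last pw[symmetric]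
      by (simp add: mult_ac)
  qed
  also have "\<dots> = pattern_monomial n a Z * kappa n q Z"
    unfolding pattern_monomial_def kappa_def by (rule prod.distrib)
  finally show ?thesis .
qed

lemma weight_pos: "Z \<in> patterns n \<Longrightarrow> 0 < weight Z"
  using weight_nonneg[of Z] by (auto simp: patterns_iff_weight less_le)

text \<open>Every column increases weakly with the level, so all entries are bounded by those of
  \<open>mu\<close>.\<close>

lemma finite_patterns_of_shape: "finite (patterns_of_shape n mu)"
proof -
  define B where "B = {x. set x \<subseteq> {..sum_list mu} \<and> length x \<le> n}"
  have "patterns_of_shape n mu \<subseteq> {Z. set Z \<subseteq> B \<and> length Z \<le> 2 * n}"
  proof
    fix Z assume "Z \<in> patterns_of_shape n mu"
    then have Z: "Z \<in> patterns n" and top: "level Z (2 * n) = mu" by (auto simp: patterns_of_shape_def)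
    have sh: "shaped Z" using Z by (simp add: patterns_iff_weight)
    have le: "coord (level Z k) i \<le> coord mu i" if "k \<le> 2 * n" "1 \<le> i" for k i
      using that(1)
    proof (induction k rule: inc_induct)
      case (step k)
      then show ?case
        using interlacesD(1)[OF pattern_interlaces[OF Z, of "Suc k"] that(2)] by auto
    qed (simp add: top)
    have mu: "coord mu i \<le> sum_list mu" for i
      by (auto simp: coord_def intro: member_le_sum_list)
    have "x \<in> B" if "x \<in> set Z" for x
    proof -
      from that obtain j where j: "j < length Z" "x = Z ! j" by (auto simp: in_set_conv_nth)
      then have x: "x = level Z (j + 1)" "j + 1 \<le> 2 * n" using sh by (auto simp: level_def shaped_def)
      then have "length x \<le> n" using shapedD[OF sh x(2)] by simp
      moreover have "v \<le> sum_list mu" if "v \<in> set x" for v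
      proof -
        from that obtain i where "i < length x" "v = x ! i" by (auto simp: in_set_conv_nth)
        then have "v = coord x (i + 1)" by (simp add: coord_def)
        then show ?thesis using le[OF x(2), of "i + 1"] mu[of "i + 1"] x by auto
      qed
      ultimately show ?thesis by (auto simp: B_def)
    qed
    then show "Z \<in> {Z. set Z \<subseteq> B \<and> length Z \<le> 2 * n}" using sh by (auto simp: shaped_def)
  qed
  moreover have "finite B" unfolding B_def by (rule finite_lists_length_le) simp
  ultimately show ?thesis using finite_lists_length_le finite_subset by blast
qed

lemma patterns_of_shape_nonempty:
  assumes mu: "mu \<in> tuples n"
  shows "patterns_of_shape n mu \<noteq> {}"
proof -
  \<comment> \<open>The truncations of \<open>mu\<close> form a pattern; their interlacing is the
    sortedness of \<open>mu\<close>.\<close>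
  define Z where "Z = map (\<lambda>k. take ((k + 1) div 2) mu) [1..<2 * n + 1]"
  have lev: "level Z k = take ((k + 1) div 2) mu" if "k \<le> 2 * n" for k
    using that by (auto simp: level_def Z_def simp del: upt_Suc)
  have len: "length mu = n" using mu by (simp add: tuples_def)
  have sh: "shaped Z" using lev len unfolding shaped_def by (auto simp: Z_def simp del: upt_Suc)
  have ct: "coord (take m mu) i = (if i \<le> m then coord mu i else 0)" for m i
    by (auto simp: coord_def)
  have dec: "coord mu (i + 1) \<le> coord mu i" if "i \<ge> 1" for i using mu that by (auto simp: tuples_iff)
  have "interlaces (level Z (k - 1)) (level Z k)" if k: "k \<in> {1..2 * n}" for k
    unfolding interlaces_def
  proof (intro allI impI)
    fix i :: nat assume i: "1 \<le> i"
    have "k - 1 + 1 = k" using k by auto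
    then show "coord (level Z (k - 1)) i \<le> coord (level Z k) i \<and> coord (level Z k) (i + 1) \<le> coord (level Z (k - 1)) i"
      using k i dec[OF i] by (auto simp: lev ct)
  qed
  then have "branch_weight k (level Z (k - 1)) (level Z k) \<noteq> 0" if "k \<in> {1..2 * n}" for k
    using that branch_weight_nonzero_iff[of k "level Z (k - 1)" "level Z k"] shapedD[OF sh] by auto
  then have "weight Z \<noteq> 0" by (simp add: weight_def)
  then have "Z \<in> patterns_of_shape n mu"
    using sh lev[of "2 * n"] len by (auto simp: patterns_of_shape_def patterns_iff_weight)
  then show ?thesis by blast
qed

lemma qP_eq: "qP n q a mu = (\<Sum>Z\<in>patterns_of_shape n mu. weight Z)"
  unfolding qP_def by (intro sum.cong) (auto simp: weight_eq patterns_of_shape_def)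

lemma qP_pos: "mu \<in> tuples n \<Longrightarrow> 0 < qP n q a mu"
  unfolding qP_eq using finite_patterns_of_shape patterns_of_shape_nonempty
  by (intro sum_pos) (auto simp: patterns_of_shape_def weight_pos)

theorem intertwining:
  assumes n: "1 \<le> n" and mu: "mu \<in> tuples n"
  shows "(\<Sum>Z\<in>patterns_of_shape n mu. weight Z * pattern_kernel n q a Z Z')
    = (if Z' \<in> patterns n then weight Z' * Lweight n q mu (level Z' (2 * n)) / normalizer n a else 0)"
proof -
  note P = qP_pos[OF mu] and c = normalizer_pos[OF n]
  obtain PZ where pmf_PZ: "\<And>Z. pmf PZ Z = (if Z \<in> patterns_of_shape n mu then weight Z / qP n q a mu else 0)"
    using P by (rule_tac finite_pmf_exists[OF finite_patterns_of_shape[of mu], of "\<lambda>Z. weight Z / qP n q a mu"])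
      (auto simp: weight_nonneg sum_divide_distrib[symmetric] qP_eq)
  obtain PL where pmf_PL: "\<And>l. pmf PL l = (if l \<in> alphabet n then letter_prob n a l else 0)"
    using letter_prob_pos[OF n] sum_letter_prob[OF n]
    by (rule_tac finite_pmf_exists[OF finite_alphabet, of "letter_prob n a"]) (auto simp: less_imp_le)
  interpret berele_shape n q a mu "qP n q a mu" PZ PL
    by unfold_locales (auto simp: mu pmf_PZ pmf_PL letter_prob_eq)
  have "(\<Sum>Z\<in>patterns_of_shape n mu. weight Z * pattern_kernel n q a Z Z') / qP n q a mu
      = (\<Sum>Z\<in>patterns_of_shape n mu. \<Sum>l\<in>alphabet n. pmf PL l * pmf PZ Z * pmf (insertion n q l Z) Z')"
    by (simp add: sum_divide_distrib pmf_PZ pmf_PL pattern_kernel_def insertion_kernel_def sum_distrib_left mult_ac)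
  also have "\<dots> = (\<Sum>(l, Z)\<in>alphabet n \<times> patterns_of_shape n mu. pmf PL l * pmf PZ Z * pmf (insertion n q l Z) Z')"
    by (subst sum.swap) (simp add: sum.cartesian_product)
  also have "\<dots> = (\<Sum>s\<in>alphabet n \<times> patterns_of_shape n mu.
      pmf (pair_pmf PL PZ) s * pmf (case s of (l, Z) \<Rightarrow> insertion n q l Z) Z')"
    by (intro sum.cong) (auto simp: pmf_pair)
  also have "\<dots> = pmf (bind_pmf (pair_pmf PL PZ) (\<lambda>(l, Z). insertion n q l Z)) Z'"
    by (rule pmf_bind_finite[symmetric])
      (auto simp: pmf_pair pmf_PL pmf_PZ finite_patterns_of_shape split: if_splits)
  \<comment> \<open>On level 0 every letter is still waiting, so a single walk describes the
    insertion of a random letter.\<close>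
  also have "bind_pmf (pair_pmf PL PZ) (\<lambda>(l, Z). insertion n q l Z) = bind_pmf (pending_dist 0) (run 0)"
    by (simp add: pending_dist.simps(1) bind_map_pmf insertion_def case_prod_unfold)
  also have "\<dots> = bind_pmf (pending_dist (2 * n)) (run (2 * n))"
    by (rule pending_dist_run) simp
  also have "pmf \<dots> Z' = (if Z' \<in> patterns n then weight Z' * Lweight n q mu (level Z' (2 * n)) / nconst else 0)"
    using pmf_final[OF n, of Z'] pmf_final_unshaped[OF n, of Z']
    by (cases "shaped Z'") (auto simp: patterns_iff_weight)
  finally show ?thesis
    using P by (simp add: nconst_def field_simps split: if_splits)
qed

end

section \<open>Stochasticity of the two kernels\<close>

context berele
begin

lemma pattern_kernel_nonneg: "1 \<le> n \<Longrightarrow> 0 \<le> pattern_kernel n q a Z Z'"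
  unfolding pattern_kernel_def insertion_kernel_def
  by (intro sum_nonneg mult_nonneg_nonneg less_imp_le[OF letter_prob_pos]) auto

lemma top_level_tuples: "1 \<le> n \<Longrightarrow> Z \<in> patterns n \<Longrightarrow> level Z (2 * n) \<in> tuples n"
  unfolding patterns_def by auto

text \<open>The intertwining sum has nonnegative terms, so a vanishing right-hand side annihilates
  each of them, and \<open>weight Z\<close> is positive.\<close>

lemma pattern_kernel_eq_0:
  assumes n: "1 \<le> n" and Z: "Z \<in> patterns n"
    and Z': "Z' \<notin> patterns n \<or> Lweight n q (level Z (2 * n)) (level Z' (2 * n)) = 0"
  shows "pattern_kernel n q a Z Z' = 0"
proof -
  define mu where "mu = level Z (2 * n)"
  have "(\<Sum>Z\<in>patterns_of_shape n mu. weight Z * pattern_kernel n q a Z Z') = 0"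
    using intertwining[OF n top_level_tuples[OF n Z], of Z'] Z' by (auto simp: mu_def)
  then have "weight Z * pattern_kernel n q a Z Z' = 0"
    using Z weight_nonneg pattern_kernel_nonneg[OF n]
    by (subst (asm) sum_nonneg_eq_0_iff[OF finite_patterns_of_shape])
      (auto simp: mu_def patterns_of_shape_def)
  then show ?thesis using weight_pos[OF Z] by simp
qed

text \<open>A finite superset of the shapes reachable in one insertion, which reduces the infinite
  sums over states to finite ones.\<close>

definition successors :: "nat list \<Rightarrow> nat list set" where
  "successors mu = {nu \<in> tuples n. \<exists>i\<in>{1..n}. nu = add_box mu i \<or> mu = add_box nu i}"

lemma finite_successors: "finite (successors mu)"
proof -
  have "successors mu \<subseteq> add_box mu ` {1..n} \<union> remove_box mu ` {1..n}"
  proof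
    fix nu assume "nu \<in> successors mu"
    then obtain i where i: "i \<in> {1..n}" "length nu = n" "nu = add_box mu i \<or> mu = add_box nu i"
      by (auto simp: successors_def tuples_def)
    then have "nu = add_box mu i \<or> nu = remove_box mu i" using remove_add_box[of i nu] by auto
    then show "nu \<in> add_box mu ` {1..n} \<union> remove_box mu ` {1..n}" using i(1) by auto
  qed
  then show ?thesis by (rule finite_subset) simp
qed

lemma Lweight_nonzero: "Lweight n q mu nu \<noteq> 0 \<Longrightarrow> \<exists>i\<in>{1..n}. nu = add_box mu i \<or> mu = add_box nu i"
  unfolding Lweight_def by (rule ccontr) auto

lemma Lweight_nonneg: "0 \<le> Lweight n q mu nu"
  unfolding Lweight_def u_plus_def u_minus_def
  using power_le_1 by (intro sum_nonneg add_nonneg_nonneg) auto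

lemma set_pmf_insertion:
  assumes n: "1 \<le> n" and Z: "Z \<in> patterns_of_shape n mu" and l: "l \<in> alphabet n"
  shows "set_pmf (insertion n q l Z) \<subseteq> (\<Union>nu\<in>successors mu. patterns_of_shape n nu)"
proof
  fix Z' assume "Z' \<in> set_pmf (insertion n q l Z)"
  then have "0 < letter_prob n a l * insertion_kernel n q l Z Z'"
    using letter_prob_pos[OF n l] by (simp add: insertion_kernel_def pmf_positive)
  also have "\<dots> \<le> pattern_kernel n q a Z Z'"
    unfolding pattern_kernel_def
    by (intro member_le_sum l finite_alphabet mult_nonneg_nonneg less_imp_le[OF letter_prob_pos[OF n]])
       (auto simp: insertion_kernel_def)
  finally have "pattern_kernel n q a Z Z' \<noteq> 0" by simp
  then have "Z' \<in> patterns n" "Lweight n q mu (level Z' (2 * n)) \<noteq> 0"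
    using pattern_kernel_eq_0[OF n, of Z Z'] Z by (auto simp: patterns_of_shape_def)
  then show "Z' \<in> (\<Union>nu\<in>successors mu. patterns_of_shape n nu)"
    using top_level_tuples[OF n] Lweight_nonzero by (auto simp: patterns_of_shape_def successors_def)
qed

lemma sum_pattern_kernel:
  assumes n: "1 \<le> n" and Z: "Z \<in> patterns_of_shape n mu"
  shows "(\<Sum>Z'\<in>(\<Union>nu\<in>successors mu. patterns_of_shape n nu). pattern_kernel n q a Z Z') = 1"
proof -
  have "(\<Sum>Z'\<in>(\<Union>nu\<in>successors mu. patterns_of_shape n nu). pattern_kernel n q a Z Z')
      = (\<Sum>l\<in>alphabet n. letter_prob n a l
          * (\<Sum>Z'\<in>(\<Union>nu\<in>successors mu. patterns_of_shape n nu). pmf (insertion n q l Z) Z'))"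
    unfolding pattern_kernel_def insertion_kernel_def by (subst sum.swap) (simp add: sum_distrib_left)
  also have "\<dots> = (\<Sum>l\<in>alphabet n. letter_prob n a l * 1)"
    using set_pmf_insertion[OF n Z]
    by (intro sum.cong refl arg_cong2[of _ _ _ _ "(*)"] sum_pmf_eq_1)
       (auto simp: finite_successors finite_patterns_of_shape)
  finally show ?thesis using sum_letter_prob[OF n] by simp
qed

lemma pattern_kernel_has_sum:
  assumes n: "1 \<le> n" and Z: "Z \<in> patterns n"
  shows "(pattern_kernel n q a Z has_sum 1) (patterns n)"
proof -
  define G where "G = (\<Union>nu\<in>successors (level Z (2 * n)). patterns_of_shape n nu)"
  have G: "finite G" "G \<subseteq> patterns n"
    unfolding G_def by (intro finite_UN_I finite_successors finite_patterns_of_shape)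
      (auto simp: patterns_of_shape_def)
  have "(pattern_kernel n q a Z has_sum 1) G"
    using sum_pattern_kernel[OF n, of Z "level Z (2 * n)"] Z G has_sum_finite[of G "pattern_kernel n q a Z"]
    by (simp add: G_def patterns_of_shape_def)
  moreover have "pattern_kernel n q a Z Z' = 0" if "Z' \<in> patterns n - G" for Z'
  proof (rule pattern_kernel_eq_0[OF n Z], rule disjI2, rule ccontr)
    assume "Lweight n q (level Z (2 * n)) (level Z' (2 * n)) \<noteq> 0"
    then have "Z' \<in> G" using that top_level_tuples[OF n, of Z'] Lweight_nonzero
      by (auto simp: G_def successors_def patterns_of_shape_def)
    then show False using that by simp
  qed
  ultimately show ?thesis
    using G has_sum_cong_neutral[of G "patterns n" "pattern_kernel n q a Z" "pattern_kernel n q a Z" 1] by auto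
qed

lemma shape_kernel_nonneg: "1 \<le> n \<Longrightarrow> mu \<in> tuples n \<Longrightarrow> nu \<in> tuples n \<Longrightarrow> 0 \<le> shape_kernel n q a mu nu"
  unfolding shape_kernel_def using normalizer_pos qP_pos[of mu] qP_pos[of nu] Lweight_nonneg
  by (intro mult_nonneg_nonneg) (auto simp: less_imp_le)

text \<open>Summing the intertwining relation over Z', with the rows of
  \<open>pattern_kernel\<close> summing to 1, leaves \<open>qP\<close> of \<open>mu\<close> on one
  side and the \<open>Lweight\<close> sum on the other.\<close>

lemma shape_kernel_has_sum:
  assumes n: "1 \<le> n" and mu: "mu \<in> tuples n"
  shows "(shape_kernel n q a mu has_sum 1) (tuples n)"
proof -
  define G where "G = (\<Union>nu\<in>successors mu. patterns_of_shape n nu)"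
  have "(\<Sum>nu\<in>successors mu. qP n q a nu * Lweight n q mu nu / normalizer n a)
      = (\<Sum>nu\<in>successors mu. \<Sum>Z'\<in>patterns_of_shape n nu. weight Z' * Lweight n q mu (level Z' (2 * n)) / normalizer n a)"
    unfolding qP_eq sum_distrib_right sum_divide_distrib
    by (intro sum.cong refl) (auto simp: patterns_of_shape_def)
  also have "\<dots> = (\<Sum>Z'\<in>G. weight Z' * Lweight n q mu (level Z' (2 * n)) / normalizer n a)"
    unfolding G_def
    by (intro sum.UNION_disjoint[symmetric])
       (auto simp: finite_successors finite_patterns_of_shape, auto simp: patterns_of_shape_def)
  also have "\<dots> = (\<Sum>Z'\<in>G. \<Sum>Z\<in>patterns_of_shape n mu. weight Z * pattern_kernel n q a Z Z')"
    using intertwining[OF n mu] by (intro sum.cong refl) (auto simp: G_def patterns_of_shape_def)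
  also have "\<dots> = (\<Sum>Z\<in>patterns_of_shape n mu. weight Z * (\<Sum>Z'\<in>G. pattern_kernel n q a Z Z'))"
    by (subst sum.swap) (simp add: sum_distrib_left)
  also have "\<dots> = qP n q a mu"
    unfolding qP_eq G_def by (intro sum.cong refl) (simp add: sum_pattern_kernel[OF n])
  finally have "(\<Sum>nu\<in>successors mu. shape_kernel n q a mu nu) = 1"
    using qP_pos[OF mu] normalizer_pos[OF n]
    by (simp add: shape_kernel_def sum_divide_distrib[symmetric] field_simps flip: sum_distrib_left)
  then have "(shape_kernel n q a mu has_sum 1) (successors mu)"
    using has_sum_finite[OF finite_successors[of mu], of "shape_kernel n q a mu"] by simp
  moreover have "shape_kernel n q a mu nu = 0" if "nu \<in> tuples n - successors mu" for nu
    using that Lweight_nonzero[of mu nu] by (auto simp: shape_kernel_def successors_def)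
  moreover have "successors mu \<subseteq> tuples n" by (auto simp: successors_def)
  ultimately show ?thesis
    using has_sum_cong_neutral[of "successors mu" "tuples n" "shape_kernel n q a mu" "shape_kernel n q a mu" 1]
    by auto
qed

text \<open>Being the only pattern of its shape, with weight 1, the starting point already has the
  conditional law claimed for later times.\<close>

lemma zero_pattern:
  shows "zero_pattern n \<in> patterns_of_shape n (replicate n 0)" "weight (zero_pattern n) = 1"
    "Z \<in> patterns_of_shape n (replicate n 0) \<Longrightarrow> Z = zero_pattern n"
proof -
  have lev: "level (zero_pattern n) k = replicate ((k + 1) div 2) 0" if "k \<le> 2 * n" for k
    using that by (auto simp: level_def zero_pattern_def simp del: upt_Suc)
  have sh: "shaped (zero_pattern n)"
    using lev unfolding shaped_def by (auto simp: zero_pattern_def simp del: upt_Suc)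
  have c0: "coord (replicate m 0) i = 0" for m i by (cases i) (auto simp: coord_def)
  have "branch_weight k (level (zero_pattern n) (k - 1)) (level (zero_pattern n) k) = 1" if k: "k \<in> {1..2 * n}" for k
  proof -
    have "k - 1 \<le> 2 * n" using k by auto
    from lev[OF this] lev[of k] k show ?thesis
    by (simp add: branch_weight_def branch_prod_def c0 qbin_def qbinom_def qpoch_def sum_list_replicate)
  qed
  then show w: "weight (zero_pattern n) = 1" by (simp add: weight_def)
  show "zero_pattern n \<in> patterns_of_shape n (replicate n 0)"
    using w sh lev[of "2 * n"] by (simp add: patterns_of_shape_def patterns_iff_weight)
  show "Z = zero_pattern n" if "Z \<in> patterns_of_shape n (replicate n 0)"
  proof -
    have Z: "Z \<in> patterns n" and top: "level Z (2 * n) = replicate n 0"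
      using that by (auto simp: patterns_of_shape_def)
    have shZ: "shaped Z" using Z by (simp add: patterns_iff_weight)
    have zero: "coord (level Z k) i = 0" if "k \<le> 2 * n" "1 \<le> i" for k i
      using that(1)
    proof (induction k rule: inc_induct)
      case (step k)
      then show ?case
        using interlacesD(1)[OF pattern_interlaces[OF Z, of "Suc k"] that(2)] by auto
    qed (simp add: top c0)
    show ?thesis
    proof (rule nth_equalityI)
      show "length Z = length (zero_pattern n)" using sh shZ by (simp add: shaped_def)
      fix j assume "j < length Z"
      then have j: "j + 1 \<le> 2 * n" using shZ by (simp add: shaped_def)
      have "level Z (j + 1) = level (zero_pattern n) (j + 1)"
      proof (rule nth_equalityI)
        show "length (level Z (j + 1)) = length (level (zero_pattern n) (j + 1))"
          using shapedD[OF shZ j] shapedD[OF sh j] by simp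
        fix i assume i: "i < length (level Z (j + 1))"
        then have "level (zero_pattern n) (j + 1) ! i = 0"
          unfolding lev[OF j] shapedD[OF shZ j] by (rule nth_replicate)
        with i show "level Z (j + 1) ! i = level (zero_pattern n) (j + 1) ! i"
          using zero[OF j, of "i + 1"] by (simp add: coord_def)
      qed
      then show "Z ! j = zero_pattern n ! j" by (simp add: level_def)
    qed
  qed
qed

end

section \<open>The driven process\<close>

locale q_berele_chain = berele n q a for n q a +
  fixes M :: "'a measure" and w :: "nat \<Rightarrow> 'a \<Rightarrow> letter"
    and S :: "'b measure" and u :: "nat \<Rightarrow> 'a \<Rightarrow> 'b"
    and ins :: "letter \<Rightarrow> pattern \<Rightarrow> 'b \<Rightarrow> pattern"
    and Z :: "nat \<Rightarrow> 'a \<Rightarrow> pattern"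
  assumes n: "1 \<le> n"
    and process: "q_berele_process n q a M w S u ins Z"
begin

sublocale prob_space M
  using process by (simp add: q_berele_process_def)

lemma indep: "indep_vars (\<lambda>_. count_space (alphabet n) \<Otimes>\<^sub>M S) (\<lambda>m \<omega>. (w m \<omega>, u m \<omega>)) {1..}"
  using process unfolding q_berele_process_def by (elim conjE)

lemma indep_letter: "1 \<le> m \<Longrightarrow> l \<in> alphabet n \<Longrightarrow> B \<in> sets S \<Longrightarrow>
    \<P>(\<omega> in M. w m \<omega> = l \<and> u m \<omega> \<in> B) = \<P>(\<omega> in M. w m \<omega> = l) * \<P>(\<omega> in M. u m \<omega> \<in> B)"
  using process unfolding q_berele_process_def by (elim conjE) blast

lemma letter_law: "1 \<le> m \<Longrightarrow> l \<in> alphabet n \<Longrightarrow> \<P>(\<omega> in M. w m \<omega> = l) = letter_prob n a l"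
  using process unfolding q_berele_process_def by (elim conjE) blast

lemma measurable_ins: "l \<in> alphabet n \<Longrightarrow> ins l z \<in> S \<rightarrow>\<^sub>M count_space UNIV"
  using process unfolding q_berele_process_def by (elim conjE) blast

lemma ins_law: "1 \<le> m \<Longrightarrow> l \<in> alphabet n \<Longrightarrow> z \<in> patterns n \<Longrightarrow>
    \<P>(\<omega> in M. ins l z (u m \<omega>) = z') = insertion_kernel n q l z z'"
  using process unfolding q_berele_process_def by (elim conjE) blast

lemma Z_0: "\<omega> \<in> space M \<Longrightarrow> Z 0 \<omega> = zero_pattern n"
  using process unfolding q_berele_process_def by (elim conjE) blast

lemma Z_Suc: "\<omega> \<in> space M \<Longrightarrow> Z (Suc m) \<omega> = ins (w (Suc m) \<omega>) (Z m \<omega>) (u (Suc m) \<omega>)"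
proof -
  assume "\<omega> \<in> space M"
  then have "Z (Suc m) \<omega> = ins (w (Suc m) \<omega>) (Z (Suc m - 1) \<omega>) (u (Suc m) \<omega>)"
    using process unfolding q_berele_process_def by (elim conjE) (metis le_add1 plus_1_eq_Suc)
  then show ?thesis by simp
qed

text \<open>
  An event on the path \<open>Z 0, ..., Z m\<close> is an intersection of such events for the independent pairs
  \<open>(w i, u i)\<close>, so path probabilities factor without conditioning.
\<close>

definition transition :: "pattern \<Rightarrow> pattern \<Rightarrow> (letter \<times> 'b) set" where
  "transition z z' = (\<Union>l\<in>alphabet n. {l} \<times> (ins l z -` {z'} \<inter> space S))"

lemma transition_sets: "transition z z' \<in> sets (count_space (alphabet n) \<Otimes>\<^sub>M S)"
  unfolding transition_def
proof (intro sets.finite_UN finite_alphabet pair_measureI)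
  fix l assume l: "l \<in> alphabet n"
  show "ins l z -` {z'} \<inter> space S \<in> sets S" by (rule measurable_sets[OF measurable_ins[OF l]]) simp
  show "{l} \<in> sets (count_space (alphabet n))" using l by simp
qed

lemma measurable_pair: "1 \<le> m \<Longrightarrow> (\<lambda>\<omega>. (w m \<omega>, u m \<omega>)) \<in> M \<rightarrow>\<^sub>M count_space (alphabet n) \<Otimes>\<^sub>M S"
  using indep unfolding indep_vars_def by blast

lemma w_alphabet: "1 \<le> m \<Longrightarrow> \<omega> \<in> space M \<Longrightarrow> w m \<omega> \<in> alphabet n"
  and u_space: "1 \<le> m \<Longrightarrow> \<omega> \<in> space M \<Longrightarrow> u m \<omega> \<in> space S"
  using measurable_space[OF measurable_pair, of m \<omega>] by (auto simp: space_pair_measure)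

lemma transition_event:
  "1 \<le> m \<Longrightarrow> (\<lambda>\<omega>. (w m \<omega>, u m \<omega>)) -` transition z z' \<inter> space M = {\<omega> \<in> space M. ins (w m \<omega>) z (u m \<omega>) = z'}"
  by (auto simp: transition_def w_alphabet u_space)

lemma transition_measurable: "1 \<le> m \<Longrightarrow> {\<omega> \<in> space M. ins (w m \<omega>) z (u m \<omega>) = z'} \<in> events"
  using measurable_sets[OF measurable_pair transition_sets, of m z z'] transition_event[of m z z'] by simp

lemma transition_prob:
  assumes m: "1 \<le> m" and z: "z \<in> patterns n"
  shows "\<P>(\<omega> in M. ins (w m \<omega>) z (u m \<omega>) = z') = pattern_kernel n q a z z'"
proof -
  have wm: "w m \<in> M \<rightarrow>\<^sub>M count_space (alphabet n)" and um: "u m \<in> M \<rightarrow>\<^sub>M S"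
    using measurable_compose[OF measurable_pair[OF m] measurable_fst]
      measurable_compose[OF measurable_pair[OF m] measurable_snd] by simp_all
  have B: "ins l z -` {z'} \<inter> space S \<in> sets S" if "l \<in> alphabet n" for l
    using measurable_sets[OF measurable_ins[OF that], of "{z'}" z] by simp
  have ev: "{\<omega> \<in> space M. w m \<omega> = l \<and> u m \<omega> \<in> ins l z -` {z'} \<inter> space S} \<in> events"
    if l: "l \<in> alphabet n" for l
  proof -
    have "{\<omega> \<in> space M. w m \<omega> = l \<and> u m \<omega> \<in> ins l z -` {z'} \<inter> space S}
        = (w m -` {l} \<inter> space M) \<inter> (u m -` (ins l z -` {z'} \<inter> space S) \<inter> space M)" by auto
    also have "\<dots> \<in> events"
      using measurable_sets[OF wm, of "{l}"] measurable_sets[OF um B[OF l]] l by auto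
    finally show ?thesis .
  qed
  have "\<P>(\<omega> in M. ins (w m \<omega>) z (u m \<omega>) = z')
      = (\<Sum>l\<in>alphabet n. \<P>(\<omega> in M. w m \<omega> = l \<and> u m \<omega> \<in> ins l z -` {z'} \<inter> space S))"
    using ev transition_measurable[OF m] w_alphabet[OF m] u_space[OF m]
    by (intro prob_sum AE_I2) auto
  also have "\<dots> = (\<Sum>l\<in>alphabet n. letter_prob n a l * insertion_kernel n q l z z')"
  proof (intro sum.cong refl)
    fix l assume l: "l \<in> alphabet n"
    have "{\<omega> \<in> space M. u m \<omega> \<in> ins l z -` {z'} \<inter> space S} = {\<omega> \<in> space M. ins l z (u m \<omega>) = z'}"
      using u_space[OF m] by auto
    then show "\<P>(\<omega> in M. w m \<omega> = l \<and> u m \<omega> \<in> ins l z -` {z'} \<inter> space S)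
        = letter_prob n a l * insertion_kernel n q l z z'"
      unfolding indep_letter[OF m l B[OF l]] letter_law[OF m l] by (simp add: ins_law[OF m l z])
  qed
  finally show ?thesis by (simp add: pattern_kernel_def)
qed

lemma path_prob:
  assumes x: "\<And>i. i \<le> m \<Longrightarrow> x i \<in> patterns n"
  shows "\<P>(\<omega> in M. \<forall>i\<le>m. Z i \<omega> = x i)
    = of_bool (x 0 = zero_pattern n) * (\<Prod>i<m. pattern_kernel n q a (x i) (x (Suc i)))"
proof (cases "x 0 = zero_pattern n")
  case False
  then have "{\<omega> \<in> space M. \<forall>i\<le>m. Z i \<omega> = x i} = {}" using Z_0 by fastforce
  then have "\<P>(\<omega> in M. \<forall>i\<le>m. Z i \<omega> = x i) = 0" by (simp only: measure_empty)
  then show ?thesis using False by simp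
next
  case True
  \<comment> \<open>On the event of a prescribed path the previous state may be replaced by the
    constant x (i - 1). This decouples the steps.\<close>
  have eq: "{\<omega> \<in> space M. \<forall>i\<le>k. Z i \<omega> = x i}
      = {\<omega> \<in> space M. \<forall>i\<in>{1..k}. ins (w i \<omega>) (x (i - 1)) (u i \<omega>) = x i}" for k
  proof (induction k)
    case 0
    then show ?case using True Z_0 by auto
  next
    case (Suc k)
    have "{\<omega> \<in> space M. \<forall>i\<le>Suc k. Z i \<omega> = x i}
        = {\<omega> \<in> space M. \<forall>i\<le>k. Z i \<omega> = x i} \<inter> {\<omega> \<in> space M. ins (w (Suc k) \<omega>) (x k) (u (Suc k) \<omega>) = x (Suc k)}"
    proof -
      have "(\<forall>i\<le>Suc k. Z i \<omega> = x i) \<longleftrightarrow>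
          (\<forall>i\<le>k. Z i \<omega> = x i) \<and> ins (w (Suc k) \<omega>) (x k) (u (Suc k) \<omega>) = x (Suc k)"
        if "\<omega> \<in> space M" for \<omega>
      proof -
        have "(\<forall>i\<le>Suc k. Z i \<omega> = x i) \<longleftrightarrow> (\<forall>i\<le>k. Z i \<omega> = x i) \<and> Z (Suc k) \<omega> = x (Suc k)"
          by (auto simp: le_Suc_eq)
        then show ?thesis using Z_Suc[OF that, of k] by (cases "Z k \<omega> = x k") auto
      qed
      then show ?thesis by blast
    qed
    also have "\<dots> = {\<omega> \<in> space M. \<forall>i\<in>{1..Suc k}. ins (w i \<omega>) (x (i - 1)) (u i \<omega>) = x i}"
      unfolding Suc.IH by (auto simp: atLeastAtMostSuc_conv)
    finally show ?case .
  qed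
  show ?thesis
  proof (cases "m = 0")
    case m0: True
    then have "{\<omega> \<in> space M. \<forall>i\<le>m. Z i \<omega> = x i} = space M" using True Z_0 by auto
    then show ?thesis using True m0 by (simp add: prob_space)
  next
    case False
    have "{\<omega> \<in> space M. \<forall>i\<le>m. Z i \<omega> = x i}
        = (\<Inter>i\<in>{1..m}. (\<lambda>\<omega>. (w i \<omega>, u i \<omega>)) -` transition (x (i - 1)) (x i) \<inter> space M)"
    proof -
      have "(\<Inter>i\<in>{1..m}. (\<lambda>\<omega>. (w i \<omega>, u i \<omega>)) -` transition (x (i - 1)) (x i) \<inter> space M)
          = (\<Inter>i\<in>{1..m}. {\<omega> \<in> space M. ins (w i \<omega>) (x (i - 1)) (u i \<omega>) = x i})"
        by (intro INF_cong refl transition_event) simp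
      also have "\<dots> = {\<omega> \<in> space M. \<forall>i\<in>{1..m}. ins (w i \<omega>) (x (i - 1)) (u i \<omega>) = x i}"
      proof (rule set_eqI)
        fix \<omega>
        show "\<omega> \<in> (\<Inter>i\<in>{1..m}. {\<omega> \<in> space M. ins (w i \<omega>) (x (i - 1)) (u i \<omega>) = x i})
          \<longleftrightarrow> \<omega> \<in> {\<omega> \<in> space M. \<forall>i\<in>{1..m}. ins (w i \<omega>) (x (i - 1)) (u i \<omega>) = x i}"
          using False by (cases "\<omega> \<in> space M") auto
      qed
      finally show ?thesis unfolding eq by simp
    qed
    also have "prob \<dots> = (\<Prod>i\<in>{1..m}. prob ((\<lambda>\<omega>. (w i \<omega>, u i \<omega>)) -` transition (x (i - 1)) (x i) \<inter> space M))"
      using False by (intro indep_varsD[OF indep] transition_sets) auto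
    also have "\<dots> = (\<Prod>i\<in>{1..m}. pattern_kernel n q a (x (i - 1)) (x i))"
    proof (intro prod.cong refl)
      fix i assume "i \<in> {1..m}"
      then have "1 \<le> i" "x (i - 1) \<in> patterns n" using x by auto
      then show "prob ((\<lambda>\<omega>. (w i \<omega>, u i \<omega>)) -` transition (x (i - 1)) (x i) \<inter> space M)
          = pattern_kernel n q a (x (i - 1)) (x i)"
        by (simp add: transition_event transition_prob del: One_nat_def)
    qed
    also have "\<dots> = (\<Prod>i<m. pattern_kernel n q a (x i) (x (Suc i)))"
      by (rule prod.reindex_bij_witness[of _ Suc "\<lambda>i. i - 1"]) auto
    finally show ?thesis using True by simp
  qed
qed

text \<open>Patterns form a countable type, so singletons suffice, and their preimages split over
  the countably many previous states.\<close>

lemma measurable_Z [measurable]: "Z m \<in> M \<rightarrow>\<^sub>M count_space UNIV"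
proof (induction m)
  case 0
  have "(\<lambda>\<omega>. zero_pattern n) \<in> M \<rightarrow>\<^sub>M count_space UNIV" by simp
  then show ?case by (rule measurable_cong[THEN iffD2, rotated]) (rule Z_0)
next
  case (Suc m)
  have "Z (Suc m) -` {z'} \<inter> space M \<in> events" for z'
  proof -
    have "Z (Suc m) -` {z'} \<inter> space M
        = (\<Union>z. (Z m -` {z} \<inter> space M) \<inter> {\<omega> \<in> space M. ins (w (Suc m) \<omega>) z (u (Suc m) \<omega>) = z'})"
      using Z_Suc by auto
    also have "\<dots> \<in> events"
      using measurable_sets[OF Suc] transition_measurable[of "Suc m"]
      by (intro sets.countable_UN' sets.Int) auto
    finally show ?thesis .
  qed
  then show ?case by (subst measurable_count_space_eq2_countable) auto
qed

text \<open>The transitions of probability 0 are countably many and can be excluded together.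
  Transitions out of \<open>patterns n\<close> are among them.\<close>

lemma AE_transition: "AE \<omega> in M. \<forall>m. Z m \<omega> \<in> patterns n \<and> pattern_kernel n q a (Z m \<omega>) (Z (Suc m) \<omega>) \<noteq> 0"
proof -
  have "AE \<omega> in M. \<not> (ins (w (Suc m) \<omega>) z (u (Suc m) \<omega>) = z')"
    if "z \<in> patterns n" "pattern_kernel n q a z z' = 0" for m z z'
  proof -
    have "\<P>(\<omega> in M. ins (w (Suc m) \<omega>) z (u (Suc m) \<omega>) = z') = 0"
      using transition_prob[of "Suc m" z z'] that by simp
    then show ?thesis
      using transition_measurable[of "Suc m" z z'] by (subst (asm) prob_eq_0) auto
  qed
  then have "AE \<omega> in M. \<forall>m z z'. z \<in> patterns n \<longrightarrow> pattern_kernel n q a z z' = 0 \<longrightarrow>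
      \<not> (ins (w (Suc m) \<omega>) z (u (Suc m) \<omega>) = z')"
    by (subst AE_all_countable)+ auto
  then show ?thesis
  proof (rule AE_mp, intro AE_I2 impI allI)
    fix \<omega> m
    assume \<omega>: "\<omega> \<in> space M" and *: "\<forall>m z z'. z \<in> patterns n \<longrightarrow> pattern_kernel n q a z z' = 0 \<longrightarrow>
      \<not> (ins (w (Suc m) \<omega>) z (u (Suc m) \<omega>) = z')"
    have step: "pattern_kernel n q a (Z m \<omega>) (Z (Suc m) \<omega>) \<noteq> 0" if "Z m \<omega> \<in> patterns n" for m
      using * that Z_Suc[OF \<omega>, of m] by metis
    have "Z m \<omega> \<in> patterns n"
    proof (induction m)
      case 0
      then show ?case using zero_pattern(1) Z_0[OF \<omega>] by (simp add: patterns_of_shape_def)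
    next
      case (Suc m)
      then show ?case using step[OF Suc] pattern_kernel_eq_0[OF n Suc] by blast
    qed
    with step show "Z m \<omega> \<in> patterns n \<and> pattern_kernel n q a (Z m \<omega>) (Z (Suc m) \<omega>) \<noteq> 0" by blast
  qed
qed

theorem Z_markov: "markov_chain_on M (patterns n) (pattern_kernel n q a) Z"
  unfolding markov_chain_on_def
proof (intro conjI ballI allI impI)
  show "0 \<le> pattern_kernel n q a z z'" for z z' by (rule pattern_kernel_nonneg[OF n])
  show "(pattern_kernel n q a z has_sum 1) (patterns n)" if "z \<in> patterns n" for z
    by (rule pattern_kernel_has_sum[OF n that])
  show "Z m \<in> M \<rightarrow>\<^sub>M count_space UNIV" for m by (rule measurable_Z)
  show "AE \<omega> in M. Z m \<omega> \<in> patterns n" for m using AE_transition by (auto elim: AE_mp)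
next
  fix m and x :: "nat \<Rightarrow> pattern"
  assume x: "\<forall>i\<le>m + 1. x i \<in> patterns n" and pos: "\<P>(\<omega> in M. \<forall>i\<le>m. Z i \<omega> = x i) > 0"
  have "{\<omega> \<in> space M. Z (m + 1) \<omega> = x (m + 1) \<and> (\<forall>i\<le>m. Z i \<omega> = x i)} = {\<omega> \<in> space M. \<forall>i\<le>Suc m. Z i \<omega> = x i}"
    by (auto simp: le_Suc_eq)
  then show "\<P>(\<omega> in M. Z (m + 1) \<omega> = x (m + 1) \<bar> \<forall>i\<le>m. Z i \<omega> = x i) = pattern_kernel n q a (x m) (x (m + 1))"
  proof -
    assume ev: "{\<omega> \<in> space M. Z (m + 1) \<omega> = x (m + 1) \<and> (\<forall>i\<le>m. Z i \<omega> = x i)}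
      = {\<omega> \<in> space M. \<forall>i\<le>Suc m. Z i \<omega> = x i}"
    have "\<P>(\<omega> in M. \<forall>i\<le>Suc m. Z i \<omega> = x i)
        = \<P>(\<omega> in M. \<forall>i\<le>m. Z i \<omega> = x i) * pattern_kernel n q a (x m) (x (m + 1))"
      using path_prob[of m x] path_prob[of "Suc m" x] x by simp
    then show ?thesis unfolding cond_prob_def ev using pos by simp
  qed
qed

section \<open>The shape process and its joint law with the pattern\<close>

definition f :: "nat \<Rightarrow> 'a \<Rightarrow> nat list" where
  "f m \<omega> = level (Z m \<omega>) (2 * n)"

lemma measurable_f [measurable]: "f m \<in> M \<rightarrow>\<^sub>M count_space UNIV"
  unfolding f_def by (rule measurable_compose[OF measurable_Z]) simp

lemma f_0: "\<omega> \<in> space M \<Longrightarrow> f 0 \<omega> = replicate n 0"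
  using zero_pattern(1) by (simp add: f_def Z_0 patterns_of_shape_def)

lemma AE_f: "AE \<omega> in M. \<forall>m. f m \<omega> \<in> tuples n \<and> Lweight n q (f m \<omega>) (f (Suc m) \<omega>) \<noteq> 0"
  using AE_transition
proof (rule AE_mp, intro AE_I2 impI allI)
  fix \<omega> m
  assume "\<forall>m. Z m \<omega> \<in> patterns n \<and> pattern_kernel n q a (Z m \<omega>) (Z (Suc m) \<omega>) \<noteq> 0"
  then show "f m \<omega> \<in> tuples n \<and> Lweight n q (f m \<omega>) (f (Suc m) \<omega>) \<noteq> 0"
    using top_level_tuples[OF n] pattern_kernel_eq_0[OF n] unfolding f_def by blast
qed

text \<open>The part of the path probability that does not depend on the final pattern; summing over
  that pattern contributes \<open>qP\<close>.\<close>

definition shape_path_weight :: "nat \<Rightarrow> (nat \<Rightarrow> nat list) \<Rightarrow> real" where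
  "shape_path_weight m g
     = of_bool (g 0 = replicate n 0) * (\<Prod>i<m. Lweight n q (g i) (g (Suc i))) / normalizer n a ^ m"

text \<open>A history of shapes mixes many pattern paths. Almost surely they form a finite disjoint
  family \<open>I\<close>, and \<open>path_prob\<close> applies to each member.\<close>

lemma joint_step:
  assumes g: "\<And>i. i \<le> m \<Longrightarrow> g i \<in> tuples n" and z: "z \<in> patterns n" and z': "z' \<in> patterns n"
  shows "\<P>(\<omega> in M. (\<forall>i\<le>m. f i \<omega> = g i) \<and> Z m \<omega> = z \<and> Z (Suc m) \<omega> = z')
    = \<P>(\<omega> in M. (\<forall>i\<le>m. f i \<omega> = g i) \<and> Z m \<omega> = z) * pattern_kernel n q a z z'"
proof -
  define I where "I = {h. length h = Suc m \<and> (\<forall>i\<le>m. h ! i \<in> patterns_of_shape n (g i)) \<and> h ! m = z}"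
  have "I \<subseteq> {h. set h \<subseteq> (\<Union>i\<le>m. patterns_of_shape n (g i)) \<and> length h = Suc m}"
  proof
    fix h assume h: "h \<in> I"
    have "v \<in> (\<Union>i\<le>m. patterns_of_shape n (g i))" if "v \<in> set h" for v
    proof -
      from that obtain i where "i < length h" "v = h ! i" by (auto simp: in_set_conv_nth)
      with h show ?thesis by (auto simp: I_def less_Suc_eq_le)
    qed
    with h show "h \<in> {h. set h \<subseteq> (\<Union>i\<le>m. patterns_of_shape n (g i)) \<and> length h = Suc m}"
      by (auto simp: I_def)
  qed
  then have I: "finite I"
    by (rule finite_subset) (intro finite_lists_length_eq finite_UN_I finite_atMost finite_patterns_of_shape)
  define on_shape where "on_shape = (\<lambda>\<omega>. (\<forall>i\<le>m. f i \<omega> = g i) \<and> Z m \<omega> = z)"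
  define on_path where "on_path = (\<lambda>h \<omega>. \<forall>i\<le>m. Z i \<omega> = h ! i)"
  have uniq: "AE \<omega> in M. (\<forall>h\<in>I. on_path h \<omega> \<longrightarrow> on_shape \<omega>) \<and> (on_shape \<omega> \<longrightarrow> (\<exists>!h\<in>I. on_path h \<omega>))"
    using AE_transition
  proof (rule AE_mp, intro AE_I2 impI)
    fix \<omega>
    assume Z: "\<forall>m. Z m \<omega> \<in> patterns n \<and> pattern_kernel n q a (Z m \<omega>) (Z (Suc m) \<omega>) \<noteq> 0"
    define H where "H = map (\<lambda>i. Z i \<omega>) [0..<Suc m]"
    have H: "length H = Suc m" "\<And>i. i \<le> m \<Longrightarrow> H ! i = Z i \<omega>"
      by (auto simp: H_def simp del: upt_Suc)
    have 1: "on_shape \<omega>" if "h \<in> I" "on_path h \<omega>" for h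
      using that by (auto simp: I_def f_def patterns_of_shape_def on_path_def on_shape_def)
    have 2: "H \<in> I" "on_path H \<omega>" if "on_shape \<omega>"
      using that Z H by (auto simp: I_def f_def patterns_of_shape_def on_path_def on_shape_def)
    have 3: "h = H" if "h \<in> I" "on_path h \<omega>" for h
      by (rule nth_equalityI) (use that H in \<open>auto simp: I_def on_path_def less_Suc_eq_le\<close>)
    show "(\<forall>h\<in>I. on_path h \<omega> \<longrightarrow> on_shape \<omega>) \<and> (on_shape \<omega> \<longrightarrow> (\<exists>!h\<in>I. on_path h \<omega>))"
      using 1 2 3 by blast
  qed
  have meas: "{\<omega> \<in> space M. on_shape \<omega>} \<in> events" "{\<omega> \<in> space M. on_path h \<omega>} \<in> events"
    "{\<omega> \<in> space M. Z (Suc m) \<omega> = z'} \<in> events" for h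
    unfolding on_shape_def on_path_def by measurable
  have 1: "\<P>(\<omega> in M. on_shape \<omega>) = (\<Sum>h\<in>I. \<P>(\<omega> in M. on_path h \<omega>))"
    by (rule prob_sum[OF I meas(2,1) uniq])
  have 2: "\<P>(\<omega> in M. on_shape \<omega> \<and> Z (Suc m) \<omega> = z')
      = (\<Sum>h\<in>I. \<P>(\<omega> in M. on_path h \<omega> \<and> Z (Suc m) \<omega> = z'))"
  proof (rule prob_sum[OF I])
    show "AE \<omega> in M. (\<forall>h\<in>I. on_path h \<omega> \<and> Z (Suc m) \<omega> = z' \<longrightarrow> on_shape \<omega> \<and> Z (Suc m) \<omega> = z')
        \<and> (on_shape \<omega> \<and> Z (Suc m) \<omega> = z' \<longrightarrow> (\<exists>!h\<in>I. on_path h \<omega> \<and> Z (Suc m) \<omega> = z'))"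
      by (rule AE_mp[OF uniq]) (intro AE_I2 impI, blast)
  qed (intro sets.sets_Collect_conj meas)+
  have "\<P>(\<omega> in M. on_path h \<omega> \<and> Z (Suc m) \<omega> = z')
      = \<P>(\<omega> in M. on_path h \<omega>) * pattern_kernel n q a z z'" if h: "h \<in> I" for h
  proof -
    define x where "x = (\<lambda>i. if i = Suc m then z' else h ! i)"
    have x: "x i \<in> patterns n" if "i \<le> Suc m" for i
      using h that z' by (auto simp: x_def I_def patterns_of_shape_def le_Suc_eq)
    have ev: "{\<omega> \<in> space M. on_path h \<omega> \<and> Z (Suc m) \<omega> = z'} = {\<omega> \<in> space M. \<forall>i\<le>Suc m. Z i \<omega> = x i}"
      "{\<omega> \<in> space M. on_path h \<omega>} = {\<omega> \<in> space M. \<forall>i\<le>m. Z i \<omega> = x i}"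
      by (auto simp: x_def le_Suc_eq on_path_def)
    have "pattern_kernel n q a (x m) (x (Suc m)) = pattern_kernel n q a z z'"
      using h by (simp add: x_def I_def)
    then show ?thesis
      using path_prob[of m x] path_prob[of "Suc m" x] x unfolding ev by simp
  qed
  then have "\<P>(\<omega> in M. on_shape \<omega> \<and> Z (Suc m) \<omega> = z') = \<P>(\<omega> in M. on_shape \<omega>) * pattern_kernel n q a z z'"
    unfolding 1 2 sum_distrib_right by (intro sum.cong) auto
  then show ?thesis by (simp add: on_shape_def conj_assoc)
qed

lemma joint_law:
  assumes g: "\<And>i. i \<le> m \<Longrightarrow> g i \<in> tuples n" and z: "z \<in> patterns_of_shape n (g m)"
  shows "\<P>(\<omega> in M. (\<forall>i\<le>m. f i \<omega> = g i) \<and> Z m \<omega> = z) = shape_path_weight m g * weight z"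
  using assms
proof (induction m arbitrary: z)
  case 0
  show ?case
  proof (cases "g 0 = replicate n 0")
    case True
    then have "z = zero_pattern n" using zero_pattern(3) 0 by simp
    then have "{\<omega> \<in> space M. (\<forall>i\<le>0. f i \<omega> = g i) \<and> Z 0 \<omega> = z} = space M"
      using f_0 Z_0 True by auto
    then show ?thesis
      using \<open>z = zero_pattern n\<close> zero_pattern(2) True by (simp add: shape_path_weight_def prob_space)
  next
    case False
    then have "{\<omega> \<in> space M. (\<forall>i\<le>0. f i \<omega> = g i) \<and> Z 0 \<omega> = z} = {}" using f_0 by auto
    then have "\<P>(\<omega> in M. (\<forall>i\<le>0. f i \<omega> = g i) \<and> Z 0 \<omega> = z) = 0" by (simp only: measure_empty)
    then show ?thesis using False by (simp add: shape_path_weight_def)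
  qed
next
  case (Suc m)
  define K where "K = patterns_of_shape n (g m)"
  have K: "finite K" by (simp add: K_def finite_patterns_of_shape)
  have z: "z \<in> patterns n" "level z (2 * n) = g (Suc m)" using Suc.prems by (auto simp: patterns_of_shape_def)
  have "\<P>(\<omega> in M. (\<forall>i\<le>Suc m. f i \<omega> = g i) \<and> Z (Suc m) \<omega> = z)
      = (\<Sum>z0\<in>K. \<P>(\<omega> in M. (\<forall>i\<le>m. f i \<omega> = g i) \<and> Z m \<omega> = z0 \<and> Z (Suc m) \<omega> = z))"
  proof (rule prob_sum[OF K])
    show "AE \<omega> in M. (\<forall>z0\<in>K. (\<forall>i\<le>m. f i \<omega> = g i) \<and> Z m \<omega> = z0 \<and> Z (Suc m) \<omega> = z
          \<longrightarrow> (\<forall>i\<le>Suc m. f i \<omega> = g i) \<and> Z (Suc m) \<omega> = z)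
        \<and> ((\<forall>i\<le>Suc m. f i \<omega> = g i) \<and> Z (Suc m) \<omega> = z
          \<longrightarrow> (\<exists>!z0\<in>K. (\<forall>i\<le>m. f i \<omega> = g i) \<and> Z m \<omega> = z0 \<and> Z (Suc m) \<omega> = z))"
      using AE_transition
    proof (rule AE_mp, intro AE_I2 impI)
      fix \<omega> assume "\<forall>m. Z m \<omega> \<in> patterns n \<and> pattern_kernel n q a (Z m \<omega>) (Z (Suc m) \<omega>) \<noteq> 0"
      then have "Z m \<omega> \<in> K \<longleftrightarrow> f m \<omega> = g m" by (auto simp: K_def patterns_of_shape_def f_def)
      moreover have "(\<forall>i\<le>Suc m. f i \<omega> = g i) \<and> Z (Suc m) \<omega> = z \<longleftrightarrow> (\<forall>i\<le>m. f i \<omega> = g i) \<and> Z (Suc m) \<omega> = z"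
        using z(2) by (auto simp: le_Suc_eq f_def)
      ultimately show "(\<forall>z0\<in>K. (\<forall>i\<le>m. f i \<omega> = g i) \<and> Z m \<omega> = z0 \<and> Z (Suc m) \<omega> = z
          \<longrightarrow> (\<forall>i\<le>Suc m. f i \<omega> = g i) \<and> Z (Suc m) \<omega> = z)
        \<and> ((\<forall>i\<le>Suc m. f i \<omega> = g i) \<and> Z (Suc m) \<omega> = z
          \<longrightarrow> (\<exists>!z0\<in>K. (\<forall>i\<le>m. f i \<omega> = g i) \<and> Z m \<omega> = z0 \<and> Z (Suc m) \<omega> = z))"
        by blast
    qed
  qed measurable
  also have "\<dots> = (\<Sum>z0\<in>K. shape_path_weight m g * (weight z0 * pattern_kernel n q a z0 z))"
  proof (intro sum.cong refl)
    fix z0 assume "z0 \<in> K"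
    then show "\<P>(\<omega> in M. (\<forall>i\<le>m. f i \<omega> = g i) \<and> Z m \<omega> = z0 \<and> Z (Suc m) \<omega> = z)
        = shape_path_weight m g * (weight z0 * pattern_kernel n q a z0 z)"
      using joint_step[of m g z0 z] Suc.IH[of z0] Suc.prems z(1)
      by (simp add: K_def patterns_of_shape_def)
  qed
  also have "\<dots> = shape_path_weight m g * (weight z * Lweight n q (g m) (g (Suc m)) / normalizer n a)"
    using intertwining[OF n, of "g m" z] Suc.prems(1)[of m] z
    by (simp add: sum_distrib_left[symmetric] K_def)
  also have "\<dots> = shape_path_weight (Suc m) g * weight z"
    by (simp add: shape_path_weight_def mult_ac)
  finally show ?case .
qed

lemma shape_law:
  assumes g: "\<And>i. i \<le> m \<Longrightarrow> g i \<in> tuples n"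
  shows "\<P>(\<omega> in M. \<forall>i\<le>m. f i \<omega> = g i) = shape_path_weight m g * qP n q a (g m)"
proof -
  have "\<P>(\<omega> in M. \<forall>i\<le>m. f i \<omega> = g i)
      = (\<Sum>z\<in>patterns_of_shape n (g m). \<P>(\<omega> in M. (\<forall>i\<le>m. f i \<omega> = g i) \<and> Z m \<omega> = z))"
  proof (rule prob_sum[OF finite_patterns_of_shape])
    show "AE \<omega> in M. (\<forall>z\<in>patterns_of_shape n (g m). (\<forall>i\<le>m. f i \<omega> = g i) \<and> Z m \<omega> = z
          \<longrightarrow> (\<forall>i\<le>m. f i \<omega> = g i))
        \<and> ((\<forall>i\<le>m. f i \<omega> = g i)
          \<longrightarrow> (\<exists>!z\<in>patterns_of_shape n (g m). (\<forall>i\<le>m. f i \<omega> = g i) \<and> Z m \<omega> = z))"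
      using AE_transition
    proof (rule AE_mp, intro AE_I2 impI)
      fix \<omega> assume "\<forall>m. Z m \<omega> \<in> patterns n \<and> pattern_kernel n q a (Z m \<omega>) (Z (Suc m) \<omega>) \<noteq> 0"
      then have "Z m \<omega> \<in> patterns_of_shape n (g m) \<longleftrightarrow> f m \<omega> = g m" by (auto simp: patterns_of_shape_def f_def)
      then show "(\<forall>z\<in>patterns_of_shape n (g m). (\<forall>i\<le>m. f i \<omega> = g i) \<and> Z m \<omega> = z
          \<longrightarrow> (\<forall>i\<le>m. f i \<omega> = g i))
        \<and> ((\<forall>i\<le>m. f i \<omega> = g i)
          \<longrightarrow> (\<exists>!z\<in>patterns_of_shape n (g m). (\<forall>i\<le>m. f i \<omega> = g i) \<and> Z m \<omega> = z))"
        by blast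
    qed
  qed measurable
  also have "\<dots> = (\<Sum>z\<in>patterns_of_shape n (g m). shape_path_weight m g * weight z)"
    by (intro sum.cong refl joint_law g)
  finally show ?thesis by (simp add: qP_eq sum_distrib_left)
qed

text \<open>In the path law \<open>qP\<close> occurs only at the endpoint, so the ratio of
  consecutive path probabilities is the Doob transform of \<open>Lweight\<close> by
  \<open>qP\<close>.\<close>

theorem f_markov: "markov_chain_on M (tuples n) (shape_kernel n q a) f"
  unfolding markov_chain_on_def
proof (intro conjI ballI allI impI)
  show "0 \<le> shape_kernel n q a x y" if "x \<in> tuples n" "y \<in> tuples n" for x y
    using shape_kernel_nonneg[OF n] that by blast
  show "(shape_kernel n q a x has_sum 1) (tuples n)" if "x \<in> tuples n" for x
    by (rule shape_kernel_has_sum[OF n that])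
  show "f m \<in> M \<rightarrow>\<^sub>M count_space UNIV" for m by (rule measurable_f)
  show "AE \<omega> in M. f m \<omega> \<in> tuples n" for m using AE_f by (auto elim: AE_mp)
next
  fix m and x :: "nat \<Rightarrow> nat list"
  assume x: "\<forall>i\<le>m + 1. x i \<in> tuples n" and pos: "\<P>(\<omega> in M. \<forall>i\<le>m. f i \<omega> = x i) > 0"
  have "{\<omega> \<in> space M. f (m + 1) \<omega> = x (m + 1) \<and> (\<forall>i\<le>m. f i \<omega> = x i)} = {\<omega> \<in> space M. \<forall>i\<le>Suc m. f i \<omega> = x i}"
    by (auto simp: le_Suc_eq)
  then have "\<P>(\<omega> in M. f (m + 1) \<omega> = x (m + 1) \<bar> \<forall>i\<le>m. f i \<omega> = x i)
      = shape_path_weight (Suc m) x * qP n q a (x (Suc m)) / (shape_path_weight m x * qP n q a (x m))"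
    using shape_law[of m x] shape_law[of "Suc m" x] x by (simp add: cond_prob_def)
  moreover have "shape_path_weight m x \<noteq> 0" using pos shape_law[of m x] x by auto
  moreover have "shape_path_weight (Suc m) x = shape_path_weight m x * Lweight n q (x m) (x (Suc m)) / normalizer n a"
    by (simp add: shape_path_weight_def)
  ultimately show "\<P>(\<omega> in M. f (m + 1) \<omega> = x (m + 1) \<bar> \<forall>i\<le>m. f i \<omega> = x i) = shape_kernel n q a (x m) (x (m + 1))"
    by (simp add: shape_kernel_def mult_ac)
qed

theorem conditional_law:
  assumes m: "1 \<le> m" and pos: "\<P>(\<omega> in M. \<forall>i\<in>{1..m}. f i \<omega> = g i) > 0" and z: "z \<in> patterns n"
  shows "\<P>(\<omega> in M. Z m \<omega> = z \<bar> \<forall>i\<in>{1..m}. f i \<omega> = g i)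
     = weight z * of_bool (level z (2 * n) = g m) / qP n q a (g m)"
proof -
  \<comment> \<open>The conditioning starts at time 1, while the joint law includes time 0, where
    the shape is deterministic.\<close>
  define g' where "g' = g(0 := replicate n 0)"
  have eq: "(\<forall>i\<in>{1..m}. f i \<omega> = g i) \<longleftrightarrow> (\<forall>i\<le>m. f i \<omega> = g' i)" if "\<omega> \<in> space M" for \<omega>
    using f_0[OF that] by (auto simp: g'_def Suc_le_eq)
  have g'm: "g' m = g m" using m by (simp add: g'_def)
  \<comment> \<open>A prescribed shape outside \<open>tuples n\<close> would make the conditioning
    event null.\<close>
  have g': "g' i \<in> tuples n" if "i \<le> m" for i
  proof (rule ccontr)
    assume "g' i \<notin> tuples n"
    then have "AE \<omega> in M. \<not> (\<forall>i\<in>{1..m}. f i \<omega> = g i)"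
      using AE_f
    proof (elim AE_mp, intro AE_I2 impI)
      fix \<omega> assume "\<omega> \<in> space M" "\<forall>m. f m \<omega> \<in> tuples n \<and> Lweight n q (f m \<omega>) (f (Suc m) \<omega>) \<noteq> 0"
      then show "\<not> (\<forall>i\<in>{1..m}. f i \<omega> = g i)" using eq that \<open>g' i \<notin> tuples n\<close> by metis
    qed
    then have "\<P>(\<omega> in M. \<forall>i\<in>{1..m}. f i \<omega> = g i) = 0"
      by (intro prob_eq_0_AE)
    then show False using pos by simp
  qed
  have den: "\<P>(\<omega> in M. \<forall>i\<in>{1..m}. f i \<omega> = g i) = shape_path_weight m g' * qP n q a (g m)"
    using shape_law[of m g'] g' eq g'm by (simp cong: conj_cong)
  have num: "\<P>(\<omega> in M. Z m \<omega> = z \<and> (\<forall>i\<in>{1..m}. f i \<omega> = g i))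
      = shape_path_weight m g' * (weight z * of_bool (level z (2 * n) = g m))"
  proof (cases "level z (2 * n) = g m")
    case True
    have "{\<omega> \<in> space M. Z m \<omega> = z \<and> (\<forall>i\<in>{1..m}. f i \<omega> = g i)}
        = {\<omega> \<in> space M. (\<forall>i\<le>m. f i \<omega> = g' i) \<and> Z m \<omega> = z}" using eq by auto
    then show ?thesis
      using joint_law[of m g' z] g' g'm z True by (simp add: patterns_of_shape_def)
  next
    case False
    then have "{\<omega> \<in> space M. Z m \<omega> = z \<and> (\<forall>i\<in>{1..m}. f i \<omega> = g i)} = {}"
      using m by (auto simp: f_def)
    then have "\<P>(\<omega> in M. Z m \<omega> = z \<and> (\<forall>i\<in>{1..m}. f i \<omega> = g i)) = 0" by (simp only: measure_empty)
    then show ?thesis using False by simp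
  qed
  have "shape_path_weight m g' \<noteq> 0" using pos den by auto
  then show ?thesis unfolding cond_prob_def num den by simp
qed

section \<open>Marginal law as a sum over oscillating tableaux\<close>

lemma finite_osc_tableaux: "finite (osc_tableaux n m)"
proof (induction m)
  case 0
  have "osc_tableaux n 0 \<subseteq> {[replicate n 0]}"
    by (auto simp: osc_tableaux_def length_Suc_conv)
  then show ?case by (rule finite_subset) simp
next
  case (Suc m)
  have "osc_tableaux n (Suc m) \<subseteq> (\<lambda>(h, x). h @ [x]) ` (SIGMA h:osc_tableaux n m. successors (h ! m))"
  proof
    fix h assume h: "h \<in> osc_tableaux n (Suc m)"
    then have len: "length h = Suc (Suc m)" by (simp add: osc_tableaux_def)
    have "butlast h ! i = h ! i" if "i \<le> m" for i using that len by (simp add: nth_butlast)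
    then have "butlast h \<in> osc_tableaux n m"
      using h len by (auto simp: osc_tableaux_def dest: in_set_butlastD)
    moreover have "h = butlast h @ [h ! Suc m]"
      using len append_butlast_last_id[of h] last_conv_nth[of h] by fastforce
    moreover have "h ! Suc m \<in> successors (butlast h ! m)"
      using h len by (auto simp: osc_tableaux_def successors_def nth_butlast)
    ultimately show "h \<in> (\<lambda>(h, x). h @ [x]) ` (SIGMA h:osc_tableaux n m. successors (h ! m))"
      by (intro image_eqI[of _ _ "(butlast h, h ! Suc m)"]) auto
  qed
  then show ?case
    by (rule finite_subset) (intro finite_imageI finite_SigmaI Suc finite_successors)
qed

theorem marginal_law:
  assumes nu: "nu \<in> tuples n"
  shows "\<P>(\<omega> in M. f m \<omega> = nu) = 1 / normalizer n a ^ m * qP n q a nu * Qfun n q m nu"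
proof -
  define I where "I = {h \<in> osc_tableaux n m. h ! m = nu}"
  have I: "finite I" by (simp add: I_def finite_osc_tableaux)
  define on_path where "on_path = (\<lambda>h \<omega>. \<forall>i\<le>m. f i \<omega> = h ! i)"
  have "\<P>(\<omega> in M. f m \<omega> = nu) = (\<Sum>h\<in>I. \<P>(\<omega> in M. on_path h \<omega>))"
  proof (rule prob_sum[OF I])
    show "AE \<omega> in M. (\<forall>h\<in>I. on_path h \<omega> \<longrightarrow> f m \<omega> = nu) \<and> (f m \<omega> = nu \<longrightarrow> (\<exists>!h\<in>I. on_path h \<omega>))"
      using AE_f
    proof (rule AE_mp, intro AE_I2 impI)
      fix \<omega>
      assume \<omega>: "\<omega> \<in> space M" and L: "\<forall>m. f m \<omega> \<in> tuples n \<and> Lweight n q (f m \<omega>) (f (Suc m) \<omega>) \<noteq> 0"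
      define H where "H = map (\<lambda>i. f i \<omega>) [0..<Suc m]"
      have H: "length H = Suc m" "\<And>i. i \<le> m \<Longrightarrow> H ! i = f i \<omega>" "set H \<subseteq> tuples n"
        using L by (auto simp: H_def simp del: upt_Suc)
      have 1: "f m \<omega> = nu" if "h \<in> I" "on_path h \<omega>" for h
        using that by (auto simp: I_def on_path_def)
      \<comment> \<open>Almost surely every step has nonzero \<open>Lweight\<close>, so consecutive
        shapes differ by one box.\<close>
      have 2: "H \<in> I" if "f m \<omega> = nu"
        using H L Lweight_nonzero f_0[OF \<omega>] that by (simp add: I_def osc_tableaux_def)
      have 3: "on_path H \<omega>" using H by (simp add: on_path_def)
      have 4: "h = H" if "h \<in> I" "on_path h \<omega>" for h
        by (rule nth_equalityI) (use that H in \<open>auto simp: I_def on_path_def osc_tableaux_def less_Suc_eq_le\<close>)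
      show "(\<forall>h\<in>I. on_path h \<omega> \<longrightarrow> f m \<omega> = nu) \<and> (f m \<omega> = nu \<longrightarrow> (\<exists>!h\<in>I. on_path h \<omega>))"
        using 1 2 3 4 by blast
    qed
    show "{\<omega> \<in> space M. on_path h \<omega>} \<in> events" for h
      unfolding on_path_def by measurable
    show "{\<omega> \<in> space M. f m \<omega> = nu} \<in> events" by measurable
  qed
  also have "\<dots> = (\<Sum>h\<in>I. 1 / normalizer n a ^ m * qP n q a nu * (\<Prod>i=1..m. Lweight n q (h ! (i - 1)) (h ! i)))"
  proof (intro sum.cong refl)
    fix h assume h: "h \<in> I"
    then have "h ! i \<in> tuples n" if "i \<le> m" for i
      using that by (auto simp: I_def osc_tableaux_def)
    then have "\<P>(\<omega> in M. on_path h \<omega>) = shape_path_weight m (\<lambda>i. h ! i) * qP n q a nu"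
      using shape_law[of m "\<lambda>i. h ! i"] h by (simp add: on_path_def I_def)
    also have "(\<Prod>i<m. Lweight n q (h ! i) (h ! Suc i)) = (\<Prod>i=1..m. Lweight n q (h ! (i - 1)) (h ! i))"
      by (rule prod.reindex_bij_witness[of _ "\<lambda>i. i - 1" Suc]) auto
    then have "shape_path_weight m (\<lambda>i. h ! i) = (\<Prod>i=1..m. Lweight n q (h ! (i - 1)) (h ! i)) / normalizer n a ^ m"
      using h by (simp add: shape_path_weight_def I_def osc_tableaux_def)
    finally show "\<P>(\<omega> in M. on_path h \<omega>)
        = 1 / normalizer n a ^ m * qP n q a nu * (\<Prod>i=1..m. Lweight n q (h ! (i - 1)) (h ! i))"
      by simp
  qed
  finally show ?thesis by (simp add: Qfun_def I_def sum_distrib_left)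
qed

end

theorem theorem5:
  fixes n :: nat and q :: real and a :: "nat \<Rightarrow> real"
    and M :: "'a measure" and w :: "nat \<Rightarrow> 'a \<Rightarrow> letter"
    and S :: "'b measure" and u :: "nat \<Rightarrow> 'a \<Rightarrow> 'b"
    and ins :: "letter \<Rightarrow> pattern \<Rightarrow> 'b \<Rightarrow> pattern"
    and Z :: "nat \<Rightarrow> 'a \<Rightarrow> pattern" and f :: "nat \<Rightarrow> 'a \<Rightarrow> nat list"
  assumes n: "n \<ge> 1"
    and q: "0 < q" "q < 1"
    and a: "\<forall>i\<in>{1..n}. a i > 0"
    and process: "q_berele_process n q a M w S u ins Z"
    and f: "\<forall>m. \<forall>\<omega>. f m \<omega> = level (Z m \<omega>) (2 * n)"
  shows "markov_chain_on M (patterns n) (pattern_kernel n q a) Z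
       \<and> markov_chain_on M (tuples n) (shape_kernel n q a) f
       \<and> (\<forall>m\<ge>1. \<forall>g lam. g m = lam \<longrightarrow> \<P>(\<omega> in M. \<forall>i\<in>{1..m}. f i \<omega> = g i) > 0 \<longrightarrow>
            (\<forall>z\<in>patterns n.
               \<P>(\<omega> in M. Z m \<omega> = z \<bar> \<forall>i\<in>{1..m}. f i \<omega> = g i)
                 = pattern_monomial n a z * kappa n q z * of_bool (level z (2 * n) = lam)
                     / qP n q a lam))
       \<and> (\<forall>m. \<forall>lam\<in>tuples n.
            \<P>(\<omega> in M. f m \<omega> = lam) = 1 / normalizer n a ^ m * qP n q a lam * Qfun n q m lam)"
proof -
  interpret chain: q_berele_chain n q a M w S u ins Z
    using n q a process by unfold_locales auto
  have "f = chain.f" using f by (intro ext) (simp add: chain.f_def)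
  then show ?thesis
    using chain.Z_markov chain.f_markov chain.conditional_law chain.marginal_law
    by (auto simp: chain.weight_eq)
qed

end
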